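(* Let $\gamma=(\bar x_1,\bar x_2,\bar x_3):(a,b)\to\mathbb{R}^{1,2}$ be a smooth immersed curve with $\bar x_1'(t)-\bar x_2'(t)\neq0$ and $\bar x_3'(t)\neq0$ for all $t\in(a,b)$, and let $t_0\in(a,b)$. Then: 1. There exist an interval $(\bar a,\bar b)\subset(a,b)$ containing $t_0$ and functions $p,p_0,q,q_0,v:(\bar a,\bar b)\to\mathbb{R}$, with $p_0=q_0$, such that the curve $\sigma_0:(\bar a,\bar b)\to N_1$ with coordinates $(p(t),p_0(t),q(t),q_0(t),v(t),\bar x_1(t),\bar x_2(t),\bar x_3(t))$ is a non-characteristic integral curve of the Pfaffian system $V^1$ on $N_1$, and such that for each $t\in(\bar a,\bar b)$ the vector $$e_3(t)=\left(-\frac{p_0^2(p^2+1)-q_0^2(q^2+1)}{2p_0q_0(p-q)},\ -\frac{p_0^2(p^2-1)-q_0^2(q^2-1)}{2p_0q_0(p-q)},\ \frac{p_0^2p-q_0^2q}{p_0q_0(p-q)}\right)$$ is contained in the lightlike plane in $T_{\gamma(t)}\mathbb{R}^{1,2}$ defined by $z_1=z_2$, where $(x_i,z_i)$ are the canonical coordinates on $T\mathbb{R}^{1,2}$. 2. These functions then determine a decomposition (unique up to constants of integration) $\sigma(t)=\sigma_+(t)*\sigma_-(t)$ of the curve $\sigma=\psi\circ\sigma_0:(\bar a,\bar b)\to N_2$, where $\sigma_+:(\bar a,\bar b)\to\widehat M_1$ and $\sigma_-:(\bar a,\bar b)\to\widehat M_2$ are integral curves of the singular systems $\widehat\theta_1$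 and $\widehat\theta_2$ respectively, and hence a unique 2-dimensional integral manifold $\iota_2:(\bar a,\bar b)\times(\bar a,\bar b)\to N_2$ of $V^2$ given by $\iota_2(t_1,t_2)=\sigma_+(t_1)*\sigma_-(t_2)$. 3. Provided $\iota_2$ satisfies the independence condition $du\wedge dv\neq0$, the composition $\pi\circ\psi^{-1}\circ\iota_2:(\bar a,\bar b)\times(\bar a,\bar b)\to\mathbb{R}^{1,2}$ defines a local isometric embedding of an open subset of $(M,\mathbf{g}_0)$ into $\mathbb{R}^{1,2}$ whose image contains the curve $\gamma((\bar a,\bar b))$. 4. If the component functions of $\gamma$ satisfy the relation $$-4\left((\bar x_1')^2-(\bar x_2')^2-(\bar x_3')^2\right)t^6+2(\bar x_1'-\bar x_2')^4-(\bar x_1'-\bar x_2')^3(\bar x_1''-\bar x_2'')\,t=0,$$ then all these constructions may be performed using only quadratures.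
   Context: $\mathbb{R}^{1,2}$ is $\mathbb{R}^3$ with the flat metric $dx_1^2-dx_2^2-dx_3^2$. $(M,\mathbf{g}_0)$ is the Lorentzian surface with coordinates $(u,v)$, $u\neq0$, and metric $\mathbf{g}_0=u^2(dv^2-du^2)$. $N_1\subset\mathbb{R}^8$ is the region $p\ne q$, $p_0q_0\ne0$ with coordinates $(p,p_0,q,q_0,v,x_1,x_2,x_3)$; $N_2$ is the same region with coordinates $(p,p_0,q,q_0,v,y_1,y_2,y_3)$. The diffeomorphism $\psi:N_1\to N_2$ preserves $p,p_0,q,q_0,v$ and is given on the remaining coordinates by $$y_1=x_1-\tfrac18p_0^2q_0^2(p-q)(1+pq),\quad y_2=x_2+\tfrac18p_0^2q_0^2(p-q)(1-pq),\quad y_3=x_3+\tfrac18p_0^2q_0^2(p^2-q^2).$$ (These are coordinates on an open part of the product of $M$ with the orthonormal frame bundle of $\mathbb{R}^{1,2}$, adapted to the first integrals of the isometric embedding system of $\mathbf{g}_0$; $e_3$ is the unit normal frame vector.) The $M$-coordinate $u$ is the function $u=\tfrac12p_0q_0(q-p)$, and $\pi:N_1\to\mathbb{R}^{1,2}$ is $\pi=(x_1,x_2,x_3)$. When $du\wedge dv\neq0$ on a surface parametrized by $(t_1,t_2)$, the functions $(u,v)$ of $(t_1,t_2)$ identify pieces of the parameter domain locally with open subsets of $M$; "defines a local isometric embedding" is understood via this identification. $V^2$ is the Pfaffian system on $N_2$ spanned by $$dv+\tfrac12p_0^2dp-\tfrac12q_0^2dq,\quad dy_1+\tfrac18p_0^4(p^2+1)dp-\tfrac18q_0^4(q^2+1)dq,$$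 $$dy_2+\tfrac18p_0^4(p^2-1)dp-\tfrac18q_0^4(q^2-1)dq,\quad dy_3-\tfrac14p\,p_0^4dp+\tfrac14q\,q_0^4dq,$$ and $V^1=\psi^*V^2$ on $N_1$. Integral surfaces are immersed surfaces on which the 1-forms of $V^2$ and the 2-forms $dp\wedge dp_0$, $dq\wedge dq_0$ vanish. The singular systems on $N_2$ are $V^2_+=V^2+\operatorname{span}\{dq,dq_0\}$ and $V^2_-=V^2+\operatorname{span}\{dp,dp_0\}$, and $V^1_\pm=\psi^*V^2_\pm$. An integral curve of $V^1$ is non-characteristic if its tangent vector is never annihilated by all of $V^1_+$ or by all of $V^1_-$ (i.e. $(p',p_0')\neq(0,0)$ and $(q',q_0')\neq(0,0)$ everywhere). $\widehat M_1=\mathbb{R}^6$ with coordinates $(p,p_0,v^+,y_1^+,y_2^+,y_3^+)$ carries the Pfaffian system $$\widehat\theta_1=\{dv^++\tfrac12p_0^2dp,\ dy_1^++\tfrac18p_0^4(p^2+1)dp,\ dy_2^++\tfrac18p_0^4(p^2-1)dp,\ dy_3^+-\tfrac14p\,p_0^4dp\},$$ and $\widehat M_2=\mathbb{R}^6$ with coordinates $(q,q_0,v^-,y_1^-,y_2^-,y_3^-)$ carries $$\widehat\theta_2=\{dv^--\tfrac12q_0^2dq,\ dy_1^--\tfrac18q_0^4(q^2+1)dq,\ dy_2^--\tfrac18q_0^4(q^2-1)dq,\ dy_3^-+\tfrac14q\,q_0^4dq\}.$$ For points $m_1\in\widehat M_1$, $m_2\in\widehat M_2$ define $$m_1*m_2=(p,p_0,q,q_0,\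 v^++v^-,\ y_1^++y_1^-,\ y_2^++y_2^-,\ y_3^++y_3^-).$$ "Using only quadratures" means that all the functions involved are obtained from $t$ and the components of $\gamma$ by differentiation, algebraic operations and taking antiderivatives, with no other differential equation to solve. *)

theory Defs
  imports "HOL-Analysis.Analysis"
begin

(* C^k and smooth maps.  Both notions are meant for open S only, since the derivatives are
   taken at points of S in the full space.  Quantifying over all directions h gives the usual
   C^k in finite dimension. *)
primrec Ck_on ::
  "nat \<Rightarrow> 'a::real_normed_vector set \<Rightarrow> ('a \<Rightarrow> 'b::real_normed_vector) \<Rightarrow> bool" where
  "Ck_on 0 S f \<longleftrightarrow> continuous_on S f"
| "Ck_on (Suc k) S f \<longleftrightarrow>
     (\<forall>x\<in>S. f differentiable (at x)) \<and>
     (\<forall>h. Ck_on k S (\<lambda>x. frechet_derivative f (at x) h))"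

definition smooth_on ::
  "'a::real_normed_vector set \<Rightarrow> ('a \<Rightarrow> 'b::real_normed_vector) \<Rightarrow> bool" where
  "smooth_on S f \<longleftrightarrow> (\<forall>k. Ck_on k S f)"


(* Differential forms on a vector space: a 1-form takes a base point and a tangent vector.
   A Pfaffian system is represented by a set of generating 1-forms; a tangent vector is
   annihilated by the span of the generators iff it is annihilated by the generators. *)
type_synonym 'a one_form = "'a \<Rightarrow> 'a \<Rightarrow> real"
type_synonym 'a two_form = "'a \<Rightarrow> 'a \<Rightarrow> 'a \<Rightarrow> real"

definition ext_d :: "('a::real_normed_vector \<Rightarrow> real) \<Rightarrow> 'a one_form" where
  "ext_d f = (\<lambda>m X. frechet_derivative f (at m) X)"

definition wedge :: "'a one_form \<Rightarrow> 'a one_form \<Rightarrow> 'a two_form" where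
  "wedge \<theta> \<eta> = (\<lambda>m X Y. \<theta> m X * \<eta> m Y - \<theta> m Y * \<eta> m X)"

definition pullback1 ::
  "('a::real_normed_vector \<Rightarrow> 'b::real_normed_vector) \<Rightarrow> 'b one_form \<Rightarrow> 'a one_form" where
  "pullback1 f \<theta> = (\<lambda>m X. \<theta> (f m) (frechet_derivative f (at m) X))"

definition integral_curve ::
  "'a::real_normed_vector set \<Rightarrow> 'a one_form set \<Rightarrow> real set \<Rightarrow> (real \<Rightarrow> 'a) \<Rightarrow> bool" where
  "integral_curve N \<Theta> J c \<longleftrightarrow>
     smooth_on J c \<and> c ` J \<subseteq> N \<and>
     (\<forall>t\<in>J. vector_derivative c (at t) \<noteq> 0) \<and>
     (\<forall>t\<in>J. \<forall>\<theta>\<in>\<Theta>. \<theta> (c t) (vector_derivative c (at t)) = 0)"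

definition integral_surface ::
  "'a::real_normed_vector set \<Rightarrow> 'a one_form set \<Rightarrow> 'a two_form set \<Rightarrow>
   (real \<times> real) set \<Rightarrow> (real \<times> real \<Rightarrow> 'a) \<Rightarrow> bool" where
  "integral_surface N \<Theta> \<Omega> D \<iota> \<longleftrightarrow>
     smooth_on D \<iota> \<and> \<iota> ` D \<subseteq> N \<and>
     (\<forall>z\<in>D. inj (frechet_derivative \<iota> (at z))) \<and>
     (\<forall>z\<in>D. \<forall>\<theta>\<in>\<Theta>. \<forall>X. \<theta> (\<iota> z) (frechet_derivative \<iota> (at z) X) = 0) \<and>
     (\<forall>z\<in>D. \<forall>\<omega>\<in>\<Omega>. \<forall>X Y.
        \<omega> (\<iota> z) (frechet_derivative \<iota> (at z) X) (frechet_derivative \<iota> (at z) Y) = 0)"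


(* Minkowski space is real^3.  A point of R^8 is (p, p0, q, q0, v, x) with x in real^3, and
   tangent vectors of R^8 are (dp, dp0, dq, dq0, dv, dx).  N_region serves as both N_1 (with
   last entry x) and N_2 (with last entry y). *)
type_synonym pt8 = "real \<times> real \<times> real \<times> real \<times> real \<times> (real^3)"
type_synonym pt6 = "real \<times> real \<times> real \<times> (real^3)"

definition coord :: "(real \<Rightarrow> real^3) \<Rightarrow> 3 \<Rightarrow> real \<Rightarrow> real" where
  "coord \<gamma> i = (\<lambda>t. \<gamma> t $ i)"

definition minkowski :: "real^3 \<Rightarrow> real^3 \<Rightarrow> real" where
  "minkowski X Y = X$1 * Y$1 - X$2 * Y$2 - X$3 * Y$3"

definition M_dom :: "(real \<times> real) set" where
  "M_dom = {(u, v). u \<noteq> 0}"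

definition g0 :: "real \<times> real \<Rightarrow> real \<times> real \<Rightarrow> real \<times> real \<Rightarrow> real" where
  "g0 = (\<lambda>(u, v) (du, dv) (du', dv'). u^2 * (dv * dv' - du * du'))"

definition N_region :: "pt8 set" where
  "N_region = {(p, p0, q, q0, v, x). p \<noteq> q \<and> p0 * q0 \<noteq> 0}"

definition psi :: "pt8 \<Rightarrow> pt8" where
  "psi = (\<lambda>(p, p0, q, q0, v, x). (p, p0, q, q0, v,
     vector [x$1 - 1/8 * p0^2 * q0^2 * (p - q) * (1 + p * q),
             x$2 + 1/8 * p0^2 * q0^2 * (p - q) * (1 - p * q),
             x$3 + 1/8 * p0^2 * q0^2 * (p^2 - q^2)]))"

definition proj_x :: "pt8 \<Rightarrow> real^3" where
  "proj_x = (\<lambda>(p, p0, q, q0, v, x). x)"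

definition u_fun :: "pt8 \<Rightarrow> real" where
  "u_fun = (\<lambda>(p, p0, q, q0, v, x). 1/2 * p0 * q0 * (q - p))"

definition v_fun :: "pt8 \<Rightarrow> real" where
  "v_fun = (\<lambda>(p, p0, q, q0, v, x). v)"

definition form_dp :: "pt8 one_form" where
  "form_dp = (\<lambda>m (dp, dp0, dq, dq0, dv, dy). dp)"

definition form_dp0 :: "pt8 one_form" where
  "form_dp0 = (\<lambda>m (dp, dp0, dq, dq0, dv, dy). dp0)"

definition form_dq :: "pt8 one_form" where
  "form_dq = (\<lambda>m (dp, dp0, dq, dq0, dv, dy). dq)"

definition form_dq0 :: "pt8 one_form" where
  "form_dq0 = (\<lambda>m (dp, dp0, dq, dq0, dv, dy). dq0)"

definition V2 :: "pt8 one_form set" where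
  "V2 =
    {\<lambda>(p, p0, q, q0, v, y) (dp, dp0, dq, dq0, dv, dy).
       dv + 1/2 * p0^2 * dp - 1/2 * q0^2 * dq,
     \<lambda>(p, p0, q, q0, v, y) (dp, dp0, dq, dq0, dv, dy).
       dy$1 + 1/8 * p0^4 * (p^2 + 1) * dp - 1/8 * q0^4 * (q^2 + 1) * dq,
     \<lambda>(p, p0, q, q0, v, y) (dp, dp0, dq, dq0, dv, dy).
       dy$2 + 1/8 * p0^4 * (p^2 - 1) * dp - 1/8 * q0^4 * (q^2 - 1) * dq,
     \<lambda>(p, p0, q, q0, v, y) (dp, dp0, dq, dq0, dv, dy).
       dy$3 - 1/4 * p * p0^4 * dp + 1/4 * q * q0^4 * dq}"

definition V2_two_forms :: "pt8 two_form set" where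
  "V2_two_forms = {wedge form_dp form_dp0, wedge form_dq form_dq0}"

definition V2_plus :: "pt8 one_form set" where
  "V2_plus = V2 \<union> {form_dq, form_dq0}"

definition V2_minus :: "pt8 one_form set" where
  "V2_minus = V2 \<union> {form_dp, form_dp0}"

definition V1 :: "pt8 one_form set" where
  "V1 = pullback1 psi ` V2"

definition V1_plus :: "pt8 one_form set" where
  "V1_plus = pullback1 psi ` V2_plus"

definition V1_minus :: "pt8 one_form set" where
  "V1_minus = pullback1 psi ` V2_minus"

definition noncharacteristic :: "real set \<Rightarrow> (real \<Rightarrow> pt8) \<Rightarrow> bool" where
  "noncharacteristic J c \<longleftrightarrow>
     (\<forall>t\<in>J. (\<exists>\<theta>\<in>V1_plus. \<theta> (c t) (vector_derivative c (at t)) \<noteq> 0) \<and>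
            (\<exists>\<theta>\<in>V1_minus. \<theta> (c t) (vector_derivative c (at t)) \<noteq> 0))"


(* Points of the two copies of R^6 are (p, p0, v+, y+) and (q, q0, v-, y-). *)
definition theta_hat1 :: "pt6 one_form set" where
  "theta_hat1 =
    {\<lambda>(p, p0, v, y) (dp, dp0, dv, dy). dv + 1/2 * p0^2 * dp,
     \<lambda>(p, p0, v, y) (dp, dp0, dv, dy). dy$1 + 1/8 * p0^4 * (p^2 + 1) * dp,
     \<lambda>(p, p0, v, y) (dp, dp0, dv, dy). dy$2 + 1/8 * p0^4 * (p^2 - 1) * dp,
     \<lambda>(p, p0, v, y) (dp, dp0, dv, dy). dy$3 - 1/4 * p * p0^4 * dp}"

definition theta_hat2 :: "pt6 one_form set" where
  "theta_hat2 =
    {\<lambda>(q, q0, v, y) (dq, dq0, dv, dy). dv - 1/2 * q0^2 * dq,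
     \<lambda>(q, q0, v, y) (dq, dq0, dv, dy). dy$1 - 1/8 * q0^4 * (q^2 + 1) * dq,
     \<lambda>(q, q0, v, y) (dq, dq0, dv, dy). dy$2 - 1/8 * q0^4 * (q^2 - 1) * dq,
     \<lambda>(q, q0, v, y) (dq, dq0, dv, dy). dy$3 + 1/4 * q * q0^4 * dq}"

definition star :: "pt6 \<Rightarrow> pt6 \<Rightarrow> pt8" where
  "star = (\<lambda>(p, p0, vp, yp) (q, q0, vm, ym). (p, p0, q, q0, vp + vm, yp + ym))"

definition decomposition ::
  "real set \<Rightarrow> (real \<Rightarrow> pt8) \<Rightarrow> (real \<Rightarrow> pt6) \<Rightarrow> (real \<Rightarrow> pt6) \<Rightarrow> bool" where
  "decomposition J \<sigma> \<sigma>p \<sigma>m \<longleftrightarrow>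
     integral_curve UNIV theta_hat1 J \<sigma>p \<and>
     integral_curve UNIV theta_hat2 J \<sigma>m \<and>
     (\<forall>t\<in>J. \<sigma> t = star (\<sigma>p t) (\<sigma>m t))"

definition iota2 :: "(real \<Rightarrow> pt6) \<Rightarrow> (real \<Rightarrow> pt6) \<Rightarrow> real \<times> real \<Rightarrow> pt8" where
  "iota2 \<sigma>p \<sigma>m = (\<lambda>(t1, t2). star (\<sigma>p t1) (\<sigma>m t2))"

definition surface_map :: "(real \<times> real \<Rightarrow> pt8) \<Rightarrow> real \<times> real \<Rightarrow> real^3" where
  "surface_map \<iota> = proj_x \<circ> inv_into N_region psi \<circ> \<iota>"


definition e3 :: "real \<Rightarrow> real \<Rightarrow> real \<Rightarrow> real \<Rightarrow> real^3" where
  "e3 p p0 q q0 = vector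
     [- (p0^2 * (p^2 + 1) - q0^2 * (q^2 + 1)) / (2 * p0 * q0 * (p - q)),
      - (p0^2 * (p^2 - 1) - q0^2 * (q^2 - 1)) / (2 * p0 * q0 * (p - q)),
      (p0^2 * p - q0^2 * q) / (p0 * q0 * (p - q))]"

definition lightlike_plane :: "(real^3) set" where
  "lightlike_plane = {z. z$1 = z$2}"

definition sigma0 ::
  "(real \<Rightarrow> real^3) \<Rightarrow> (real \<Rightarrow> real) \<Rightarrow> (real \<Rightarrow> real) \<Rightarrow> (real \<Rightarrow> real) \<Rightarrow> (real \<Rightarrow> real) \<Rightarrow>
   (real \<Rightarrow> real) \<Rightarrow> real \<Rightarrow> pt8" where
  "sigma0 \<gamma> p p0 q q0 v = (\<lambda>t. (p t, p0 t, q t, q0 t, v t, \<gamma> t))"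

definition initial_data ::
  "(real \<Rightarrow> real^3) \<Rightarrow> real set \<Rightarrow> (real \<Rightarrow> real) \<Rightarrow> (real \<Rightarrow> real) \<Rightarrow> (real \<Rightarrow> real) \<Rightarrow>
   (real \<Rightarrow> real) \<Rightarrow> (real \<Rightarrow> real) \<Rightarrow> bool" where
  "initial_data \<gamma> J p p0 q q0 v \<longleftrightarrow>
     (\<forall>t\<in>J. p0 t = q0 t) \<and>
     integral_curve N_region V1 J (sigma0 \<gamma> p p0 q q0 v) \<and>
     noncharacteristic J (sigma0 \<gamma> p p0 q q0 v) \<and>
     (\<forall>t\<in>J. e3 (p t) (p0 t) (q t) (q0 t) \<in> lightlike_plane)"


definition independence :: "(real \<times> real) set \<Rightarrow> (real \<times> real \<Rightarrow> pt8) \<Rightarrow> bool" where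
  "independence D \<iota> \<longleftrightarrow>
     (\<forall>z\<in>D. \<exists>X Y. wedge (ext_d u_fun) (ext_d v_fun) (\<iota> z)
        (frechet_derivative \<iota> (at z) X) (frechet_derivative \<iota> (at z) Y) \<noteq> 0)"

definition isometric_embedding ::
  "(real \<times> real) set \<Rightarrow> (real \<times> real \<Rightarrow> real^3) \<Rightarrow> bool" where
  "isometric_embedding U F \<longleftrightarrow>
     open U \<and> U \<subseteq> M_dom \<and> smooth_on U F \<and>
     (\<exists>G. homeomorphism U (F ` U) F G) \<and>
     (\<forall>m\<in>U. inj (frechet_derivative F (at m))) \<and>
     (\<forall>m\<in>U. \<forall>X Y. minkowski (frechet_derivative F (at m) X) (frechet_derivative F (at m) Y)
        = g0 m X Y)"

(* h = (u, v) identifies a neighbourhood W of each parameter value diffeomorphically with an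
   open subset h ` W of M, with inverse G; read through this identification, f is the map f o G. *)
definition local_isometric_embedding_via ::
  "(real \<times> real) set \<Rightarrow> (real \<times> real \<Rightarrow> real \<times> real) \<Rightarrow> (real \<times> real \<Rightarrow> real^3) \<Rightarrow> bool" where
  "local_isometric_embedding_via D h f \<longleftrightarrow>
     (\<forall>z\<in>D. \<exists>W G. open W \<and> z \<in> W \<and> W \<subseteq> D \<and>
        smooth_on W h \<and> smooth_on (h ` W) G \<and> (\<forall>w\<in>W. G (h w) = w) \<and>
        isometric_embedding (h ` W) (f \<circ> G))"


(* Functions obtained from the functions in B by algebraic operations (arithmetic and root
   extraction) on S; only the values on S matter. *)
inductive_set algebraic_in :: "'a set \<Rightarrow> ('a \<Rightarrow> real) set \<Rightarrow> ('a \<Rightarrow> real) set"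
  for S :: "'a set" and B :: "('a \<Rightarrow> real) set" where
  base: "f \<in> B \<Longrightarrow> f \<in> algebraic_in S B"
| const: "(\<lambda>x. c) \<in> algebraic_in S B"
| add: "f \<in> algebraic_in S B \<Longrightarrow> g \<in> algebraic_in S B \<Longrightarrow> (\<lambda>x. f x + g x) \<in> algebraic_in S B"
| diff: "f \<in> algebraic_in S B \<Longrightarrow> g \<in> algebraic_in S B \<Longrightarrow> (\<lambda>x. f x - g x) \<in> algebraic_in S B"
| mult: "f \<in> algebraic_in S B \<Longrightarrow> g \<in> algebraic_in S B \<Longrightarrow> (\<lambda>x. f x * g x) \<in> algebraic_in S B"
| divide: "f \<in> algebraic_in S B \<Longrightarrow> g \<in> algebraic_in S B \<Longrightarrow> (\<And>x. x \<in> S \<Longrightarrow> g x \<noteq> 0) \<Longrightarrow>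
    (\<lambda>x. f x / g x) \<in> algebraic_in S B"
| root: "f \<in> algebraic_in S B \<Longrightarrow> n > 0 \<Longrightarrow> (\<And>x. x \<in> S \<Longrightarrow> f x > 0) \<Longrightarrow>
    (\<lambda>x. root n (f x)) \<in> algebraic_in S B"
| cong: "f \<in> algebraic_in S B \<Longrightarrow> (\<And>x. x \<in> S \<Longrightarrow> g x = f x) \<Longrightarrow> g \<in> algebraic_in S B"

lemma algebraic_inp_mono [mono]:
  assumes "\<And>g. A g \<longrightarrow> B g"
  shows "algebraic_inp S A f \<longrightarrow> algebraic_inp S B f"
proof
  assume "algebraic_inp S A f"
  then show "algebraic_inp S B f"
    by induction (use assms in \<open>auto intro: algebraic_inp.intros\<close>)
qed

(* Functions on the open interval J obtained from those in B by algebraic operations,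
   differentiation and taking antiderivatives. *)
inductive_set quadrature_in :: "real set \<Rightarrow> (real \<Rightarrow> real) set \<Rightarrow> (real \<Rightarrow> real) set"
  for J :: "real set" and B :: "(real \<Rightarrow> real) set" where
  base: "f \<in> B \<Longrightarrow> f \<in> quadrature_in J B"
| algebraic: "f \<in> algebraic_in J (quadrature_in J B) \<Longrightarrow> f \<in> quadrature_in J B"
| derivative: "f \<in> quadrature_in J B \<Longrightarrow>
    (\<And>t. t \<in> J \<Longrightarrow> (f has_real_derivative g t) (at t)) \<Longrightarrow> g \<in> quadrature_in J B"
| antiderivative: "f \<in> quadrature_in J B \<Longrightarrow>
    (\<And>t. t \<in> J \<Longrightarrow> (F has_real_derivative f t) (at t)) \<Longrightarrow> F \<in> quadrature_in J B"

definition by_quadratures :: "(real \<Rightarrow> real^3) \<Rightarrow> real set \<Rightarrow> (real \<Rightarrow> real) set" where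
  "by_quadratures \<gamma> J = quadrature_in J
     {\<lambda>t. t, coord \<gamma> 1, coord \<gamma> 2, coord \<gamma> 3}"

definition by_quadratures2 :: "(real \<Rightarrow> real^3) \<Rightarrow> real set \<Rightarrow> (real \<times> real \<Rightarrow> real) set" where
  "by_quadratures2 \<gamma> J = algebraic_in (J \<times> J)
     ({g \<circ> fst | g. g \<in> by_quadratures \<gamma> J} \<union> {g \<circ> snd | g. g \<in> by_quadratures \<gamma> J})"

end

theory Submission
  imports Defs
begin

text \<open>
  Put \<open>r = p\<^sub>0 = q\<^sub>0\<close>, \<open>w = p - q\<close>, \<open>D = x\<^sub>1' - x\<^sub>2'\<close>, \<open>S = x\<^sub>1' + x\<^sub>2'\<close>, \<open>T = x\<^sub>3'\<close> along the given curve.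
  For \<open>p\<^sub>0 = q\<^sub>0\<close> the vector \<open>e\<^sub>3\<close> lies in the lightlike plane automatically, and the vanishing of the
  forms of \<open>V\<^sup>1\<close> reduces to \<open>p + q = - 2 T / D\<close>, \<open>v' = - r\<^sup>2 w' / 2\<close> and the
  two equations \<open>r\<^sup>3 r' w = D\<close> and \<open>D\<^sup>2 w\<^sup>2 + D r\<^sup>4 w\<^sup>2 w' = 4 (T\<^sup>2 - S D)\<close> (\<open>initial_data_intro\<close>).
  Since \<open>D \<noteq> 0\<close>, the first equation gives \<open>r' \<noteq> 0\<close>, so every solution is non-characteristic.  The substitution \<open>r = 1 / x\<close>, \<open>w = x / y\<close> produces the polynomial system
  \<open>x' = - D y x\<^sup>4\<close>, \<open>y' = - E x y\<^sup>4\<close> with \<open>E = 4 (T\<^sup>2 - S D) / D\<close>, which has a smooth local solution by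
  Picard's theorem (\<open>ode_local_solution\<close>, \<open>initial_data_exists\<close>).  Under the additional relation the
  two equations have the explicit solution \<open>r = t\<close>, \<open>w = D / t\<^sup>3\<close>, and only the antiderivatives \<open>v\<close>, \<open>v\<^sup>+\<close>, \<open>v\<^sup>-\<close>,
  \<open>y\<^sup>+\<close>, \<open>y\<^sup>-\<close> remain to be taken (\<open>initial_data_by_quadratures\<close>, \<open>by_quadratures_of_decomposition\<close>).

  In the coordinates of \<open>N\<^sub>2\<close> the forms of \<open>V\<^sup>2\<close> split into a part in \<open>(p, p\<^sub>0)\<close> and a part in \<open>(q, q\<^sub>0)\<close>.
  Taking antiderivatives of the two parts separately yields \<open>\<sigma>\<^sub>+\<close> and \<open>\<sigma>\<^sub>-\<close>, and this is possible in only
  one way up to constants (\<open>decomposition_exists\<close>, \<open>decomposition_unique\<close>).  The same splitting shows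
  that \<open>\<iota>\<^sub>2(t\<^sub>1, t\<^sub>2) = \<sigma>\<^sub>+(t\<^sub>1) * \<sigma>\<^sub>-(t\<^sub>2)\<close> is an integral surface (\<open>integral_surface_iota2\<close>).

  The isometry is a pointwise polynomial identity: on tangent vectors of \<open>N\<^sub>2\<close> annihilated by \<open>V\<^sup>2\<close>, the
  Minkowski product of the differentials of \<open>\<pi> \<circ> \<psi>\<^sup>-\<^sup>1\<close> equals \<open>u\<^sup>2 (dv\<^sup>2 - du\<^sup>2)\<close> (\<open>minkowski_dx\<close>).  Where
  \<open>du \<and> dv \<noteq> 0\<close>, the inverse function theorem turns \<open>(u, v)\<close> into local coordinates; the induced metric
  is nondegenerate there, so the map into Minkowski space is an immersion, and composing it with a
  linear left inverse of its differential shows that it is locally a homeomorphism onto its image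
  (\<open>local_isometric_embedding_via_intro\<close>).

  Smoothness is understood in terms of iterated directional derivatives, so the closure properties of
  smooth maps, including composition and local inversion, are established first.
\<close>

section \<open>Calculus of smooth maps\<close>

lemma Ck_on_cong:
  assumes "open S" "Ck_on k S f" "\<And>x. x \<in> S \<Longrightarrow> f x = g x"
  shows "Ck_on k S g"
  using assms(2,3)
proof (induction k arbitrary: f g)
  case 0
  then show ?case by (metis Ck_on.simps(1) continuous_on_cong)
next
  case (Suc k)
  have eq: "frechet_derivative f (at x) = frechet_derivative g (at x)" if "x \<in> S" for x
    using Suc.prems assms(1) that by (intro frechet_derivative_transform_within_open) auto
  have "g differentiable (at x)" if "x \<in> S" for x
    using Suc.prems assms(1) that
    by (metis Ck_on.simps(2) differentiable_def has_derivative_transform_within_open)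
  moreover have "Ck_on k S (\<lambda>x. frechet_derivative g (at x) h)" for h
    by (rule Suc.IH[of "\<lambda>x. frechet_derivative f (at x) h"]) (use Suc.prems eq in auto)
  ultimately show ?case by simp
qed

lemma Ck_on_Suc_intro:
  assumes "open S" and der: "\<And>x. x \<in> S \<Longrightarrow> (f has_derivative f' x) (at x)"
    and f': "\<And>h. Ck_on k S (\<lambda>x. f' x h)"
  shows "Ck_on (Suc k) S f"
proof -
  have eq: "f' x h = frechet_derivative f (at x) h" if "x \<in> S" for x h
    by (simp only: frechet_derivative_at[OF der[OF that]])
  have "Ck_on k S (\<lambda>x. frechet_derivative f (at x) h)" for h
    by (rule Ck_on_cong[OF assms(1) f'[of h]]) (rule eq)
  with der show ?thesis by (auto simp: differentiable_def)
qed

\<comment> \<open>The defining equation would unfold derivatives of every order under the simplifier.\<close>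
declare Ck_on.simps(2) [simp del]

lemma Ck_on_has_derivative:
  "Ck_on (Suc k) S f \<Longrightarrow> x \<in> S \<Longrightarrow> (f has_derivative frechet_derivative f (at x)) (at x)"
  by (simp add: Ck_on.simps(2) frechet_derivative_works)

lemma Ck_on_frechet_derivative:
  "Ck_on (Suc k) S f \<Longrightarrow> Ck_on k S (\<lambda>x. frechet_derivative f (at x) h)"
  by (simp add: Ck_on.simps(2))

lemma Ck_on_imp_continuous_on: "Ck_on k S f \<Longrightarrow> continuous_on S f"
  by (cases k)
    (auto intro!: differentiable_imp_continuous_on simp: Ck_on.simps(2) differentiable_on_def differentiable_at_withinI)

lemma Ck_on_Suc_imp: "Ck_on (Suc k) S f \<Longrightarrow> Ck_on k S f"
proof (induction k arbitrary: f)
  case 0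
  then show ?case using Ck_on_imp_continuous_on by (metis Ck_on.simps(1))
next
  case (Suc k)
  then show ?case by (metis Ck_on.simps(2))
qed

lemma Ck_on_subset: "Ck_on k S f \<Longrightarrow> T \<subseteq> S \<Longrightarrow> Ck_on k T f"
  by (induction k arbitrary: f) (auto simp: Ck_on.simps(2) intro: continuous_on_subset)

lemma Ck_on_const: "open S \<Longrightarrow> Ck_on k S (\<lambda>x. c)"
  by (induction k arbitrary: c) (auto simp: Ck_on.simps(2))

lemma Ck_on_bounded_linear:
  assumes "open S" "bounded_linear L" "Ck_on k S f"
  shows "Ck_on k S (\<lambda>x. L (f x))"
  using assms(3)
proof (induction k arbitrary: f)
  case 0
  then show ?case using assms(2) by (auto intro: bounded_linear.continuous_on)
next
  case (Suc k)
  show ?case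
  proof (rule Ck_on_Suc_intro[where f' = "\<lambda>x h. L (frechet_derivative f (at x) h)"])
    show "Ck_on k S (\<lambda>x. L (frechet_derivative f (at x) h))" for h
      by (rule Suc.IH[OF Ck_on_frechet_derivative[OF Suc.prems]])
    show "((\<lambda>x. L (f x)) has_derivative (\<lambda>h. L (frechet_derivative f (at x) h))) (at x)" if "x \<in> S" for x
      by (rule bounded_linear.has_derivative[OF assms(2) Ck_on_has_derivative[OF Suc.prems that]])
  qed (fact assms(1))
qed

lemma Ck_on_id: "open S \<Longrightarrow> Ck_on k S (\<lambda>x. x)"
  by (cases k) (auto simp: Ck_on.simps(2) Ck_on_const)

lemma Ck_on_add:
  assumes "open S" "Ck_on k S f" "Ck_on k S g"
  shows "Ck_on k S (\<lambda>x. f x + g x)"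
  using assms(2,3)
proof (induction k arbitrary: f g)
  case 0
  then show ?case by (auto intro: continuous_intros)
next
  case (Suc k)
  show ?case
  proof (rule Ck_on_Suc_intro[where f' = "\<lambda>x h. frechet_derivative f (at x) h + frechet_derivative g (at x) h"])
    show "Ck_on k S (\<lambda>x. frechet_derivative f (at x) h + frechet_derivative g (at x) h)" for h
      by (intro Suc.IH Ck_on_frechet_derivative Suc.prems)
    show "((\<lambda>x. f x + g x) has_derivative
        (\<lambda>h. frechet_derivative f (at x) h + frechet_derivative g (at x) h)) (at x)" if "x \<in> S" for x
      using Suc.prems that by (intro has_derivative_add Ck_on_has_derivative)
  qed (fact assms(1))
qed

lemma Ck_on_minus:
  assumes "open S" "Ck_on k S f"
  shows "Ck_on k S (\<lambda>x. - f x)"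
  using Ck_on_bounded_linear[OF assms(1) bounded_linear_minus[OF bounded_linear_ident] assms(2)] .

lemma Ck_on_diff:
  assumes "open S" "Ck_on k S f" "Ck_on k S g"
  shows "Ck_on k S (\<lambda>x. f x - g x)"
  using Ck_on_add[OF assms(1,2) Ck_on_minus[OF assms(1,3)]] by simp

lemma Ck_on_sum:
  assumes "open S" "\<And>i. i \<in> I \<Longrightarrow> Ck_on k S (f i)"
  shows "Ck_on k S (\<lambda>x. \<Sum>i\<in>I. f i x)"
  using assms(2)
  by (induction I rule: infinite_finite_induct) (auto intro!: Ck_on_const Ck_on_add assms(1))

lemma Ck_on_bilinear:
  assumes "open S" "bounded_bilinear B" "Ck_on k S f" "Ck_on k S g"
  shows "Ck_on k S (\<lambda>x. B (f x) (g x))"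
  using assms(3,4)
proof (induction k arbitrary: f g)
  case 0
  then show ?case using assms(2) by (auto intro: bounded_bilinear.continuous_on)
next
  case (Suc k)
  show ?case
  proof (rule Ck_on_Suc_intro[where f' = "\<lambda>x h. B (f x) (frechet_derivative g (at x) h)
            + B (frechet_derivative f (at x) h) (g x)"])
    show "Ck_on k S (\<lambda>x. B (f x) (frechet_derivative g (at x) h)
            + B (frechet_derivative f (at x) h) (g x))" for h
      by (intro Ck_on_add Suc.IH assms(1)) (use Suc.prems in \<open>auto intro: Ck_on_Suc_imp Ck_on_frechet_derivative\<close>)
    show "((\<lambda>x. B (f x) (g x)) has_derivative (\<lambda>h. B (f x) (frechet_derivative g (at x) h)
        + B (frechet_derivative f (at x) h) (g x))) (at x)" if "x \<in> S" for x
      using Suc.prems that by (intro bounded_bilinear.FDERIV[OF assms(2)] Ck_on_has_derivative)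
  qed (fact assms(1))
qed

lemma Ck_on_mult:
  fixes f g :: "'a::real_normed_vector \<Rightarrow> real"
  shows "open S \<Longrightarrow> Ck_on k S f \<Longrightarrow> Ck_on k S g \<Longrightarrow> Ck_on k S (\<lambda>x. f x * g x)"
  by (rule Ck_on_bilinear[OF _ bounded_bilinear_mult])

lemma Ck_on_inverse:
  fixes f :: "'a::real_normed_vector \<Rightarrow> real"
  assumes "open S" "Ck_on k S f" "\<And>x. x \<in> S \<Longrightarrow> f x \<noteq> 0"
  shows "Ck_on k S (\<lambda>x. inverse (f x))"
  using assms(2)
proof (induction k)
  case 0
  then show ?case using assms(3) by (auto intro!: continuous_intros)
next
  case (Suc k)
  show ?case
  proof (rule Ck_on_Suc_intro[where f' = "\<lambda>x h. - (inverse (f x) * frechet_derivative f (at x) h * inverse (f x))"])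
    show "Ck_on k S (\<lambda>x. - (inverse (f x) * frechet_derivative f (at x) h * inverse (f x)))" for h
      by (intro Ck_on_minus Ck_on_mult assms(1) Suc.IH Ck_on_Suc_imp[OF Suc.prems])
        (use Suc.prems in \<open>auto intro: Ck_on_frechet_derivative\<close>)
    show "((\<lambda>x. inverse (f x)) has_derivative
        (\<lambda>h. - (inverse (f x) * frechet_derivative f (at x) h * inverse (f x)))) (at x)" if "x \<in> S" for x
      using Suc.prems that assms(3) by (intro Deriv.has_derivative_inverse Ck_on_has_derivative)
  qed (fact assms(1))
qed

text \<open>The derivative \<open>dg(f(x)) (df(x) h)\<close> of a composition has a direction that varies with \<open>x\<close>.
  Expanding it in a basis reduces it to derivatives of \<open>g\<close> in fixed directions.\<close>

lemma Ck_on_compose: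
  fixes f :: "'a::real_normed_vector \<Rightarrow> 'b::euclidean_space"
  assumes "open S" "open T" "Ck_on k S f" "Ck_on k T g" "f ` S \<subseteq> T"
  shows "Ck_on k S (\<lambda>x. g (f x))"
  using assms(3,4)
proof (induction k arbitrary: g)
  case 0
  then show ?case using assms(5) by (auto intro: continuous_on_compose2)
next
  case (Suc k)
  let ?f' = "\<lambda>x. frechet_derivative f (at x)" and ?g' = "\<lambda>y. frechet_derivative g (at y)"
  show ?case
  proof (rule Ck_on_Suc_intro[where f' = "\<lambda>x h. \<Sum>b\<in>Basis. (?f' x h \<bullet> b) *\<^sub>R ?g' (f x) b"])
    fix x assume x: "x \<in> S"
    then have g: "(g has_derivative ?g' (f x)) (at (f x))"
      using assms(5) Suc.prems(2) by (blast intro: Ck_on_has_derivative)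
    then have "((\<lambda>x. g (f x)) has_derivative (\<lambda>h. ?g' (f x) (?f' x h))) (at x)"
      using has_derivative_compose Ck_on_has_derivative[OF Suc.prems(1) x] by blast
    moreover have "(\<lambda>h. ?g' (f x) (?f' x h)) = (\<lambda>h. \<Sum>b\<in>Basis. (?f' x h \<bullet> b) *\<^sub>R ?g' (f x) b)"
    proof
      fix h
      interpret l: linear "?g' (f x)" using g has_derivative_linear by blast
      have "?g' (f x) (?f' x h) = ?g' (f x) (\<Sum>b\<in>Basis. (?f' x h \<bullet> b) *\<^sub>R b)"
        by (simp add: euclidean_representation)
      also have "\<dots> = (\<Sum>b\<in>Basis. (?f' x h \<bullet> b) *\<^sub>R ?g' (f x) b)"
        by (simp add: l.sum l.scaleR)
      finally show "?g' (f x) (?f' x h) = (\<Sum>b\<in>Basis. (?f' x h \<bullet> b) *\<^sub>R ?g' (f x) b)" .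
    qed
    ultimately show "((\<lambda>x. g (f x)) has_derivative (\<lambda>h. \<Sum>b\<in>Basis. (?f' x h \<bullet> b) *\<^sub>R ?g' (f x) b)) (at x)"
      by (rule back_subst)
  next
    show "Ck_on k S (\<lambda>x. \<Sum>b\<in>Basis. (?f' x h \<bullet> b) *\<^sub>R ?g' (f x) b)" for h
    proof (intro Ck_on_sum Ck_on_bilinear[OF _ bounded_bilinear_scaleR] assms(1))
      show "Ck_on k S (\<lambda>x. ?f' x h \<bullet> b)" for b
        by (rule Ck_on_bounded_linear[OF _ bounded_linear_inner_left]) (use assms(1) Suc.prems in \<open>auto intro: Ck_on_frechet_derivative\<close>)
      show "Ck_on k S (\<lambda>x. ?g' (f x) b)" for b
        by (rule Suc.IH) (use Suc.prems in \<open>auto intro: Ck_on_Suc_imp Ck_on_frechet_derivative\<close>)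
    qed
  qed (use assms in auto)
qed

lemma smooth_onD: "smooth_on S f \<Longrightarrow> Ck_on k S f"
  by (simp add: smooth_on_def)

lemma smooth_on_differentiable: "smooth_on S f \<Longrightarrow> x \<in> S \<Longrightarrow> f differentiable (at x)"
  using smooth_onD[of S f "Suc 0"] by (simp add: Ck_on.simps(2))

lemma smooth_on_has_derivative:
  "smooth_on S f \<Longrightarrow> x \<in> S \<Longrightarrow> (f has_derivative frechet_derivative f (at x)) (at x)"
  using frechet_derivative_works smooth_on_differentiable by blast

lemma smooth_on_has_vector_derivative:
  "smooth_on S f \<Longrightarrow> x \<in> S \<Longrightarrow> (f has_vector_derivative vector_derivative f (at x)) (at x)"
  using vector_derivative_works smooth_on_differentiable by blast

lemma smooth_on_imp_continuous_on: "smooth_on S f \<Longrightarrow> continuous_on S f"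
  using smooth_onD[of S f 0] by simp

lemma smooth_on_cong:
  "smooth_on S f \<Longrightarrow> open S \<Longrightarrow> (\<And>x. x \<in> S \<Longrightarrow> f x = g x) \<Longrightarrow> smooth_on S g"
  using Ck_on_cong unfolding smooth_on_def by blast

lemma smooth_on_subset: "smooth_on S f \<Longrightarrow> T \<subseteq> S \<Longrightarrow> smooth_on T f"
  using Ck_on_subset unfolding smooth_on_def by blast

lemma smooth_on_const: "open S \<Longrightarrow> smooth_on S (\<lambda>x. c)"
  by (simp add: smooth_on_def Ck_on_const)

lemma smooth_on_id: "open S \<Longrightarrow> smooth_on S (\<lambda>x. x)"
  by (simp add: smooth_on_def Ck_on_id)

lemma smooth_on_bounded_linear:
  "open S \<Longrightarrow> bounded_linear L \<Longrightarrow> smooth_on S f \<Longrightarrow> smooth_on S (\<lambda>x. L (f x))"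
  by (simp add: smooth_on_def Ck_on_bounded_linear)

lemma smooth_on_add:
  "open S \<Longrightarrow> smooth_on S f \<Longrightarrow> smooth_on S g \<Longrightarrow> smooth_on S (\<lambda>x. f x + g x)"
  by (simp add: smooth_on_def Ck_on_add)

lemma smooth_on_minus: "open S \<Longrightarrow> smooth_on S f \<Longrightarrow> smooth_on S (\<lambda>x. - f x)"
  by (simp add: smooth_on_def Ck_on_minus)

lemma smooth_on_diff:
  "open S \<Longrightarrow> smooth_on S f \<Longrightarrow> smooth_on S g \<Longrightarrow> smooth_on S (\<lambda>x. f x - g x)"
  by (simp add: smooth_on_def Ck_on_diff)

lemma smooth_on_scaleR:
  "open S \<Longrightarrow> smooth_on S f \<Longrightarrow> smooth_on S g \<Longrightarrow> smooth_on S (\<lambda>x. f x *\<^sub>R g x)"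
  by (simp add: smooth_on_def Ck_on_bilinear[OF _ bounded_bilinear_scaleR])

lemma smooth_on_mult:
  fixes f g :: "'a::real_normed_vector \<Rightarrow> real"
  shows "open S \<Longrightarrow> smooth_on S f \<Longrightarrow> smooth_on S g \<Longrightarrow> smooth_on S (\<lambda>x. f x * g x)"
  by (simp add: smooth_on_def Ck_on_mult)

lemma smooth_on_power:
  fixes f :: "'a::real_normed_vector \<Rightarrow> real"
  shows "open S \<Longrightarrow> smooth_on S f \<Longrightarrow> smooth_on S (\<lambda>x. f x ^ n)"
  by (induction n) (auto intro: smooth_on_const smooth_on_mult)

lemma smooth_on_divide:
  fixes f g :: "'a::real_normed_vector \<Rightarrow> real"
  assumes "open S" "smooth_on S f" "smooth_on S g" "\<And>x. x \<in> S \<Longrightarrow> g x \<noteq> 0"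
  shows "smooth_on S (\<lambda>x. f x / g x)"
  using assms by (simp add: smooth_on_def divide_inverse Ck_on_mult Ck_on_inverse)

lemma smooth_on_compose:
  fixes f :: "'a::real_normed_vector \<Rightarrow> 'b::euclidean_space"
  shows "open S \<Longrightarrow> open T \<Longrightarrow> smooth_on S f \<Longrightarrow> smooth_on T g \<Longrightarrow> f ` S \<subseteq> T \<Longrightarrow>
    smooth_on S (\<lambda>x. g (f x))"
  by (simp add: smooth_on_def Ck_on_compose)

lemma smooth_on_Pair:
  assumes "open S" "smooth_on S f" "smooth_on S g"
  shows "smooth_on S (\<lambda>x. (f x, g x))"
proof -
  have "smooth_on S (\<lambda>x. (f x, 0) + (0, g x))"
    by (intro smooth_on_add smooth_on_bounded_linear[where L = "\<lambda>y. (y, 0)"]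
        smooth_on_bounded_linear[where L = "Pair 0"] assms bounded_linear_intros)
  then show ?thesis by simp
qed

lemma smooth_on_fst: "open S \<Longrightarrow> smooth_on S f \<Longrightarrow> smooth_on S (\<lambda>x. fst (f x))"
  by (rule smooth_on_bounded_linear[OF _ bounded_linear_fst])

lemma smooth_on_snd: "open S \<Longrightarrow> smooth_on S f \<Longrightarrow> smooth_on S (\<lambda>x. snd (f x))"
  by (rule smooth_on_bounded_linear[OF _ bounded_linear_snd])

lemma smooth_on_vec_nth:
  fixes f :: "'a::real_normed_vector \<Rightarrow> real^'n"
  shows "open S \<Longrightarrow> smooth_on S f \<Longrightarrow> smooth_on S (\<lambda>x. f x $ i)"
  by (rule smooth_on_bounded_linear[OF _ bounded_linear_vec_nth])

lemma smooth_on_vec3: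
  assumes "open S" "smooth_on S f" "smooth_on S g" "smooth_on S h"
  shows "smooth_on S (\<lambda>x. vector [f x, g x, h x] :: real^3)"
proof -
  have "smooth_on S (\<lambda>x. f x *\<^sub>R axis 1 1 + g x *\<^sub>R axis 2 1 + h x *\<^sub>R axis 3 1 :: real^3)"
    by (intro smooth_on_add smooth_on_scaleR smooth_on_const assms)
  moreover have "f x *\<^sub>R axis 1 1 + g x *\<^sub>R axis 2 1 + h x *\<^sub>R axis 3 1 = (vector [f x, g x, h x] :: real^3)" for x
    by (simp add: vec_eq_iff forall_3 axis_def)
  ultimately show ?thesis by simp
qed

lemmas smooth_intros = smooth_on_const smooth_on_id smooth_on_add smooth_on_minus smooth_on_diff
  smooth_on_scaleR smooth_on_mult smooth_on_power smooth_on_Pair smooth_on_fst smooth_on_snd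
  smooth_on_vec_nth smooth_on_vec3

text \<open>On an open subset of the line, smoothness is governed by the vector derivative alone.\<close>

lemma Ck_on_Suc_real_intro:
  fixes f :: "real \<Rightarrow> 'a::real_normed_vector"
  assumes "open S" "\<And>t. t \<in> S \<Longrightarrow> (f has_vector_derivative f' t) (at t)" "Ck_on k S f'"
  shows "Ck_on (Suc k) S f"
proof (rule Ck_on_Suc_intro[where f' = "\<lambda>t h. h *\<^sub>R f' t"])
  show "Ck_on k S (\<lambda>t. h *\<^sub>R f' t)" for h
    by (rule Ck_on_bounded_linear[OF assms(1) bounded_linear_scaleR_right assms(3)])
qed (use assms(1,2) in \<open>simp_all add: has_vector_derivative_def\<close>)

lemma smooth_on_antiderivative:
  fixes f :: "real \<Rightarrow> 'a::real_normed_vector"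
  assumes "open S" "\<And>t. t \<in> S \<Longrightarrow> (f has_vector_derivative f' t) (at t)" "smooth_on S f'"
  shows "smooth_on S f"
  using Ck_on_Suc_real_intro[OF assms(1,2) smooth_onD[OF assms(3)]] Ck_on_Suc_imp
  unfolding smooth_on_def by blast

lemma smooth_on_vector_derivative:
  fixes f :: "real \<Rightarrow> 'a::real_normed_vector"
  assumes "open S" "smooth_on S f"
  shows "smooth_on S (\<lambda>t. vector_derivative f (at t))"
proof -
  have "Ck_on k S (\<lambda>t. frechet_derivative f (at t) 1)" for k
    using smooth_onD[OF assms(2)] Ck_on_frechet_derivative by blast
  then have "smooth_on S (\<lambda>t. frechet_derivative f (at t) 1)"
    by (simp add: smooth_on_def)
  then show ?thesis
    by (rule smooth_on_cong)
      (use assms in \<open>auto simp: frechet_derivative_eq_vector_derivative smooth_on_differentiable\<close>)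
qed

lemma smooth_on_deriv:
  fixes f :: "real \<Rightarrow> real"
  assumes "open S" "smooth_on S f"
  shows "smooth_on S (deriv f)"
  using smooth_on_vector_derivative[OF assms]
  by (rule smooth_on_cong)
    (use assms in \<open>auto simp: field_derivative_eq_vector_derivative smooth_on_differentiable\<close>)

lemma smooth_on_has_real_derivative:
  fixes f :: "real \<Rightarrow> real"
  assumes "smooth_on S f" "x \<in> S"
  shows "(f has_real_derivative deriv f x) (at x)"
  using smooth_on_has_vector_derivative[OF assms]
  by (simp add: field_derivative_eq_vector_derivative has_real_derivative_iff_has_vector_derivative)

section \<open>The inverse function theorem for smooth maps of the plane\<close>

text \<open>Cramer's rule in dimension two.\<close>

lemma inj_linear_plane_iff_det:
  fixes L :: "real \<times> real \<Rightarrow> real \<times> real"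
  assumes "linear L"
  defines "\<Delta> \<equiv> fst (L (1,0)) * snd (L (0,1)) - fst (L (0,1)) * snd (L (1,0))"
  shows "inj L \<longleftrightarrow> \<Delta> \<noteq> 0"
    and "\<Delta> \<noteq> 0 \<Longrightarrow> L ((snd (L (0,1)) * fst y - fst (L (0,1)) * snd y) / \<Delta>,
        (fst (L (1,0)) * snd y - snd (L (1,0)) * fst y) / \<Delta>) = y"
proof -
  interpret L: linear L by fact
  have L: "L (s, t) = (fst (L (1,0)) * s + fst (L (0,1)) * t, snd (L (1,0)) * s + snd (L (0,1)) * t)" for s t
  proof -
    have "L (s, t) = L (s *\<^sub>R (1,0) + t *\<^sub>R (0,1))" by simp
    also have "\<dots> = s *\<^sub>R L (1,0) + t *\<^sub>R L (0,1)" by (simp only: L.add L.scaleR)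
    finally show ?thesis by (simp add: prod_eq_iff)
  qed
  define a b c d where abcd: "a = fst (L (1,0))" "b = fst (L (0,1))" "c = snd (L (1,0))" "d = snd (L (0,1))"
  have L': "L (s, t) = (a * s + b * t, c * s + d * t)" for s t
    unfolding abcd by (rule L)
  have D: "\<Delta> = a * d - b * c" by (simp add: \<Delta>_def abcd)
  show r: "L ((snd (L (0,1)) * fst y - fst (L (0,1)) * snd y) / \<Delta>,
        (fst (L (1,0)) * snd y - snd (L (1,0)) * fst y) / \<Delta>) = y" if "\<Delta> \<noteq> 0" for y
  proof -
    have "L ((d * fst y - b * snd y) / \<Delta>, (a * snd y - c * fst y) / \<Delta>) = y"
      using that unfolding L' D by (simp add: prod_eq_iff divide_simps) (simp add: algebra_simps)
    then show ?thesis by (simp add: abcd)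
  qed
  show "inj L \<longleftrightarrow> \<Delta> \<noteq> 0"
  proof
    assume "inj L"
    show "\<Delta> \<noteq> 0"
    proof
      assume "\<Delta> = 0"
      then have "L (d, - c) = 0" "L (b, - a) = 0" using D by (auto simp: L' zero_prod_def algebra_simps)
      then have "(d, - c) = 0" "(b, - a) = 0"
        using \<open>inj L\<close> L.zero by (metis injD)+
      then have "L (1, 0) = 0" by (simp add: L' zero_prod_def)
      then have "(1::real, 0::real) = 0" using \<open>inj L\<close> L.zero by (metis injD)
      then show False by (simp add: zero_prod_def)
    qed
  next
    assume "\<Delta> \<noteq> 0"
    from r[OF this] have "surj L" by (rule surjI)
    then show "inj L" using assms(1) linear_surjective_imp_injective by blast
  qed
qed

text \<open>By Cramer's rule the derivative of the local inverse \<open>g\<close> is a rational function of first derivatives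
  of \<open>f\<close> evaluated along \<open>g\<close>, so the regularity of \<open>g\<close> improves by one order at a time.\<close>

theorem smooth_local_inverse_plane:
  fixes f :: "real \<times> real \<Rightarrow> real \<times> real"
  assumes "open U" "smooth_on U f" "x0 \<in> U" and inj: "inj (frechet_derivative f (at x0))"
  obtains W V g where "open W" "W \<subseteq> U" "x0 \<in> W" "open V" "homeomorphism W V f g" "smooth_on V g"
proof -
  define f' where "f' x = frechet_derivative f (at x)" for x
  have der: "(f has_derivative f' x) (at x)" if "x \<in> U" for x
    using smooth_on_has_derivative[OF assms(2) that] by (simp add: f'_def)
  have bl: "bounded_linear (f' x)" if "x \<in> U" for x
    using der[OF that] has_derivative_bounded_linear by blast
  have f'_smooth: "smooth_on U (\<lambda>x. f' x h)" for h
    unfolding smooth_on_def f'_def using smooth_onD[OF assms(2)] Ck_on_frechet_derivative by blast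
  have cont: "continuous_on U (\<lambda>x. Blinfun (f' x))"
  proof (rule continuous_on_blinfun_componentwise)
    fix i :: "real \<times> real"
    have "continuous_on U (\<lambda>x. f' x i)" using f'_smooth smooth_on_imp_continuous_on by blast
    then show "continuous_on U (\<lambda>x. blinfun_apply (Blinfun (f' x)) i)"
      by (rule continuous_on_eq) (simp add: bounded_linear_Blinfun_apply bl)
  qed
  have "linear (f' x0)" using bl assms(3) bounded_linear.linear by blast
  then obtain k where "linear k" "k \<circ> f' x0 = id"
    using linear_injective_left_inverse inj f'_def by metis
  then have invf: "Blinfun k o\<^sub>L Blinfun (f' x0) = id_blinfun"
    by (intro blinfun_eqI)
      (simp add: bounded_linear_Blinfun_apply[OF bl[OF assms(3)]] pointfree_idE
        bounded_linear_Blinfun_apply[OF linear_conv_bounded_linear[THEN iffD1]])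
  have der': "(f has_derivative blinfun_apply (Blinfun (f' x))) (at x)" if "x \<in> U" for x
    using der[OF that] bl[OF that] by (simp add: bounded_linear_Blinfun_apply)
  obtain W V g g' where *: "open W" "W \<subseteq> U" "x0 \<in> W" "open V" "homeomorphism W V f g"
    and g: "\<And>y. y \<in> V \<Longrightarrow> (g has_derivative (g' y)) (at y)"
    "\<And>y. y \<in> V \<Longrightarrow> g' y = inv (blinfun_apply (Blinfun (f' (g y))))"
    "\<And>y. y \<in> V \<Longrightarrow> bij (blinfun_apply (Blinfun (f' (g y))))"
    by (rule inverse_function_theorem[OF assms(1) der' cont assms(3) invf]) blast+
  have gU: "g y \<in> U" if "y \<in> V" for y
    using * that by (metis (no_types, lifting) homeomorphism_image2 image_eqI subsetD)
  have g': "g' y = inv (f' (g y))" "bij (f' (g y))" if "y \<in> V" for y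
    using g(2,3)[OF that] bl[OF gU[OF that]] by (simp_all add: bounded_linear_Blinfun_apply)
  let ?a = "\<lambda>x. fst (f' x (1,0))" and ?b = "\<lambda>x. fst (f' x (0,1))"
    and ?c = "\<lambda>x. snd (f' x (1,0))" and ?d = "\<lambda>x. snd (f' x (0,1))"
  let ?\<Delta> = "\<lambda>x. ?a x * ?d x - ?b x * ?c x"
  let ?G = "\<lambda>h y. ((?d (g y) * fst h - ?b (g y) * snd h) / ?\<Delta> (g y),
      (?a (g y) * snd h - ?c (g y) * fst h) / ?\<Delta> (g y))"
  have nz: "?\<Delta> (g y) \<noteq> 0" and G: "g' y h = ?G h y" if "y \<in> V" for y h
  proof -
    have lin: "linear (f' (g y))" using bl[OF gU[OF that]] bounded_linear.linear by blast
    show nz: "?\<Delta> (g y) \<noteq> 0"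
      using inj_linear_plane_iff_det(1)[OF lin] g'(2)[OF that] bij_is_inj by blast
    show "g' y h = ?G h y"
      using inj_linear_plane_iff_det(2)[OF lin nz, of h] g'[OF that] by (metis bij_inv_eq_iff)
  qed
  have "Ck_on k V g" for k
  proof (induction k)
    case 0
    show ?case using *(5) by (simp add: homeomorphism_def)
  next
    case (Suc k)
    show ?case
    proof (rule Ck_on_Suc_intro[where f' = "\<lambda>y h. ?G h y"])
      fix h
      define Q where "Q x = ((?d x * fst h - ?b x * snd h) / ?\<Delta> x,
        (?a x * snd h - ?c x * fst h) / ?\<Delta> x)" for x
      define U' where "U' = {x \<in> U. ?\<Delta> x \<noteq> 0}"
      have U': "U' = U \<inter> ?\<Delta> -` (- {0})" by (auto simp: U'_def)
      have "smooth_on U ?\<Delta>"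
        by (intro smooth_intros f'_smooth assms(1))
      then have "open U'" unfolding U'
        by (intro continuous_open_preimage smooth_on_imp_continuous_on assms(1)) auto
      have f'_smooth': "smooth_on U' (\<lambda>x. f' x h)" for h
        using f'_smooth by (rule smooth_on_subset) (auto simp: U'_def)
      have "smooth_on U' Q" unfolding Q_def
        by (intro smooth_on_divide smooth_intros f'_smooth' \<open>open U'\<close>) (auto simp: U'_def)
      moreover have "g ` V \<subseteq> U'" using gU nz by (auto simp: U'_def)
      ultimately have "Ck_on k V (\<lambda>y. Q (g y))"
        using Ck_on_compose[OF *(4) \<open>open U'\<close> Suc] smooth_onD by blast
      then show "Ck_on k V (?G h)" by (simp add: Q_def)
    next
      show "(g has_derivative (\<lambda>h. ?G h y)) (at y)" if "y \<in> V" for y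
        using g(1)[OF that] by (subst (asm) ext[OF G[OF that]])
    qed (use * in auto)
  qed
  then have "smooth_on V g" by (simp add: smooth_on_def)
  with that * show ?thesis by blast
qed

section \<open>Local solutions of ordinary differential equations\<close>

lemma vector_derivative_bound:
  fixes x :: "real \<Rightarrow> 'a::real_normed_vector"
  assumes "convex S" "\<And>t. t \<in> S \<Longrightarrow> (x has_vector_derivative x' t) (at t within S)"
    and "\<And>t. t \<in> S \<Longrightarrow> norm (x' t) \<le> B" "s \<in> S" "t \<in> S"
  shows "norm (x s - x t) \<le> B * \<bar>s - t\<bar>"
proof -
  have "norm (x s - x t) \<le> B * norm (s - t)"
  proof (rule differentiable_bound[OF assms(1) _ _ assms(4,5)])
    show "(x has_derivative (\<lambda>h. h *\<^sub>R x' t)) (at t within S)" if "t \<in> S" for t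
      using assms(2)[OF that] by (simp add: has_vector_derivative_def)
    show "onorm (\<lambda>h. h *\<^sub>R x' t) \<le> B" if "t \<in> S" for t
      using assms(3)[OF that] by (intro onorm_le) (simp add: mult.commute[of "\<bar>_\<bar>"] mult_right_mono)
  qed
  then show ?thesis by simp
qed

text \<open>The Picard operator of a vector field that is globally Lipschitz in the space variable is a
  contraction on the bounded continuous functions on the line, once these are read only through
  their restriction to a short interval.\<close>

lemma ode_solution_global_Lipschitz:
  fixes f :: "real \<Rightarrow> 'a::banach \<Rightarrow> 'a"
  assumes "0 < d" and cont: "continuous_on ({t0 - d..t0 + d} \<times> UNIV) (\<lambda>(t, x). f t x)"
    and lip: "\<And>t x y. t \<in> {t0 - d..t0 + d} \<Longrightarrow> norm (f t x - f t y) \<le> L * norm (x - y)"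
    and L: "0 \<le> L" "L * d \<le> 1 / 2"
  obtains x where "x t0 = x0"
    and "\<And>t. t \<in> {t0 - d..t0 + d} \<Longrightarrow> (x has_vector_derivative f t (x t)) (at t within {t0 - d..t0 + d})"
proof -
  let ?I = "{t0 - d..t0 + d}"
  define c where "c t = max (t0 - d) (min (t0 + d) t)" for t
  define G where "G \<phi> t = integral {t0 - d..t} (\<lambda>s. f s (\<phi> s))" for \<phi> :: "real \<Rightarrow> 'a" and t
  define P where "P \<phi> t = x0 + G \<phi> (c t) - G \<phi> t0" for \<phi> :: "real \<Rightarrow> 'a" and t
  have c: "c t \<in> ?I" "t \<in> ?I \<Longrightarrow> c t = t" for t using \<open>0 < d\<close> by (auto simp: c_def)
  have f\<phi>: "continuous_on ?I (\<lambda>s. f s (apply_bcontfun \<phi> s))" for \<phi> :: "real \<Rightarrow>\<^sub>C 'a"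
  proof -
    have "continuous_on ?I (\<lambda>s. (s, apply_bcontfun \<phi> s))"
      by (intro continuous_on_Pair continuous_on_id continuous_on_apply_bcontfun)
    then have "continuous_on ?I (\<lambda>s. (\<lambda>(t, x). f t x) (s, apply_bcontfun \<phi> s))"
      by (rule continuous_on_compose2[OF cont]) auto
    then show ?thesis by simp
  qed
  have G: "(G (apply_bcontfun \<phi>) has_vector_derivative f t (apply_bcontfun \<phi> t)) (at t within ?I)"
    if "t \<in> ?I" for \<phi> t
    unfolding G_def by (rule integral_has_vector_derivative[OF f\<phi> that])
  have contG: "continuous_on ?I (G (apply_bcontfun \<phi>))" for \<phi> :: "real \<Rightarrow>\<^sub>C 'a"
    using G by (rule continuous_on_vector_derivative)
  have bc: "P (apply_bcontfun \<phi>) \<in> bcontfun" for \<phi>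
  proof -
    have "continuous_on UNIV c" unfolding c_def by (intro continuous_intros)
    then have 1: "continuous_on UNIV (P (apply_bcontfun \<phi>))"
      unfolding P_def using c(1)
      by (intro continuous_intros continuous_on_compose2[OF contG]) auto
    have "compact (G (apply_bcontfun \<phi>) ` ?I)"
      using contG by (rule compact_continuous_image) simp
    then obtain B where B: "\<And>t. t \<in> ?I \<Longrightarrow> norm (G (apply_bcontfun \<phi>) t) \<le> B"
      using compact_imp_bounded bounded_iff by (metis imageI)
    have "norm (P (apply_bcontfun \<phi>) t) \<le> norm x0 + B + B" for t
    proof -
      have "norm (P (apply_bcontfun \<phi>) t) \<le>
          norm x0 + norm (G (apply_bcontfun \<phi>) (c t)) + norm (G (apply_bcontfun \<phi>) t0)"
        unfolding P_def by (meson norm_triangle_ineq norm_triangle_ineq4 order_trans add_right_mono)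
      moreover have "t0 \<in> ?I" using \<open>0 < d\<close> by simp
      ultimately show ?thesis using B[OF c(1)[of t]] B[of t0] by linarith
    qed
    with 1 show ?thesis by (rule bcontfun_normI)
  qed
  define T where "T \<phi> = Bcontfun (P (apply_bcontfun \<phi>))" for \<phi>
  have T: "apply_bcontfun (T \<phi>) = P (apply_bcontfun \<phi>)" for \<phi>
    unfolding T_def by (rule Bcontfun_inverse[OF bc])
  have "dist (T \<phi>) (T \<psi>) \<le> 1 / 2 * dist \<phi> \<psi>" for \<phi> \<psi>
  proof (rule dist_bound)
    fix t
    let ?H = "\<lambda>t. G (apply_bcontfun \<phi>) t - G (apply_bcontfun \<psi>) t"
    have "norm (?H (c t) - ?H t0) \<le> L * dist \<phi> \<psi> * \<bar>c t - t0\<bar>"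
    proof (rule vector_derivative_bound)
      show "(?H has_vector_derivative f t (apply_bcontfun \<phi> t) - f t (apply_bcontfun \<psi> t)) (at t within ?I)"
        if "t \<in> ?I" for t
        by (intro has_vector_derivative_diff G that)
      show "norm (f t (apply_bcontfun \<phi> t) - f t (apply_bcontfun \<psi> t)) \<le> L * dist \<phi> \<psi>" if "t \<in> ?I" for t
        using lip[OF that] dist_bounded[of \<phi> t \<psi>] L(1)
        by (metis dist_norm mult_left_mono order_trans)
    qed (use c(1) \<open>0 < d\<close> in auto)
    also have "\<dots> \<le> L * dist \<phi> \<psi> * d"
      using c(1)[of t] L(1) by (intro mult_left_mono) auto
    also have "\<dots> \<le> 1 / 2 * dist \<phi> \<psi>"
      using mult_right_mono[OF L(2), of "dist \<phi> \<psi>"] by (simp add: mult_ac)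
    finally show "dist (apply_bcontfun (T \<phi>) t) (apply_bcontfun (T \<psi>) t) \<le> 1 / 2 * dist \<phi> \<psi>"
      by (simp add: T P_def dist_norm algebra_simps)
  qed
  then obtain \<phi> where "T \<phi> = \<phi>"
    using banach_fix_type[of "1/2" T] by auto
  then have fixed: "apply_bcontfun \<phi> = P (apply_bcontfun \<phi>)" using T by metis
  show ?thesis
  proof (rule that[of "apply_bcontfun \<phi>"])
    have "t0 \<in> ?I" using \<open>0 < d\<close> by simp
    then have "P (apply_bcontfun \<phi>) t0 = x0" by (simp add: P_def c(2))
    then show "apply_bcontfun \<phi> t0 = x0" using fixed by simp
    show "(apply_bcontfun \<phi> has_vector_derivative f t (apply_bcontfun \<phi> t)) (at t within ?I)"
      if "t \<in> ?I" for t
    proof (rule has_vector_derivative_transform[OF that])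
      show "apply_bcontfun \<phi> s = x0 + G (apply_bcontfun \<phi>) s - G (apply_bcontfun \<phi>) t0" if "s \<in> ?I" for s
        using fixed c(2)[OF that] by (metis P_def)
      show "((\<lambda>s. x0 + G (apply_bcontfun \<phi>) s - G (apply_bcontfun \<phi>) t0) has_vector_derivative
          f t (apply_bcontfun \<phi> t)) (at t within ?I)"
        using has_vector_derivative_diff[OF has_vector_derivative_add[OF has_vector_derivative_const
              G[OF that]] has_vector_derivative_const] by simp
    qed
  qed
qed

text \<open>Composing the vector field with the projection onto the ball makes it globally Lipschitz; the
  solution found in this way does not leave the ball in a sufficiently short time.\<close>

theorem ode_local_solution:
  fixes f :: "real \<Rightarrow> 'a::euclidean_space \<Rightarrow> 'a"
  assumes "0 < d" "0 < \<rho>"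
    and cont: "continuous_on ({t0 - d..t0 + d} \<times> cball x0 \<rho>) (\<lambda>(t, x). f t x)"
    and lip: "\<And>t x y. t \<in> {t0 - d..t0 + d} \<Longrightarrow> x \<in> cball x0 \<rho> \<Longrightarrow> y \<in> cball x0 \<rho> \<Longrightarrow>
        norm (f t x - f t y) \<le> L * norm (x - y)"
  obtains \<delta> x where "0 < \<delta>" "\<delta> \<le> d" "x t0 = x0"
    and "\<And>t. t \<in> {t0 - \<delta><..<t0 + \<delta>} \<Longrightarrow> x t \<in> cball x0 \<rho>"
    and "\<And>t. t \<in> {t0 - \<delta><..<t0 + \<delta>} \<Longrightarrow> (x has_vector_derivative f t (x t)) (at t)"
proof -
  define P where "P = closest_point (cball x0 \<rho>)"
  have P: "P x \<in> cball x0 \<rho>" "x \<in> cball x0 \<rho> \<Longrightarrow> P x = x" "dist (P x) (P y) \<le> dist x y" for x y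
    unfolding P_def using \<open>0 < \<rho>\<close>
    by (auto intro!: closest_point_in_set closest_point_self closest_point_lipschitz simp del: mem_cball)
  have "compact ((\<lambda>(t, x). f t x) ` ({t0 - d..t0 + d} \<times> cball x0 \<rho>))"
    using cont by (rule compact_continuous_image) (intro compact_Times compact_cball compact_Icc)
  then obtain M0 where M0: "\<And>t x. t \<in> {t0 - d..t0 + d} \<Longrightarrow> x \<in> cball x0 \<rho> \<Longrightarrow> norm (f t x) \<le> M0"
    unfolding compact_eq_bounded_closed bounded_iff by fastforce
  define M where "M = max 1 M0"
  have M: "norm (f t x) \<le> M" if "t \<in> {t0 - d..t0 + d}" "x \<in> cball x0 \<rho>" for t x
    using M0[OF that] by (simp add: M_def)
  define K where "K = max 1 L"
  define \<delta> where "\<delta> = min d (min (\<rho> / M) (1 / (2 * K)))"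
  have pos: "0 < M" "0 < K" by (auto simp: M_def K_def)
  have \<delta>: "0 < \<delta>" "\<delta> \<le> d" using \<open>0 < d\<close> \<open>0 < \<rho>\<close> pos by (auto simp: \<delta>_def)
  have "\<delta> \<le> \<rho> / M" "\<delta> \<le> 1 / (2 * K)" by (auto simp: \<delta>_def)
  then have \<delta>': "M * \<delta> \<le> \<rho>" "K * \<delta> \<le> 1 / 2" using pos by (auto simp: field_simps)
  have sub: "{t0 - \<delta>..t0 + \<delta>} \<subseteq> {t0 - d..t0 + d}" using \<delta>(2) by auto
  obtain x where x: "x t0 = x0" "\<And>t. t \<in> {t0 - \<delta>..t0 + \<delta>} \<Longrightarrow>
      (x has_vector_derivative f t (P (x t))) (at t within {t0 - \<delta>..t0 + \<delta>})"
  proof (rule ode_solution_global_Lipschitz[OF \<delta>(1), of t0 "\<lambda>t x. f t (P x)" K x0])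
    have "continuous_on UNIV P"
      unfolding P_def using \<open>0 < \<rho>\<close> by (intro continuous_on_closest_point) auto
    then have "continuous_on ({t0 - \<delta>..t0 + \<delta>} \<times> UNIV) (\<lambda>z. P (snd z))"
      by (rule continuous_on_compose2[OF _ continuous_on_snd[OF continuous_on_id]]) simp
    then have "continuous_on ({t0 - \<delta>..t0 + \<delta>} \<times> UNIV) (\<lambda>z. (fst z, P (snd z)))"
      by (intro continuous_on_Pair continuous_on_fst continuous_on_id)
    then have "continuous_on ({t0 - \<delta>..t0 + \<delta>} \<times> UNIV) (\<lambda>z. (\<lambda>(t, x). f t x) (fst z, P (snd z)))"
      by (rule continuous_on_compose2[OF cont]) (use sub P(1) in auto)
    then show "continuous_on ({t0 - \<delta>..t0 + \<delta>} \<times> UNIV) (\<lambda>(t, x). f t (P x))"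
      by (simp add: case_prod_beta)
    show "norm (f t (P x) - f t (P y)) \<le> K * norm (x - y)" if "t \<in> {t0 - \<delta>..t0 + \<delta>}" for t x y
    proof -
      have "norm (f t (P x) - f t (P y)) \<le> L * norm (P x - P y)"
        using that sub P(1) by (intro lip) auto
      also have "\<dots> \<le> K * norm (P x - P y)" by (intro mult_right_mono) (auto simp: K_def)
      also have "\<dots> \<le> K * norm (x - y)"
        using P(3)[of x y] pos by (intro mult_left_mono) (auto simp: dist_norm)
      finally show ?thesis .
    qed
  qed (use pos \<delta>' in auto)
  have ball: "x t \<in> cball x0 \<rho>" if "t \<in> {t0 - \<delta>..t0 + \<delta>}" for t
  proof -
    have "norm (x t - x t0) \<le> M * \<bar>t - t0\<bar>"
    proof (rule vector_derivative_bound)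
      show "norm (f s (P (x s))) \<le> M" if "s \<in> {t0 - \<delta>..t0 + \<delta>}" for s
        using that sub P(1) by (intro M) auto
    qed (use x(2) that \<delta> in auto)
    also have "\<dots> \<le> M * \<delta>" using that pos by (intro mult_left_mono) auto
    finally show ?thesis using \<delta>'(1) x(1) by (simp add: dist_norm norm_minus_commute)
  qed
  show ?thesis
  proof (rule that[of \<delta> x, OF \<delta> x(1)])
    fix t assume t: "t \<in> {t0 - \<delta><..<t0 + \<delta>}"
    then show "x t \<in> cball x0 \<rho>" by (intro ball) auto
    then have "P (x t) = x t" by (rule P(2))
    moreover have "(x has_vector_derivative f t (P (x t))) (at t within {t0 - \<delta><..<t0 + \<delta>})"
      by (rule has_vector_derivative_within_subset[OF x(2)]) (use t in auto)
    ultimately show "(x has_vector_derivative f t (x t)) (at t)"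
      by (simp only: at_within_open[OF t open_greaterThanLessThan])
  qed
qed

text \<open>The integrand need not be integrable up to the end points, so the integral is based at the midpoint.\<close>

lemma antiderivative_on_open_interval:
  fixes f :: "real \<Rightarrow> real"
  assumes "continuous_on {\<alpha><..<\<beta>} f"
  obtains F where "\<And>t. t \<in> {\<alpha><..<\<beta>} \<Longrightarrow> (F has_real_derivative f t) (at t)"
proof (cases "\<alpha> < \<beta>")
  case True
  define m where "m = (\<alpha> + \<beta>) / 2"
  define F where "F t = (LBINT s=ereal m..ereal t. f s)" for t
  have "(F has_real_derivative f t) (at t)" if "t \<in> {\<alpha><..<\<beta>}" for t
  proof -
    define a b where "a = (\<alpha> + min m t) / 2" and "b = (\<beta> + max m t) / 2"
    have ab: "a < m" "a < t" "m < b" "t < b" "\<alpha> < a" "b < \<beta>"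
      using True that by (auto simp: a_def b_def m_def min_def max_def field_simps)
    have "(F has_vector_derivative f t) (at t within {a..b})"
      unfolding F_def
      by (rule interval_integral_FTC2) (use ab assms in \<open>auto intro: continuous_on_subset\<close>)
    then have "(F has_vector_derivative f t) (at t within {a<..<b})"
      by (rule has_vector_derivative_within_subset) auto
    moreover have "at t within {a<..<b} = at t"
      using ab by (intro at_within_open) auto
    ultimately show ?thesis
      by (simp add: has_real_derivative_iff_has_vector_derivative)
  qed
  then show ?thesis by (rule that)
qed (use that in auto)

section \<open>The change of coordinates and the Pfaffian systems\<close>

lemma has_derivative_vec3:
  assumes "(f has_derivative f') F" "(g has_derivative g') F" "(h has_derivative h') F"
  shows "((\<lambda>x. vector [f x, g x, h x] :: real^3) has_derivative (\<lambda>y. vector [f' y, g' y, h' y])) F"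
proof -
  have eq: "(vector [a, b, c] :: real^3) = a *\<^sub>R axis 1 1 + b *\<^sub>R axis 2 1 + c *\<^sub>R axis 3 1" for a b c
    by (simp add: vec_eq_iff forall_3 axis_def)
  show ?thesis unfolding eq
    by (intro has_derivative_add has_derivative_scaleR_left assms)
qed

text \<open>The change of coordinates is a shear: it adds to the last entry a vector that depends only
  on the first four coordinates.\<close>

definition shear :: "pt8 \<Rightarrow> real^3" where
  "shear = (\<lambda>(p, p0, q, q0, v, x).
     vector [- (1/8 * p0^2 * q0^2 * (p - q) * (1 + p * q)),
             1/8 * p0^2 * q0^2 * (p - q) * (1 - p * q),
             1/8 * p0^2 * q0^2 * (p^2 - q^2)])"

text \<open>The differential of \<^const>\<open>shear\<close>.\<close>

definition dshear :: "pt8 \<Rightarrow> pt8 \<Rightarrow> real^3" where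
  "dshear = (\<lambda>(p, p0, q, q0, v, x) (dp, dp0, dq, dq0, dv, dx).
     let k = 1/8 * p0^2 * q0^2; dk = 1/4 * p0 * q0 * (dp0 * q0 + p0 * dq0) in
     vector [- (dk * (p - q) * (1 + p * q) + k * ((dp - dq) * (1 + p * q) + (p - q) * (dp * q + p * dq))),
             dk * (p - q) * (1 - p * q) + k * ((dp - dq) * (1 - p * q) - (p - q) * (dp * q + p * dq)),
             dk * (p^2 - q^2) + k * (2 * p * dp - 2 * q * dq)])"

text \<open>The differential of \<^const>\<open>psi\<close> at \<open>m\<close>, applied to \<open>X\<close>.\<close>

definition dpsi :: "pt8 \<Rightarrow> pt8 \<Rightarrow> pt8" where
  "dpsi m X = X + (0, 0, 0, 0, 0, dshear m X)"

text \<open>The inverse of \<^const>\<open>psi\<close>; since \<^const>\<open>shear\<close> does not see the last entry, it subtracts the same vector.\<close>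

definition psi_inv :: "pt8 \<Rightarrow> pt8" where
  "psi_inv m = m - (0, 0, 0, 0, 0, shear m)"

lemma psi_eq: "psi m = m + (0, 0, 0, 0, 0, shear m)"
  by (cases m) (simp add: psi_def shear_def vec_eq_iff forall_3)

lemma shear_add [simp]: "shear (m + (0, 0, 0, 0, 0, y)) = shear m" "shear (m - (0, 0, 0, 0, 0, y)) = shear m"
  by (cases m; simp add: shear_def)+

lemma psi_psi_inv: "psi (psi_inv m) = m" and psi_inv_psi: "psi_inv (psi m) = m"
  by (simp_all add: psi_eq psi_inv_def)

lemma psi_inv_in_N_region: "psi_inv m \<in> N_region \<longleftrightarrow> m \<in> N_region"
  by (cases m) (simp add: psi_inv_def N_region_def)

lemma inv_into_psi: "m \<in> N_region \<Longrightarrow> inv_into N_region psi m = psi_inv m"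
  by (metis f_inv_into_f image_eqI inv_into_into psi_inv_in_N_region psi_inv_psi psi_psi_inv)

lemma has_derivative_shear: "(shear has_derivative dshear m) (at m)"
proof -
  define P A Q B :: "pt8 \<Rightarrow> real"
    where "P = fst" and "A m = fst (snd m)" and "Q m = fst (snd (snd m))" and "B m = fst (snd (snd (snd m)))" for m
  note defs = this
  have P: "(P has_derivative P) (at m)" and A: "(A has_derivative A) (at m)"
    and Q: "(Q has_derivative Q) (at m)" and B: "(B has_derivative B) (at m)"
    unfolding defs[abs_def] by (intro has_derivative_fst has_derivative_snd has_derivative_ident)+
  define k where "k m = 1/8 * (A m * A m) * (B m * B m)" for m
  define dk where "dk X = 1/4 * A m * B m * (A X * B m + A m * B X)" for X
  have k: "(k has_derivative dk) (at m)"
    unfolding k_def[abs_def]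
    by (rule has_derivative_eq_rhs[OF has_derivative_mult[OF has_derivative_mult[OF has_derivative_const
            has_derivative_mult[OF A A]] has_derivative_mult[OF B B]]])
      (simp add: dk_def fun_eq_iff algebra_simps power2_eq_square)
  have PQ: "((\<lambda>m. P m * Q m) has_derivative (\<lambda>X. P X * Q m + P m * Q X)) (at m)"
    by (rule has_derivative_eq_rhs[OF has_derivative_mult[OF P Q]]) (simp add: fun_eq_iff)
  note d = has_derivative_diff[OF P Q]
  have 1: "((\<lambda>m. - (k m * (P m - Q m) * (1 + P m * Q m))) has_derivative (\<lambda>X. dshear m X $ 1)) (at m)"
    by (rule has_derivative_eq_rhs[OF has_derivative_minus[OF has_derivative_mult[OF has_derivative_mult[OF k d]
              has_derivative_add[OF has_derivative_const PQ]]]])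
      (simp add: dshear_def k_def dk_def defs Let_def case_prod_beta fun_eq_iff field_simps power2_eq_square)
  have 2: "((\<lambda>m. k m * (P m - Q m) * (1 - P m * Q m)) has_derivative (\<lambda>X. dshear m X $ 2)) (at m)"
    by (rule has_derivative_eq_rhs[OF has_derivative_mult[OF has_derivative_mult[OF k d]
              has_derivative_diff[OF has_derivative_const PQ]]])
      (simp add: dshear_def k_def dk_def defs Let_def case_prod_beta fun_eq_iff field_simps power2_eq_square)
  have 3: "((\<lambda>m. k m * ((P m - Q m) * (P m + Q m))) has_derivative (\<lambda>X. dshear m X $ 3)) (at m)"
    by (rule has_derivative_eq_rhs[OF has_derivative_mult[OF k has_derivative_mult[OF d has_derivative_add[OF P Q]]]])
      (simp add: dshear_def k_def dk_def defs Let_def case_prod_beta fun_eq_iff field_simps power2_eq_square)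
  have eq: "shear = (\<lambda>m. vector [- (k m * (P m - Q m) * (1 + P m * Q m)),
      k m * (P m - Q m) * (1 - P m * Q m), k m * ((P m - Q m) * (P m + Q m))])"
    by (auto simp: shear_def k_def defs fun_eq_iff algebra_simps power2_eq_square)
  have deq: "(\<lambda>X. vector [dshear m X $ 1, dshear m X $ 2, dshear m X $ 3]) = dshear m"
    by (simp add: fun_eq_iff vec_eq_iff forall_3)
  show ?thesis
    unfolding eq using has_derivative_vec3[OF 1 2 3] by (simp only: deq)
qed

lemma has_derivative_psi: "(psi has_derivative dpsi m) (at m)"
  unfolding dpsi_def[abs_def] psi_eq[abs_def]
  by (intro has_derivative_add has_derivative_Pair has_derivative_const has_derivative_ident has_derivative_shear)

lemma smooth_on_shear: "open S \<Longrightarrow> smooth_on S shear"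
  unfolding shear_def case_prod_beta by (intro smooth_intros)

lemma pullback1_psi: "pullback1 psi \<theta> m X = \<theta> (psi m) (dpsi m X)"
  by (simp add: pullback1_def frechet_derivative_at[OF has_derivative_psi, symmetric])

lemma V2_iff:
  "(\<forall>\<theta>\<in>V2. \<theta> (p, p0, q, q0, v, y) (dp, dp0, dq, dq0, dv, dy) = 0) \<longleftrightarrow>
     dv = - (1/2 * p0^2 * dp) + 1/2 * q0^2 * dq \<and>
     dy $ 1 = - (1/8 * p0^4 * (p^2 + 1) * dp) + 1/8 * q0^4 * (q^2 + 1) * dq \<and>
     dy $ 2 = - (1/8 * p0^4 * (p^2 - 1) * dp) + 1/8 * q0^4 * (q^2 - 1) * dq \<and>
     dy $ 3 = 1/4 * p * p0^4 * dp - 1/4 * q * q0^4 * dq"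
  unfolding V2_def
  by (simp only: ball_simps case_prod_conv) (rule iffI; elim conjE; intro conjI TrueI; linarith)

lemma theta_hat1_iff:
  "(\<forall>\<theta>\<in>theta_hat1. \<theta> (p, p0, v, y) (dp, dp0, dv, dy) = 0) \<longleftrightarrow>
     dv = - (1/2 * p0^2 * dp) \<and>
     dy = vector [- (1/8 * p0^4 * (p^2 + 1) * dp), - (1/8 * p0^4 * (p^2 - 1) * dp), 1/4 * p * p0^4 * dp]"
  unfolding theta_hat1_def
  by (simp only: ball_simps case_prod_conv vec_eq_iff forall_3 vector_3)
    (rule iffI; elim conjE; intro conjI TrueI; linarith)

lemma theta_hat2_iff:
  "(\<forall>\<theta>\<in>theta_hat2. \<theta> (q, q0, v, y) (dq, dq0, dv, dy) = 0) \<longleftrightarrow>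
     dv = 1/2 * q0^2 * dq \<and>
     dy = vector [1/8 * q0^4 * (q^2 + 1) * dq, 1/8 * q0^4 * (q^2 - 1) * dq, - (1/4 * q * q0^4 * dq)]"
  unfolding theta_hat2_def
  by (simp only: ball_simps case_prod_conv vec_eq_iff forall_3 vector_3)
    (rule iffI; elim conjE; intro conjI TrueI; linarith)

section \<open>The non-characteristic initial curve\<close>

lemma sigma0_components:
  assumes "open J" "smooth_on J (sigma0 \<gamma> p p0 q q0 v)"
  shows "smooth_on J p" "smooth_on J p0" "smooth_on J q" "smooth_on J q0" "smooth_on J v" "smooth_on J \<gamma>"
proof -
  let ?s = "sigma0 \<gamma> p p0 q q0 v"
  have "smooth_on J (\<lambda>t. fst (?s t))" "smooth_on J (\<lambda>t. fst (snd (?s t)))"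
    "smooth_on J (\<lambda>t. fst (snd (snd (?s t))))" "smooth_on J (\<lambda>t. fst (snd (snd (snd (?s t)))))"
    "smooth_on J (\<lambda>t. fst (snd (snd (snd (snd (?s t))))))"
    "smooth_on J (\<lambda>t. snd (snd (snd (snd (snd (?s t))))))"
    by (intro smooth_on_fst smooth_on_snd assms)+
  then show "smooth_on J p" "smooth_on J p0" "smooth_on J q" "smooth_on J q0" "smooth_on J v" "smooth_on J \<gamma>"
    by (simp_all add: sigma0_def)
qed

lemma vector_derivative_sigma0:
  assumes "smooth_on J p" "smooth_on J p0" "smooth_on J q" "smooth_on J q0" "smooth_on J v" "smooth_on J \<gamma>"
    and "t \<in> J"
  shows "vector_derivative (sigma0 \<gamma> p p0 q q0 v) (at t) =
    (deriv p t, deriv p0 t, deriv q t, deriv q0 t, deriv v t, vector_derivative \<gamma> (at t))"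
  unfolding sigma0_def
  by (intro vector_derivative_at has_vector_derivative_Pair
      smooth_on_has_vector_derivative[OF assms(6,7)]
      smooth_on_has_real_derivative[OF assms(1,7), THEN has_real_derivative_iff_has_vector_derivative[THEN iffD1]]
      smooth_on_has_real_derivative[OF assms(2,7), THEN has_real_derivative_iff_has_vector_derivative[THEN iffD1]]
      smooth_on_has_real_derivative[OF assms(3,7), THEN has_real_derivative_iff_has_vector_derivative[THEN iffD1]]
      smooth_on_has_real_derivative[OF assms(4,7), THEN has_real_derivative_iff_has_vector_derivative[THEN iffD1]]
      smooth_on_has_real_derivative[OF assms(5,7), THEN has_real_derivative_iff_has_vector_derivative[THEN iffD1]])

text \<open>When \<open>p\<^sub>0 = q\<^sub>0\<close>, the first two components of \<^const>\<open>e3\<close> both equal \<open>- (p + q) / 2\<close>, so the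
  condition on the normal vector is automatic.\<close>

lemma e3_lightlike:
  assumes "p \<noteq> q" "r \<noteq> 0"
  shows "e3 p r q r \<in> lightlike_plane"
  using assms by (simp add: e3_def lightlike_plane_def field_simps)

lemma initial_data_iff:
  assumes "open J"
  shows "initial_data \<gamma> J p p0 q q0 v \<longleftrightarrow>
     smooth_on J (sigma0 \<gamma> p p0 q q0 v) \<and>
     (\<forall>t\<in>J. p0 t = q0 t \<and> p t \<noteq> q t \<and> p0 t * q0 t \<noteq> 0 \<and>
        (\<forall>\<theta>\<in>V2. \<theta> (psi (sigma0 \<gamma> p p0 q q0 v t))
           (dpsi (sigma0 \<gamma> p p0 q q0 v t)
             (deriv p t, deriv p0 t, deriv q t, deriv q0 t, deriv v t, vector_derivative \<gamma> (at t))) = 0) \<and>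
        (deriv p t \<noteq> 0 \<or> deriv p0 t \<noteq> 0) \<and> (deriv q t \<noteq> 0 \<or> deriv q0 t \<noteq> 0))"
    (is "?L \<longleftrightarrow> ?sm \<and> (\<forall>t\<in>J. ?R t)")
proof (cases ?sm)
  case True
  let ?s = "sigma0 \<gamma> p p0 q q0 v"
  define ds where "ds t = (deriv p t, deriv p0 t, deriv q t, deriv q0 t, deriv v t, vector_derivative \<gamma> (at t))" for t
  have ds: "vector_derivative ?s (at t) = ds t" if "t \<in> J" for t
    unfolding ds_def using vector_derivative_sigma0 sigma0_components[OF assms True] that by blast
  have region: "?s ` J \<subseteq> N_region \<longleftrightarrow> (\<forall>t\<in>J. p t \<noteq> q t \<and> p0 t * q0 t \<noteq> 0)"
    by (auto simp: sigma0_def N_region_def)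
  define Z where "Z t \<longleftrightarrow> (\<forall>\<theta>\<in>V2. \<theta> (psi (?s t)) (dpsi (?s t) (ds t)) = 0)" for t
  have V1: "(\<forall>\<theta>\<in>V1. \<theta> (?s t) (ds t) = 0) \<longleftrightarrow> Z t" for t
    by (simp add: V1_def pullback1_psi Z_def)
  have plus: "(\<exists>\<theta>\<in>V1_plus. \<theta> (?s t) (ds t) \<noteq> 0) \<longleftrightarrow> \<not> Z t \<or> deriv q t \<noteq> 0 \<or> deriv q0 t \<noteq> 0" for t
    by (auto simp: Z_def V1_plus_def V2_plus_def pullback1_psi form_dq_def form_dq0_def dpsi_def ds_def)
  have minus: "(\<exists>\<theta>\<in>V1_minus. \<theta> (?s t) (ds t) \<noteq> 0) \<longleftrightarrow> \<not> Z t \<or> deriv p t \<noteq> 0 \<or> deriv p0 t \<noteq> 0" for t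
    by (auto simp: Z_def V1_minus_def V2_minus_def pullback1_psi form_dp_def form_dp0_def dpsi_def ds_def)
  have "?L \<longleftrightarrow> (\<forall>t\<in>J. p0 t = q0 t \<and> (p t \<noteq> q t \<and> p0 t * q0 t \<noteq> 0) \<and>
      vector_derivative ?s (at t) \<noteq> 0 \<and> (\<forall>\<theta>\<in>V1. \<theta> (?s t) (vector_derivative ?s (at t)) = 0) \<and>
      (\<exists>\<theta>\<in>V1_plus. \<theta> (?s t) (vector_derivative ?s (at t)) \<noteq> 0) \<and>
      (\<exists>\<theta>\<in>V1_minus. \<theta> (?s t) (vector_derivative ?s (at t)) \<noteq> 0) \<and>
      e3 (p t) (p0 t) (q t) (q0 t) \<in> lightlike_plane)"
    unfolding initial_data_def integral_curve_def noncharacteristic_def region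
    by (simp only: True ball_conj_distrib simp_thms conj_ac)
  also have "\<dots> \<longleftrightarrow> (\<forall>t\<in>J. p0 t = q0 t \<and> p t \<noteq> q t \<and> p0 t * q0 t \<noteq> 0 \<and> Z t \<and>
        (deriv p t \<noteq> 0 \<or> deriv p0 t \<noteq> 0) \<and> (deriv q t \<noteq> 0 \<or> deriv q0 t \<noteq> 0))"
  proof (rule ball_cong[OF refl])
    fix t assume t: "t \<in> J"
    have nz: "ds t \<noteq> 0" if "deriv p t \<noteq> 0 \<or> deriv p0 t \<noteq> 0"
      using that by (auto simp: ds_def zero_prod_def)
    have e3: "e3 (p t) (p0 t) (q t) (q0 t) \<in> lightlike_plane" if "p0 t = q0 t" "p t \<noteq> q t" "p0 t * q0 t \<noteq> 0"
      using that e3_lightlike[of "p t" "q t" "q0 t"] by simp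
    show "(p0 t = q0 t \<and> (p t \<noteq> q t \<and> p0 t * q0 t \<noteq> 0) \<and>
      vector_derivative ?s (at t) \<noteq> 0 \<and> (\<forall>\<theta>\<in>V1. \<theta> (?s t) (vector_derivative ?s (at t)) = 0) \<and>
      (\<exists>\<theta>\<in>V1_plus. \<theta> (?s t) (vector_derivative ?s (at t)) \<noteq> 0) \<and>
      (\<exists>\<theta>\<in>V1_minus. \<theta> (?s t) (vector_derivative ?s (at t)) \<noteq> 0) \<and>
      e3 (p t) (p0 t) (q t) (q0 t) \<in> lightlike_plane) \<longleftrightarrow>
      (p0 t = q0 t \<and> p t \<noteq> q t \<and> p0 t * q0 t \<noteq> 0 \<and> Z t \<and>
        (deriv p t \<noteq> 0 \<or> deriv p0 t \<noteq> 0) \<and> (deriv q t \<noteq> 0 \<or> deriv q0 t \<noteq> 0))"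
      unfolding ds[OF t] V1 plus minus using nz e3 by blast
  qed
  finally show ?thesis
    using True by (simp add: Z_def ds_def)
qed (simp add: initial_data_def integral_curve_def)

text \<open>With \<open>r = p\<^sub>0 = q\<^sub>0\<close>, \<open>w = p - q\<close>, \<open>D = x\<^sub>1' - x\<^sub>2'\<close>, \<open>S = x\<^sub>1' + x\<^sub>2'\<close> and \<open>T = x\<^sub>3'\<close>, the vanishing of
  the pulled-back forms amounts to \<open>v' = - r\<^sup>2 w' / 2\<close>, \<open>p + q = - 2 T / D\<close> and two scalar differential
  equations for \<open>r\<close> and \<open>w\<close>.\<close>

lemma initial_data_intro:
  fixes \<gamma> :: "real \<Rightarrow> real^3"
  defines "D \<equiv> \<lambda>t. deriv (coord \<gamma> 1) t - deriv (coord \<gamma> 2) t"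
    and "S \<equiv> \<lambda>t. deriv (coord \<gamma> 1) t + deriv (coord \<gamma> 2) t"
    and "T \<equiv> \<lambda>t. deriv (coord \<gamma> 3) t"
  assumes J: "open J" and \<gamma>: "smooth_on J \<gamma>" and D: "\<And>t. t \<in> J \<Longrightarrow> D t \<noteq> 0"
    and r: "smooth_on J r" "\<And>t. t \<in> J \<Longrightarrow> (r t)^3 * deriv r t * w t = D t"
    and w: "smooth_on J w"
      "\<And>t. t \<in> J \<Longrightarrow> (D t)^2 * (w t)^2 + D t * (r t)^4 * (w t)^2 * deriv w t = 4 * ((T t)^2 - S t * D t)"
    and v: "\<And>t. t \<in> J \<Longrightarrow> (v has_real_derivative - (1/2 * (r t)^2 * deriv w t)) (at t)"
    and p: "\<And>t. p t = (- (2 * T t / D t) + w t) / 2"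
    and q: "\<And>t. q t = (- (2 * T t / D t) - w t) / 2"
  shows "initial_data \<gamma> J p r q r v"
proof -
  have coord: "smooth_on J (coord \<gamma> i)" for i
    unfolding coord_def by (intro smooth_intros J \<gamma>)
  have s: "smooth_on J (\<lambda>t. 2 * T t / D t)"
    unfolding T_def D_def
    by (intro smooth_on_divide smooth_intros smooth_on_deriv coord J) (use D D_def in auto)
  have pq: "smooth_on J p" "smooth_on J q"
    unfolding p[abs_def] q[abs_def]
    using smooth_on_divide[OF J smooth_on_add[OF J smooth_on_minus[OF J s] w(1)] smooth_on_const[OF J, of 2]]
      smooth_on_divide[OF J smooth_on_diff[OF J smooth_on_minus[OF J s] w(1)] smooth_on_const[OF J, of 2]]
    by simp_all
  have "smooth_on J v"
  proof (rule smooth_on_antiderivative[OF J])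
    show "(v has_vector_derivative - (1/2 * (r t)^2 * deriv w t)) (at t)" if "t \<in> J" for t
      using v[OF that] by (simp add: has_real_derivative_iff_has_vector_derivative)
  qed (intro smooth_intros smooth_on_deriv J r w)
  with pq have sm: "smooth_on J (sigma0 \<gamma> p r q r v)"
    unfolding sigma0_def by (intro smooth_intros J r \<gamma>)
  have "p t \<noteq> q t \<and> r t * r t \<noteq> 0 \<and>
      (\<forall>\<theta>\<in>V2. \<theta> (psi (sigma0 \<gamma> p r q r v t)) (dpsi (sigma0 \<gamma> p r q r v t)
         (deriv p t, deriv r t, deriv q t, deriv r t, deriv v t, vector_derivative \<gamma> (at t))) = 0) \<and>
      deriv r t \<noteq> 0" if t: "t \<in> J" for t
  proof (intro conjI)
    have nz: "r t \<noteq> 0" "deriv r t \<noteq> 0" "w t \<noteq> 0" using r(2)[OF t] D[OF t] by auto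
    then show "p t \<noteq> q t" "r t * r t \<noteq> 0" "deriv r t \<noteq> 0" by (auto simp: p q)
    define g where "g = vector_derivative \<gamma> (at t)"
    have g: "g $ i = deriv (coord \<gamma> i) t" for i
    proof -
      have "(coord \<gamma> i has_vector_derivative g $ i) (at t)"
        unfolding coord_def g_def
        by (rule bounded_linear.has_vector_derivative[OF bounded_linear_vec_nth
              smooth_on_has_vector_derivative[OF \<gamma> t]])
      then show ?thesis by (simp add: DERIV_imp_deriv has_real_derivative_iff_has_vector_derivative)
    qed
    define R R' P Q P' Q' where "R = r t" "R' = deriv r t" "P = p t" "Q = q t" "P' = deriv p t" "Q' = deriv q t"
    note defs = this
    have w_eq: "w = (\<lambda>t. p t - q t)" by (auto simp: p q field_simps)
    then have wt: "w t = P - Q" by (simp add: defs)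
    have w': "deriv w t = P' - Q'"
      unfolding w_eq defs
      by (intro DERIV_imp_deriv DERIV_diff smooth_on_has_real_derivative[OF _ t] pq)
    have v': "deriv v t = - (1/2 * R^2 * (P' - Q'))"
      using DERIV_imp_deriv[OF v[OF t]] by (simp add: w' defs)
    \<comment> \<open>The velocity of the curve is expressed through \<open>P\<close>, \<open>Q\<close>, \<open>R\<close> and their derivatives; the four
      equations of the Pfaffian system then become polynomial identities.\<close>
    have D1: "g $ 1 - g $ 2 = R^3 * R' * (P - Q)"
      using r(2)[OF t] by (simp add: D_def g w_eq defs)
    have pq_sum: "P + Q = - 2 * T t / D t" by (simp add: defs p q field_simps)
    then have T1: "g $ 3 = - (1/2 * R^3 * R' * (P - Q) * (P + Q))"
      using D[OF t] by (simp add: D1[symmetric] g D_def T_def)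
    have "D t * S t = D t * (R^3 * R' * (P - Q) * P * Q - 1/4 * R^4 * (P - Q)^2 * (P' - Q'))"
    proof -
      have "4 * (D t * S t) = 4 * (T t)^2 - (D t)^2 * (P - Q)^2 - D t * R^4 * (P - Q)^2 * (P' - Q')"
        using w(2)[OF t] unfolding w' wt by (simp add: defs(1) algebra_simps)
      moreover have "4 * (T t)^2 = (D t)^2 * (P + Q)^2"
      proof -
        have "2 * T t = - (D t * (P + Q))" using pq_sum D[OF t] by (simp add: field_simps)
        then have "(2 * T t)^2 = (D t * (P + Q))^2" by simp
        then show ?thesis by (simp add: power_mult_distrib)
      qed
      moreover have "(D t)^2 * (P + Q)^2 - (D t)^2 * (P - Q)^2 = 4 * (D t * (R^3 * R' * (P - Q) * P * Q))"
      proof -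
        have "D t = R^3 * R' * (P - Q)" using r(2)[OF t] by (simp add: w_eq defs)
        moreover have "(D t)^2 * (P + Q)^2 - (D t)^2 * (P - Q)^2 = 4 * (D t * (D t * P * Q))"
          by (simp add: power2_eq_square algebra_simps)
        ultimately show ?thesis by (simp only:)
      qed
      ultimately show ?thesis by (simp add: field_simps)
    qed
    then have S1: "g $ 1 + g $ 2 = R^3 * R' * (P - Q) * P * Q - 1/4 * R^4 * (P - Q)^2 * (P' - Q')"
      using D[OF t] by (simp add: S_def g)
    have g1: "g $ 1 = (R^3 * R' * (P - Q) * P * Q - 1/4 * R^4 * (P - Q)^2 * (P' - Q') + R^3 * R' * (P - Q)) / 2"
      and g2: "g $ 2 = (R^3 * R' * (P - Q) * P * Q - 1/4 * R^4 * (P - Q)^2 * (P' - Q') - R^3 * R' * (P - Q)) / 2"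
      using D1 S1 by auto
    have "\<forall>\<theta>\<in>V2. \<theta> (psi (P, R, Q, R, v t, \<gamma> t)) (dpsi (P, R, Q, R, v t, \<gamma> t) (P', R', Q', R', deriv v t, g)) = 0"
      unfolding psi_eq dpsi_def dshear_def Let_def
      by (simp add: V2_iff g1 g2 T1 v' field_simps power2_eq_square power3_eq_cube power4_eq_xxxx)
    then show "\<forall>\<theta>\<in>V2. \<theta> (psi (sigma0 \<gamma> p r q r v t)) (dpsi (sigma0 \<gamma> p r q r v t)
         (deriv p t, deriv r t, deriv q t, deriv r t, deriv v t, vector_derivative \<gamma> (at t))) = 0"
      by (simp add: sigma0_def defs g_def)
  qed
  with sm show ?thesis by (simp add: initial_data_iff[OF J])
qed

lemma mult_power4_Lipschitz:
  fixes x y x' y' :: real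
  assumes "\<bar>y\<bar> \<le> 2" "\<bar>x'\<bar> \<le> 2" "\<bar>y'\<bar> \<le> 2"
  shows "\<bar>x * y^4 - x' * y'^4\<bar> \<le> 16 * \<bar>x - x'\<bar> + 64 * \<bar>y - y'\<bar>"
proof -
  have p: "\<bar>y\<bar>^n \<le> 2^n" "\<bar>y'\<bar>^n \<le> 2^n" for n using assms by (auto intro: power_mono)
  have "x * y^4 - x' * y'^4 = (x - x') * y^4 + x' * ((y - y') * (y^3 + y^2 * y' + y * y'^2 + y'^3))"
    by (simp add: power2_eq_square power3_eq_cube power4_eq_xxxx algebra_simps)
  also have "\<bar>\<dots>\<bar> \<le> \<bar>x - x'\<bar> * 16 + 2 * (\<bar>y - y'\<bar> * 32)"
  proof (rule order_trans[OF abs_triangle_ineq add_mono])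
    show "\<bar>(x - x') * y^4\<bar> \<le> \<bar>x - x'\<bar> * 16"
      using p(1)[of 4] by (simp add: abs_mult power_abs mult_left_mono)
    have "\<bar>y^3 + y^2 * y' + y * y'^2 + y'^3\<bar> \<le> \<bar>y^3\<bar> + \<bar>y^2 * y'\<bar> + \<bar>y * y'^2\<bar> + \<bar>y'^3\<bar>" by linarith
    also have "\<dots> \<le> 2^3 + 2^2 * 2 + 2 * 2^2 + 2^3"
      unfolding abs_mult power_abs using assms by (intro add_mono mult_mono p) auto
    finally have "\<bar>y^3 + y^2 * y' + y * y'^2 + y'^3\<bar> \<le> 32" by simp
    then show "\<bar>x' * ((y - y') * (y^3 + y^2 * y' + y * y'^2 + y'^3))\<bar> \<le> 2 * (\<bar>y - y'\<bar> * 32)"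
      unfolding abs_mult using assms by (intro mult_mono) auto
  qed
  finally show ?thesis by simp
qed

text \<open>The solution starts at \<open>(1, 1)\<close> and stays within distance \<open>1/2\<close>, so that both components remain
  nonzero.  Its smoothness follows from the equation itself.\<close>

lemma quartic_ode_local_solution:
  fixes D E :: "real \<Rightarrow> real"
  assumes D: "smooth_on {a<..<b} D" and E: "smooth_on {a<..<b} E" and t0: "t0 \<in> {a<..<b}"
  obtains \<alpha> \<beta> x y where "t0 \<in> {\<alpha><..<\<beta>}" "{\<alpha><..<\<beta>} \<subseteq> {a<..<b}"
    and "smooth_on {\<alpha><..<\<beta>} x" "smooth_on {\<alpha><..<\<beta>} y"
    and "\<And>t. t \<in> {\<alpha><..<\<beta>} \<Longrightarrow> x t \<noteq> 0 \<and> y t \<noteq> 0"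
    and "\<And>t. t \<in> {\<alpha><..<\<beta>} \<Longrightarrow> (x has_real_derivative - (D t * (y t * x t ^ 4))) (at t)"
    and "\<And>t. t \<in> {\<alpha><..<\<beta>} \<Longrightarrow> (y has_real_derivative - (E t * (x t * y t ^ 4))) (at t)"
proof -
  define d where "d = min (t0 - a) (b - t0) / 2"
  have "0 < d" "d \<le> (t0 - a) / 2" "d \<le> (b - t0) / 2" using t0 by (auto simp: d_def)
  then have d: "0 < d" "{t0 - d..t0 + d} \<subseteq> {a<..<b}" by auto
  let ?I = "{t0 - d..t0 + d}"
  define f where "f t z = (- (D t * (snd z * fst z ^ 4)), - (E t * (fst z * snd z ^ 4)))" for t and z :: "real \<times> real"
  have cDE: "continuous_on ?I D" "continuous_on ?I E"
    using D E d(2) smooth_on_imp_continuous_on continuous_on_subset by blast+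
  have "bounded (D ` ?I)" "bounded (E ` ?I)"
    using cDE by (auto intro!: compact_imp_bounded compact_continuous_image)
  then obtain K1 K2 where K12: "\<And>t. t \<in> ?I \<Longrightarrow> \<bar>D t\<bar> \<le> K1" "\<And>t. t \<in> ?I \<Longrightarrow> \<bar>E t\<bar> \<le> K2"
    unfolding bounded_iff by (metis image_eqI real_norm_def)
  define K where "K = max K1 K2"
  have K: "\<bar>D t\<bar> \<le> K" "\<bar>E t\<bar> \<le> K" if "t \<in> ?I" for t using K12[OF that] by (auto simp: K_def)
  have ball: "\<bar>fst z\<bar> \<le> 2 \<and> \<bar>snd z\<bar> \<le> 2 \<and> fst z \<noteq> 0 \<and> snd z \<noteq> 0"
    if "z \<in> cball (1, 1) (1/2)" for z :: "real \<times> real"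
  proof -
    have "norm (z - (1, 1)) \<le> 1/2"
      using that by (metis dist_commute dist_norm mem_cball)
    moreover have "\<bar>fst z - 1\<bar> \<le> norm (z - (1, 1))" "\<bar>snd z - 1\<bar> \<le> norm (z - (1, 1))"
      using norm_fst_le[of "fst z - 1" "snd z - 1"] norm_snd_le[of "snd z - 1" "fst z - 1"]
      by (simp_all add: minus_prod_def)
    ultimately have "\<bar>fst z - 1\<bar> \<le> 1/2" "\<bar>snd z - 1\<bar> \<le> 1/2" by linarith+
    then have "1/2 \<le> fst z" "fst z \<le> 2" "1/2 \<le> snd z" "snd z \<le> 2" by linarith+
    then show ?thesis by auto
  qed
  obtain \<delta> z where \<delta>: "0 < \<delta>" "\<delta> \<le> d"
    and z: "\<And>t. t \<in> {t0 - \<delta><..<t0 + \<delta>} \<Longrightarrow> z t \<in> cball (1, 1) (1/2)"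
      "\<And>t. t \<in> {t0 - \<delta><..<t0 + \<delta>} \<Longrightarrow> (z has_vector_derivative f t (z t)) (at t)"
  proof (rule ode_local_solution[OF d(1), of "1/2" t0 "(1, 1)" f "160 * K"])
    have c: "continuous_on (?I \<times> cball (1, 1) (1/2)) (\<lambda>w. D (fst w))"
      "continuous_on (?I \<times> cball (1, 1) (1/2)) (\<lambda>w. E (fst w))"
      by (rule continuous_on_compose2[OF cDE(1) continuous_on_fst[OF continuous_on_id]]
          continuous_on_compose2[OF cDE(2) continuous_on_fst[OF continuous_on_id]]; force)+
    show "continuous_on (?I \<times> cball (1, 1) (1/2)) (\<lambda>(t, z). f t z)"
      unfolding f_def case_prod_beta by (intro continuous_intros c)
    fix t and z z' :: "real \<times> real"
    assume t: "t \<in> ?I" and z: "z \<in> cball (1, 1) (1/2)" and z': "z' \<in> cball (1, 1) (1/2)"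
    \<comment> \<open>Each component is \<open>16 + 64 = 80\<close> times \<open>K\<close> Lipschitz, and the norm of a pair is at most the sum
      of the norms of its two components.\<close>
    let ?N = "norm (z - z')"
    have le: "\<bar>fst z - fst z'\<bar> \<le> ?N" "\<bar>snd z - snd z'\<bar> \<le> ?N"
      using norm_fst_le[of "fst z - fst z'" "snd z - snd z'"] norm_snd_le[of "snd z - snd z'" "fst z - fst z'"]
      by (simp_all add: minus_prod_def)
    have bound: "\<bar>C * u - C * u'\<bar> \<le> K * (80 * ?N)" if "\<bar>C\<bar> \<le> K" "\<bar>u - u'\<bar> \<le> 80 * ?N" for C u u' :: real
    proof -
      have "\<bar>C * u - C * u'\<bar> = \<bar>C\<bar> * \<bar>u - u'\<bar>" by (simp add: abs_mult[symmetric] right_diff_distrib)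
      also have "\<dots> \<le> K * (80 * ?N)" using that by (intro mult_mono) auto
      finally show ?thesis .
    qed
    have "\<bar>snd z * fst z ^ 4 - snd z' * fst z' ^ 4\<bar> \<le> 16 * \<bar>snd z - snd z'\<bar> + 64 * \<bar>fst z - fst z'\<bar>"
      "\<bar>fst z * snd z ^ 4 - fst z' * snd z' ^ 4\<bar> \<le> 16 * \<bar>fst z - fst z'\<bar> + 64 * \<bar>snd z - snd z'\<bar>"
      using ball[OF z] ball[OF z'] by (intro mult_power4_Lipschitz; blast)+
    moreover have "16 * \<bar>snd z - snd z'\<bar> + 64 * \<bar>fst z - fst z'\<bar> \<le> 80 * ?N"
      "16 * \<bar>fst z - fst z'\<bar> + 64 * \<bar>snd z - snd z'\<bar> \<le> 80 * ?N"
      using le by simp_all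
    ultimately have "\<bar>snd z * fst z ^ 4 - snd z' * fst z' ^ 4\<bar> \<le> 80 * ?N"
      "\<bar>fst z * snd z ^ 4 - fst z' * snd z' ^ 4\<bar> \<le> 80 * ?N"
      using order_trans by blast+
    note * = bound[OF K(1)[OF t] this(1)] bound[OF K(2)[OF t] this(2)]
    have "norm (f t z - f t z') \<le> \<bar>fst (f t z - f t z')\<bar> + \<bar>snd (f t z - f t z')\<bar>"
      using norm_Pair_le[of "fst (f t z - f t z')" "snd (f t z - f t z')"] by (simp only: prod.collapse real_norm_def)
    also have "\<dots> = \<bar>D t * (snd z * fst z ^ 4) - D t * (snd z' * fst z' ^ 4)\<bar> +
        \<bar>E t * (fst z * snd z ^ 4) - E t * (fst z' * snd z' ^ 4)\<bar>"
      by (simp add: f_def abs_minus_commute)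
    also have "\<dots> \<le> 160 * K * ?N" using * by simp
    finally show "norm (f t z - f t z') \<le> 160 * K * ?N" .
  qed (use d in auto)
  let ?J = "{t0 - \<delta><..<t0 + \<delta>}"
  define x where "x t = fst (z t)" for t
  define y where "y t = snd (z t)" for t
  have J: "?J \<subseteq> {a<..<b}" using d \<delta> by fastforce
  have der: "(x has_vector_derivative - (D t * (y t * x t ^ 4))) (at t)"
    "(y has_vector_derivative - (E t * (x t * y t ^ 4))) (at t)" if "t \<in> ?J" for t
    using bounded_linear.has_vector_derivative[OF bounded_linear_fst z(2)[OF that]]
      bounded_linear.has_vector_derivative[OF bounded_linear_snd z(2)[OF that]]
    by (simp_all add: f_def x_def[abs_def] y_def[abs_def])
  have "Ck_on k ?J x \<and> Ck_on k ?J y" for k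
  proof (induction k)
    case 0
    have "continuous_on ?J x" "continuous_on ?J y"
      using has_vector_derivative_continuous[OF der(1)] has_vector_derivative_continuous[OF der(2)]
      by (intro continuous_at_imp_continuous_on ballI; simp)+
    then show ?case by simp
  next
    case (Suc k)
    have "smooth_on ?J D" "smooth_on ?J E" using D E J smooth_on_subset by blast+
    then have DE: "Ck_on k ?J D" "Ck_on k ?J E" by (auto dest: smooth_onD)
    have "Ck_on k ?J (\<lambda>t. - (D t * (y t * x t ^ 4)))" "Ck_on k ?J (\<lambda>t. - (E t * (x t * y t ^ 4)))"
      unfolding power4_eq_xxxx by (intro Ck_on_minus Ck_on_mult DE Suc[THEN conjunct1] Suc[THEN conjunct2] open_greaterThanLessThan)+
    then show ?case
      using Ck_on_Suc_real_intro[OF open_greaterThanLessThan der(1)]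
        Ck_on_Suc_real_intro[OF open_greaterThanLessThan der(2)] by blast
  qed
  then have sm: "smooth_on ?J x" "smooth_on ?J y" by (auto simp: smooth_on_def)
  show ?thesis
    by (rule that[of "t0 - \<delta>" "t0 + \<delta>" x y])
      (use sm der J \<delta> z(1) ball in \<open>auto simp: x_def y_def has_real_derivative_iff_has_vector_derivative\<close>)
qed

text \<open>Shrinking the interval makes the ranges of \<open>p\<close> and \<open>q\<close> disjoint, which keeps the whole surface
  in the region \<open>p \<noteq> q\<close>.\<close>

lemma initial_data_from_ode_solution:
  fixes \<gamma> :: "real \<Rightarrow> real^3"
  defines "D \<equiv> \<lambda>t. deriv (coord \<gamma> 1) t - deriv (coord \<gamma> 2) t"
    and "S \<equiv> \<lambda>t. deriv (coord \<gamma> 1) t + deriv (coord \<gamma> 2) t"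
    and "T \<equiv> \<lambda>t. deriv (coord \<gamma> 3) t"
  assumes t0: "t0 \<in> {a<..<b}" and \<gamma>: "smooth_on {a<..<b} \<gamma>" and D: "\<And>t. t \<in> {a<..<b} \<Longrightarrow> D t \<noteq> 0"
    and r: "smooth_on {a<..<b} r" "\<And>t. t \<in> {a<..<b} \<Longrightarrow> (r t)^3 * deriv r t * w t = D t"
    and w: "smooth_on {a<..<b} w" "\<And>t. t \<in> {a<..<b} \<Longrightarrow>
      (D t)^2 * (w t)^2 + D t * (r t)^4 * (w t)^2 * deriv w t = 4 * ((T t)^2 - S t * D t)"
    and p: "\<And>t. p t = (- (2 * T t / D t) + w t) / 2"
    and q: "\<And>t. q t = (- (2 * T t / D t) - w t) / 2"
  obtains \<alpha> \<beta> v where "t0 \<in> {\<alpha><..<\<beta>}" "{\<alpha><..<\<beta>} \<subseteq> {a<..<b}"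
    and "initial_data \<gamma> {\<alpha><..<\<beta>} p r q r v"
    and "\<And>t1 t2. t1 \<in> {\<alpha><..<\<beta>} \<Longrightarrow> t2 \<in> {\<alpha><..<\<beta>} \<Longrightarrow> p t1 \<noteq> q t2"
    and "\<And>t. t \<in> {\<alpha><..<\<beta>} \<Longrightarrow> (v has_real_derivative - (1/2 * (r t)^2 * deriv w t)) (at t)"
proof -
  let ?I = "{a<..<b}"
  have "smooth_on ?I (\<lambda>t. - (1/2 * (r t)^2 * deriv w t))"
    by (intro smooth_intros smooth_on_deriv r w open_greaterThanLessThan)
  then obtain v where v: "\<And>t. t \<in> ?I \<Longrightarrow> (v has_real_derivative - (1/2 * (r t)^2 * deriv w t)) (at t)"
    using antiderivative_on_open_interval smooth_on_imp_continuous_on by blast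
  have id: "initial_data \<gamma> J p r q r v" if J: "open J" "J \<subseteq> ?I" for J
  proof (rule initial_data_intro[where w = w])
    show "smooth_on J \<gamma>" "smooth_on J r" "smooth_on J w"
      using smooth_on_subset J(2) \<gamma> r(1) w(1) by blast+
  qed (use J D r(2) w(2) v p q in \<open>auto simp: D_def S_def T_def\<close>)
  then have "smooth_on ?I (sigma0 \<gamma> p r q r v)"
    by (simp add: initial_data_iff)
  note pq = sigma0_components(1,3)[OF open_greaterThanLessThan this]
  have "w t0 \<noteq> 0" using r(2)[OF t0] D[OF t0] by auto
  then have e: "\<bar>w t0\<bar> / 2 > 0" by simp
  have "continuous (at t0) p" "continuous (at t0) q"
    using pq t0 smooth_on_imp_continuous_on continuous_on_eq_continuous_at open_greaterThanLessThan by blast+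
  then obtain d1 d2 where d1: "d1 > 0" "\<And>t. dist t t0 < d1 \<Longrightarrow> dist (p t) (p t0) < \<bar>w t0\<bar> / 2"
    and d2: "d2 > 0" "\<And>t. dist t t0 < d2 \<Longrightarrow> dist (q t) (q t0) < \<bar>w t0\<bar> / 2"
    unfolding continuous_at_eps_delta using e by metis
  define \<alpha> \<beta> where "\<alpha> = max a (t0 - min d1 d2)" and "\<beta> = min b (t0 + min d1 d2)"
  have sub: "{\<alpha><..<\<beta>} \<subseteq> ?I" by (auto simp: \<alpha>_def \<beta>_def)
  show ?thesis
  proof (rule that[of \<alpha> \<beta> v])
    show "t0 \<in> {\<alpha><..<\<beta>}" using t0 d1(1) d2(1) by (auto simp: \<alpha>_def \<beta>_def)
    show "p t1 \<noteq> q t2" if "t1 \<in> {\<alpha><..<\<beta>}" "t2 \<in> {\<alpha><..<\<beta>}" for t1 t2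
    proof -
      have "dist t1 t0 < d1" "dist t2 t0 < d2" using that by (auto simp: \<alpha>_def \<beta>_def dist_real_def)
      then have "\<bar>p t1 - p t0\<bar> < \<bar>w t0\<bar> / 2" "\<bar>q t2 - q t0\<bar> < \<bar>w t0\<bar> / 2"
        using d1(2) d2(2) by (auto simp: dist_real_def)
      moreover have "p t0 - q t0 = w t0" by (simp add: p q field_simps)
      ultimately show ?thesis by linarith
    qed
  qed (use sub v id[OF _ sub] in auto)
qed

text \<open>The substitution \<open>r = 1 / x\<close>, \<open>w = x / y\<close> turns the two scalar equations into a polynomial system.\<close>

lemma initial_data_exists:
  fixes \<gamma> :: "real \<Rightarrow> real^3"
  assumes \<gamma>: "smooth_on {a<..<b} \<gamma>" and t0: "t0 \<in> {a<..<b}"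
    and D: "\<And>t. t \<in> {a<..<b} \<Longrightarrow> deriv (coord \<gamma> 1) t - deriv (coord \<gamma> 2) t \<noteq> 0"
  obtains \<alpha> \<beta> p r q v where "t0 \<in> {\<alpha><..<\<beta>}" "{\<alpha><..<\<beta>} \<subseteq> {a<..<b}"
    and "initial_data \<gamma> {\<alpha><..<\<beta>} p r q r v"
    and "\<And>t1 t2. t1 \<in> {\<alpha><..<\<beta>} \<Longrightarrow> t2 \<in> {\<alpha><..<\<beta>} \<Longrightarrow> p t1 \<noteq> q t2"
proof -
  define D where "D t = deriv (coord \<gamma> 1) t - deriv (coord \<gamma> 2) t" for t
  define S where "S t = deriv (coord \<gamma> 1) t + deriv (coord \<gamma> 2) t" for t
  define T where "T t = deriv (coord \<gamma> 3) t" for t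
  define E where "E t = 4 * ((T t)^2 - S t * D t) / D t" for t
  have D0: "D t \<noteq> 0" if "t \<in> {a<..<b}" for t using D[OF that] by (simp add: D_def)
  have coord: "smooth_on {a<..<b} (deriv (coord \<gamma> i))" for i
    unfolding coord_def by (intro smooth_on_deriv smooth_intros \<gamma> open_greaterThanLessThan)
  have smD: "smooth_on {a<..<b} D" and "smooth_on {a<..<b} S" "smooth_on {a<..<b} T"
    unfolding D_def S_def T_def by (intro smooth_intros coord open_greaterThanLessThan)+
  then have smE: "smooth_on {a<..<b} E"
    unfolding E_def by (intro smooth_on_divide smooth_intros open_greaterThanLessThan D0)
  obtain \<alpha>' \<beta>' x y where I: "t0 \<in> {\<alpha>'<..<\<beta>'}" "{\<alpha>'<..<\<beta>'} \<subseteq> {a<..<b}"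
    and sm: "smooth_on {\<alpha>'<..<\<beta>'} x" "smooth_on {\<alpha>'<..<\<beta>'} y"
    and nz: "\<And>t. t \<in> {\<alpha>'<..<\<beta>'} \<Longrightarrow> x t \<noteq> 0 \<and> y t \<noteq> 0"
    and der: "\<And>t. t \<in> {\<alpha>'<..<\<beta>'} \<Longrightarrow> (x has_real_derivative - (D t * (y t * x t ^ 4))) (at t)"
      "\<And>t. t \<in> {\<alpha>'<..<\<beta>'} \<Longrightarrow> (y has_real_derivative - (E t * (x t * y t ^ 4))) (at t)"
    by (rule quartic_ode_local_solution[OF smD smE t0]) blast
  define r where "r t = 1 / x t" for t
  define w where "w t = x t / y t" for t
  define p where "p t = (- (2 * T t / D t) + w t) / 2" for t
  define q where "q t = (- (2 * T t / D t) - w t) / 2" for t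
  obtain \<alpha> \<beta> v where "t0 \<in> {\<alpha><..<\<beta>}" "{\<alpha><..<\<beta>} \<subseteq> {\<alpha>'<..<\<beta>'}"
    "initial_data \<gamma> {\<alpha><..<\<beta>} p r q r v"
    "\<And>t1 t2. t1 \<in> {\<alpha><..<\<beta>} \<Longrightarrow> t2 \<in> {\<alpha><..<\<beta>} \<Longrightarrow> p t1 \<noteq> q t2"
  proof (rule initial_data_from_ode_solution[of t0 \<alpha>' \<beta>' \<gamma> r w p q])
    show "smooth_on {\<alpha>'<..<\<beta>'} \<gamma>" using smooth_on_subset \<gamma> I(2) by blast
    show "smooth_on {\<alpha>'<..<\<beta>'} r"
      unfolding r_def using nz by (intro smooth_on_divide smooth_on_const sm) auto
    show "smooth_on {\<alpha>'<..<\<beta>'} w"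
      unfolding w_def using nz by (intro smooth_on_divide sm) auto
    fix t assume t: "t \<in> {\<alpha>'<..<\<beta>'}"
    then have xy: "x t \<noteq> 0" "y t \<noteq> 0" and Dt: "D t \<noteq> 0" using nz D0 I(2) by auto
    show "deriv (coord \<gamma> 1) t - deriv (coord \<gamma> 2) t \<noteq> 0" using Dt by (simp add: D_def)
    have "(r has_real_derivative D t * y t * (x t)^2) (at t)"
      unfolding r_def using xy
      by (auto intro!: derivative_eq_intros der t simp: power2_eq_square power4_eq_xxxx field_simps)
    then have r': "deriv r t = D t * y t * (x t)^2" by (rule DERIV_imp_deriv)
    have "(w has_real_derivative E t * (x t)^2 * (y t)^2 - D t * (x t)^4) (at t)"
      unfolding w_def using xy
      by (auto intro!: derivative_eq_intros der t simp: power2_eq_square power4_eq_xxxx field_simps)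
    then have w': "deriv w t = E t * (x t)^2 * (y t)^2 - D t * (x t)^4" by (rule DERIV_imp_deriv)
    show "(r t)^3 * deriv r t * w t = deriv (coord \<gamma> 1) t - deriv (coord \<gamma> 2) t"
      unfolding r' using xy by (simp add: r_def w_def D_def[symmetric] power2_eq_square power3_eq_cube field_simps)
    have "(D t)^2 * (w t)^2 + D t * (r t)^4 * (w t)^2 * deriv w t = D t * E t"
      unfolding w' using xy by (simp add: r_def w_def power2_eq_square power4_eq_xxxx field_simps)
    also have "\<dots> = 4 * ((T t)^2 - S t * D t)" using Dt by (simp add: E_def)
    finally show "(deriv (coord \<gamma> 1) t - deriv (coord \<gamma> 2) t)^2 * (w t)^2 +
        (deriv (coord \<gamma> 1) t - deriv (coord \<gamma> 2) t) * (r t)^4 * (w t)^2 * deriv w t =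
        4 * ((deriv (coord \<gamma> 3) t)^2 - (deriv (coord \<gamma> 1) t + deriv (coord \<gamma> 2) t) *
          (deriv (coord \<gamma> 1) t - deriv (coord \<gamma> 2) t))"
      by (simp add: D_def S_def T_def)
  qed (use I in \<open>auto simp: p_def q_def T_def D_def\<close>)
  then show ?thesis using that I(2) by blast
qed

section \<open>Decomposition into integral curves of the singular systems\<close>

lemma has_vector_derivative_vec3:
  assumes "(f has_vector_derivative f') F" "(g has_vector_derivative g') F" "(h has_vector_derivative h') F"
  shows "((\<lambda>x. vector [f x, g x, h x] :: real^3) has_vector_derivative vector [f', g', h']) F"
proof -
  have "(\<lambda>s. vector [s *\<^sub>R f', s *\<^sub>R g', s *\<^sub>R h']) = (\<lambda>s. s *\<^sub>R (vector [f', g', h'] :: real^3))"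
    by (simp add: fun_eq_iff vec_eq_iff forall_3)
  then show ?thesis
    using has_derivative_vec3[OF assms[unfolded has_vector_derivative_def]]
    by (simp only: has_vector_derivative_def)
qed

lemma psi_sigma0:
  "psi (sigma0 \<gamma> p p0 q q0 v t) =
    (p t, p0 t, q t, q0 t, v t, \<gamma> t + shear (sigma0 \<gamma> p p0 q q0 v t))"
  by (simp add: psi_eq sigma0_def)

text \<open>The components of \<open>\<sigma>\<^sub>+\<close> are antiderivatives of the part of the equations that involves \<open>p\<close>; the
  remainder \<open>\<sigma> - \<sigma>\<^sub>+\<close> then satisfies the equations for \<open>\<sigma>\<^sub>-\<close>.\<close>

lemma decomposition_exists:
  assumes J: "J = {\<alpha><..<\<beta>}" and "initial_data \<gamma> J p p0 q q0 v"
  shows "\<exists>\<sigma>p \<sigma>m. decomposition J (psi \<circ> sigma0 \<gamma> p p0 q q0 v) \<sigma>p \<sigma>m"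
proof -
  let ?s = "sigma0 \<gamma> p p0 q q0 v"
  let ?ds = "\<lambda>t. (deriv p t, deriv p0 t, deriv q t, deriv q0 t, deriv v t, vector_derivative \<gamma> (at t))"
  have op: "open J" using J by simp
  have sm: "smooth_on J ?s"
    and V2: "\<And>t. t \<in> J \<Longrightarrow> \<forall>\<theta>\<in>V2. \<theta> (psi (?s t)) (dpsi (?s t) (?ds t)) = 0"
    and nz: "\<And>t. t \<in> J \<Longrightarrow> (deriv p t \<noteq> 0 \<or> deriv p0 t \<noteq> 0) \<and> (deriv q t \<noteq> 0 \<or> deriv q0 t \<noteq> 0)"
    using assms(2) unfolding initial_data_iff[OF op] by blast+
  note comp = sigma0_components[OF op sm]
  have der: "(f has_vector_derivative deriv f t) (at t)" if "smooth_on J f" "t \<in> J" for f :: "real \<Rightarrow> real" and t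
    using smooth_on_has_real_derivative[OF that] by (simp add: has_real_derivative_iff_has_vector_derivative)
  define y where "y t = \<gamma> t + shear (?s t)" for t
  define dy where "dy t = vector_derivative \<gamma> (at t) + dshear (?s t) (?ds t)" for t
  have smy: "smooth_on J y" unfolding y_def
    by (intro smooth_intros comp op smooth_on_compose[OF op open_UNIV sm smooth_on_shear]) auto
  have dy: "(y has_vector_derivative dy t) (at t)" if "t \<in> J" for t
  proof -
    have "(?s has_vector_derivative ?ds t) (at t)"
      using smooth_on_has_vector_derivative[OF sm that] vector_derivative_sigma0[OF comp that] by simp
    from vector_derivative_diff_chain_within[OF this has_derivative_at_withinI[OF has_derivative_shear]]
    have "((\<lambda>t. shear (?s t)) has_vector_derivative dshear (?s t) (?ds t)) (at t)"
      by (simp add: o_def)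
    then show ?thesis unfolding y_def dy_def
      by (intro has_vector_derivative_add smooth_on_has_vector_derivative[OF comp(6) that])
  qed
  have eqs: "deriv v t = - (1/2 * (p0 t)^2 * deriv p t) + 1/2 * (q0 t)^2 * deriv q t"
     "dy t $ 1 = - (1/8 * (p0 t)^4 * ((p t)^2 + 1) * deriv p t) + 1/8 * (q0 t)^4 * ((q t)^2 + 1) * deriv q t"
     "dy t $ 2 = - (1/8 * (p0 t)^4 * ((p t)^2 - 1) * deriv p t) + 1/8 * (q0 t)^4 * ((q t)^2 - 1) * deriv q t"
     "dy t $ 3 = 1/4 * p t * (p0 t)^4 * deriv p t - 1/4 * q t * (q0 t)^4 * deriv q t" if "t \<in> J" for t
  proof -
    have "dpsi (?s t) (?ds t) = (deriv p t, deriv p0 t, deriv q t, deriv q0 t, deriv v t, dy t)"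
      by (simp add: dpsi_def dy_def)
    with V2[OF that] show "deriv v t = - (1/2 * (p0 t)^2 * deriv p t) + 1/2 * (q0 t)^2 * deriv q t"
     "dy t $ 1 = - (1/8 * (p0 t)^4 * ((p t)^2 + 1) * deriv p t) + 1/8 * (q0 t)^4 * ((q t)^2 + 1) * deriv q t"
     "dy t $ 2 = - (1/8 * (p0 t)^4 * ((p t)^2 - 1) * deriv p t) + 1/8 * (q0 t)^4 * ((q t)^2 - 1) * deriv q t"
     "dy t $ 3 = 1/4 * p t * (p0 t)^4 * deriv p t - 1/4 * q t * (q0 t)^4 * deriv q t"
      by (simp_all only: psi_sigma0 V2_iff)
  qed
  define f0 f1 f2 f3 where "f0 t = - (1/2 * (p0 t)^2 * deriv p t)"
    and "f1 t = - (1/8 * (p0 t)^4 * ((p t)^2 + 1) * deriv p t)"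
    and "f2 t = - (1/8 * (p0 t)^4 * ((p t)^2 - 1) * deriv p t)"
    and "f3 t = 1/4 * p t * (p0 t)^4 * deriv p t" for t
  note f_def = this
  have smf: "smooth_on J f0" "smooth_on J f1" "smooth_on J f2" "smooth_on J f3"
    unfolding f_def by (intro smooth_intros smooth_on_deriv op comp)+
  have anti: "\<exists>F. smooth_on J F \<and> (\<forall>t\<in>J. (F has_vector_derivative f t) (at t))" if "smooth_on J f" for f :: "real \<Rightarrow> real"
  proof -
    have "continuous_on {\<alpha><..<\<beta>} f" using smooth_on_imp_continuous_on[OF that] J by simp
    then obtain F where "\<And>t. t \<in> {\<alpha><..<\<beta>} \<Longrightarrow> (F has_real_derivative f t) (at t)"
      by (rule antiderivative_on_open_interval) blast
    then have F: "(F has_vector_derivative f t) (at t)" if "t \<in> J" for t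
      using that J by (simp add: has_real_derivative_iff_has_vector_derivative)
    with smooth_on_antiderivative[OF op F that] show ?thesis by blast
  qed
  obtain F0 where F0: "smooth_on J F0" "\<forall>t\<in>J. (F0 has_vector_derivative f0 t) (at t)"
    using anti[OF smf(1)] by blast
  obtain F1 where F1: "smooth_on J F1" "\<forall>t\<in>J. (F1 has_vector_derivative f1 t) (at t)"
    using anti[OF smf(2)] by blast
  obtain F2 where F2: "smooth_on J F2" "\<forall>t\<in>J. (F2 has_vector_derivative f2 t) (at t)"
    using anti[OF smf(3)] by blast
  obtain F3 where F3: "smooth_on J F3" "\<forall>t\<in>J. (F3 has_vector_derivative f3 t) (at t)"
    using anti[OF smf(4)] by blast
  note smF = F0(1) F1(1) F2(1) F3(1) and F = F0(2)[rule_format] F1(2)[rule_format] F2(2)[rule_format] F3(2)[rule_format]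
  define \<sigma>p :: "real \<Rightarrow> pt6" where "\<sigma>p t = (p t, p0 t, F0 t, vector [F1 t, F2 t, F3 t])" for t
  define \<sigma>m :: "real \<Rightarrow> pt6" where "\<sigma>m t = (q t, q0 t, v t - F0 t, y t - vector [F1 t, F2 t, F3 t])" for t
  have p': "vector_derivative \<sigma>p (at t) = (deriv p t, deriv p0 t, f0 t, vector [f1 t, f2 t, f3 t])" if "t \<in> J" for t
    unfolding \<sigma>p_def
    by (intro vector_derivative_at has_vector_derivative_Pair has_vector_derivative_vec3 der comp F that)
  have m': "vector_derivative \<sigma>m (at t) = (deriv q t, deriv q0 t, deriv v t - f0 t, dy t - vector [f1 t, f2 t, f3 t])"
    if "t \<in> J" for t
    unfolding \<sigma>m_def
    by (intro vector_derivative_at has_vector_derivative_Pair has_vector_derivative_diff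
        has_vector_derivative_vec3 der comp F dy that)
  have "integral_curve UNIV theta_hat1 J \<sigma>p"
    unfolding integral_curve_def
  proof (intro conjI ballI)
    show "smooth_on J \<sigma>p" unfolding \<sigma>p_def by (intro smooth_intros comp smF op)
    fix t assume t: "t \<in> J"
    show "vector_derivative \<sigma>p (at t) \<noteq> 0" using nz[OF t] by (auto simp: p'[OF t] zero_prod_def)
    have "\<forall>\<theta>\<in>theta_hat1. \<theta> (\<sigma>p t) (vector_derivative \<sigma>p (at t)) = 0"
      unfolding p'[OF t] \<sigma>p_def theta_hat1_iff by (simp add: f_def)
    then show "\<theta> (\<sigma>p t) (vector_derivative \<sigma>p (at t)) = 0" if "\<theta> \<in> theta_hat1" for \<theta> using that by blast
  qed simp
  moreover have "integral_curve UNIV theta_hat2 J \<sigma>m"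
    unfolding integral_curve_def
  proof (intro conjI ballI)
    show "smooth_on J \<sigma>m" unfolding \<sigma>m_def by (intro smooth_intros comp smF smy op)
    fix t assume t: "t \<in> J"
    show "vector_derivative \<sigma>m (at t) \<noteq> 0" using nz[OF t] by (auto simp: m'[OF t] zero_prod_def)
    have "\<forall>\<theta>\<in>theta_hat2. \<theta> (\<sigma>m t) (vector_derivative \<sigma>m (at t)) = 0"
      unfolding m'[OF t] \<sigma>m_def theta_hat2_iff by (simp add: f_def eqs[OF t] vec_eq_iff forall_3)
    then show "\<theta> (\<sigma>m t) (vector_derivative \<sigma>m (at t)) = 0" if "\<theta> \<in> theta_hat2" for \<theta> using that by blast
  qed simp
  moreover have "(psi \<circ> ?s) t = star (\<sigma>p t) (\<sigma>m t)" for t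
    by (simp add: psi_sigma0 \<sigma>p_def \<sigma>m_def star_def y_def)
  ultimately show ?thesis unfolding decomposition_def by blast
qed

text \<open>Along an integral curve of either singular system, the tangent vector is determined by its first
  two components; since it does not vanish, these do not both vanish.\<close>

lemma theta_hat1_tangent:
  assumes "integral_curve UNIV theta_hat1 J \<sigma>" "t \<in> J" "\<sigma> t = (p, p0, v, y)"
  obtains dp dp0 where "(\<sigma> has_vector_derivative (dp, dp0, - (1/2 * p0^2 * dp),
      vector [- (1/8 * p0^4 * (p^2 + 1) * dp), - (1/8 * p0^4 * (p^2 - 1) * dp), 1/4 * p * p0^4 * dp])) (at t)"
    and "dp \<noteq> 0 \<or> dp0 \<noteq> 0"
proof -
  obtain dp dp0 dv dy where d: "vector_derivative \<sigma> (at t) = (dp, dp0, dv, dy)"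
    by (cases "vector_derivative \<sigma> (at t)") auto
  have "smooth_on J \<sigma>" "\<forall>\<theta>\<in>theta_hat1. \<theta> (p, p0, v, y) (dp, dp0, dv, dy) = 0" "(dp, dp0, dv, dy) \<noteq> 0"
    using assms d unfolding integral_curve_def by (blast, metis, metis)
  moreover from this(2) have "dv = - (1/2 * p0^2 * dp)"
     "dy = vector [- (1/8 * p0^4 * (p^2 + 1) * dp), - (1/8 * p0^4 * (p^2 - 1) * dp), 1/4 * p * p0^4 * dp]"
    unfolding theta_hat1_iff by blast+
  moreover from this have "dv = 0 \<and> dy = 0" if "dp = 0"
    using that by (simp add: vec_eq_iff forall_3)
  ultimately show ?thesis
    using that smooth_on_has_vector_derivative[OF _ assms(2)] d by (metis zero_prod_def)
qed

lemma theta_hat2_tangent: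
  assumes "integral_curve UNIV theta_hat2 J \<sigma>" "t \<in> J" "\<sigma> t = (q, q0, v, y)"
  obtains dq dq0 where "(\<sigma> has_vector_derivative (dq, dq0, 1/2 * q0^2 * dq,
      vector [1/8 * q0^4 * (q^2 + 1) * dq, 1/8 * q0^4 * (q^2 - 1) * dq, - (1/4 * q * q0^4 * dq)])) (at t)"
    and "dq \<noteq> 0 \<or> dq0 \<noteq> 0"
proof -
  obtain dq dq0 dv dy where d: "vector_derivative \<sigma> (at t) = (dq, dq0, dv, dy)"
    by (cases "vector_derivative \<sigma> (at t)") auto
  have "smooth_on J \<sigma>" "\<forall>\<theta>\<in>theta_hat2. \<theta> (q, q0, v, y) (dq, dq0, dv, dy) = 0" "(dq, dq0, dv, dy) \<noteq> 0"
    using assms d unfolding integral_curve_def by (blast, metis, metis)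
  moreover from this(2) have "dv = 1/2 * q0^2 * dq"
     "dy = vector [1/8 * q0^4 * (q^2 + 1) * dq, 1/8 * q0^4 * (q^2 - 1) * dq, - (1/4 * q * q0^4 * dq)]"
    unfolding theta_hat2_iff by blast+
  moreover from this have "dv = 0 \<and> dy = 0" if "dq = 0"
    using that by (simp add: vec_eq_iff forall_3)
  ultimately show ?thesis
    using that smooth_on_has_vector_derivative[OF _ assms(2)] d by (metis zero_prod_def)
qed

text \<open>The first two components of both factors can be read off from \<open>\<sigma>\<close>, so two choices of \<open>\<sigma>\<^sub>+\<close> have the
  same tangent vectors and differ by a constant.\<close>

lemma decomposition_unique:
  assumes J: "J = {\<alpha><..<\<beta>}" and \<sigma>: "decomposition J \<sigma> \<sigma>p \<sigma>m" and \<tau>: "decomposition J \<sigma> \<tau>p \<tau>m"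
  obtains cv cy where "\<And>t. t \<in> J \<Longrightarrow> \<tau>p t = \<sigma>p t + (0, 0, cv, cy) \<and> \<tau>m t = \<sigma>m t - (0, 0, cv, cy)"
proof -
  have ic: "integral_curve UNIV theta_hat1 J \<sigma>p" "integral_curve UNIV theta_hat1 J \<tau>p"
    and eq: "\<And>t. t \<in> J \<Longrightarrow> star (\<tau>p t) (\<tau>m t) = star (\<sigma>p t) (\<sigma>m t)"
    using \<sigma> \<tau> unfolding decomposition_def by auto
  have same: "fst (\<tau>p t) = fst (\<sigma>p t)" "fst (snd (\<tau>p t)) = fst (snd (\<sigma>p t))"
    "fst (\<tau>m t) = fst (\<sigma>m t)" "fst (snd (\<tau>m t)) = fst (snd (\<sigma>m t))"
    "fst (snd (snd (\<tau>p t))) + fst (snd (snd (\<tau>m t))) = fst (snd (snd (\<sigma>p t))) + fst (snd (snd (\<sigma>m t)))"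
    "snd (snd (snd (\<tau>p t))) + snd (snd (snd (\<tau>m t))) = snd (snd (snd (\<sigma>p t))) + snd (snd (snd (\<sigma>m t)))"
    if "t \<in> J" for t
    using eq[OF that] by (auto simp: star_def case_prod_beta)
  have zero: "((\<lambda>t. \<tau>p t - \<sigma>p t) has_vector_derivative 0) (at t within J)" if t: "t \<in> J" for t
  proof -
    obtain p p0 v y where s: "\<sigma>p t = (p, p0, v, y)" by (cases "\<sigma>p t") auto
    with same(1,2)[OF t] obtain v' y' where u: "\<tau>p t = (p, p0, v', y')" by (cases "\<tau>p t") auto
    obtain dp dp0 where d: "(\<sigma>p has_vector_derivative (dp, dp0, - (1/2 * p0^2 * dp),
        vector [- (1/8 * p0^4 * (p^2 + 1) * dp), - (1/8 * p0^4 * (p^2 - 1) * dp), 1/4 * p * p0^4 * dp])) (at t)"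
      by (rule theta_hat1_tangent[OF ic(1) t s])
    obtain dp' dp0' where d': "(\<tau>p has_vector_derivative (dp', dp0', - (1/2 * p0^2 * dp'),
        vector [- (1/8 * p0^4 * (p^2 + 1) * dp'), - (1/8 * p0^4 * (p^2 - 1) * dp'), 1/4 * p * p0^4 * dp'])) (at t)"
      by (rule theta_hat1_tangent[OF ic(2) t u])
    have "((\<lambda>t. fst (\<tau>p t)) has_vector_derivative dp') (at t)" "((\<lambda>t. fst (snd (\<tau>p t))) has_vector_derivative dp0') (at t)"
      using bounded_linear.has_vector_derivative[OF bounded_linear_fst d']
        bounded_linear.has_vector_derivative[OF bounded_linear_compose[OF bounded_linear_fst bounded_linear_snd] d'] by auto
    then have "((\<lambda>t. fst (\<sigma>p t)) has_vector_derivative dp') (at t)" "((\<lambda>t. fst (snd (\<sigma>p t))) has_vector_derivative dp0') (at t)"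
      using same(1,2) t J by (auto elim!: has_vector_derivative_transform_within_open[of _ _ _ J])
    moreover have "((\<lambda>t. fst (\<sigma>p t)) has_vector_derivative dp) (at t)" "((\<lambda>t. fst (snd (\<sigma>p t))) has_vector_derivative dp0) (at t)"
      using bounded_linear.has_vector_derivative[OF bounded_linear_fst d]
        bounded_linear.has_vector_derivative[OF bounded_linear_compose[OF bounded_linear_fst bounded_linear_snd] d] by auto
    ultimately have "dp' = dp" "dp0' = dp0"
      using vector_derivative_unique_at by blast+
    then show ?thesis
      using has_vector_derivative_diff[OF d' d] by (simp add: zero_prod_def has_vector_derivative_at_within)
  qed
  have "convex J" using J by simp
  then have "\<exists>c. \<forall>t\<in>J. \<tau>p t - \<sigma>p t = c"
    by (rule has_vector_derivative_zero_constant[OF _ zero]) auto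
  then obtain c where c: "\<And>t. t \<in> J \<Longrightarrow> \<tau>p t - \<sigma>p t = c" by blast
  show ?thesis
  proof (rule that[of "fst (snd (snd c))" "snd (snd (snd c))"])
    fix t assume t: "t \<in> J"
    have "c = (0, 0, fst (snd (snd c)), snd (snd (snd c)))"
      using same(1,2)[OF t] c[OF t] by (auto simp: prod_eq_iff)
    then have "\<tau>p t = \<sigma>p t + (0, 0, fst (snd (snd c)), snd (snd (snd c)))"
      using c[OF t] by (metis diff_eq_eq add.commute)
    moreover from this have "\<tau>m t = \<sigma>m t - (0, 0, fst (snd (snd c)), snd (snd (snd c)))"
      using same[OF t] by (simp add: prod_eq_iff algebra_simps)
    ultimately show "\<tau>p t = \<sigma>p t + (0, 0, fst (snd (snd c)), snd (snd (snd c))) \<and>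
        \<tau>m t = \<sigma>m t - (0, 0, fst (snd (snd c)), snd (snd (snd c)))" by blast
  qed
qed

lemma star_shift: "star (m + (0, 0, cv, cy)) (n - (0, 0, cv, cy)) = star m n"
  by (cases m; cases n) (simp add: star_def)

section \<open>The integral surface\<close>

lemma bounded_linear_star: "bounded_linear (\<lambda>z. star (fst z) (snd z))"
  unfolding linear_conv_bounded_linear[symmetric]
  by (rule linearI) (simp_all add: star_def case_prod_beta algebra_simps)

lemma smooth_on_iota2:
  assumes "open J" "smooth_on J \<sigma>p" "smooth_on J \<sigma>m"
  shows "smooth_on (J \<times> J) (iota2 \<sigma>p \<sigma>m)"
proof -
  have op: "open (J \<times> J)" using assms(1) by (simp add: open_Times)
  have "smooth_on (J \<times> J) (\<lambda>z. (\<sigma>p (fst z), \<sigma>m (snd z)))"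
    by (intro smooth_on_Pair op smooth_on_compose[OF op assms(1) _ assms(2)]
        smooth_on_compose[OF op assms(1) _ assms(3)] smooth_on_fst smooth_on_snd smooth_on_id) auto
  from smooth_on_bounded_linear[OF op bounded_linear_star this]
  show ?thesis by (simp add: iota2_def case_prod_beta')
qed

lemma has_derivative_iota2:
  assumes "(\<sigma>p has_vector_derivative a) (at (fst z))" "(\<sigma>m has_vector_derivative b) (at (snd z))"
  shows "(iota2 \<sigma>p \<sigma>m has_derivative (\<lambda>X. star (fst X *\<^sub>R a) (snd X *\<^sub>R b))) (at z)"
proof -
  have "((\<lambda>z. \<sigma>p (fst z)) has_derivative (\<lambda>X. fst X *\<^sub>R a)) (at z)"
    using has_derivative_compose[OF has_derivative_fst[OF has_derivative_ident] assms(1)[unfolded has_vector_derivative_def]] .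
  moreover have "((\<lambda>z. \<sigma>m (snd z)) has_derivative (\<lambda>X. snd X *\<^sub>R b)) (at z)"
    using has_derivative_compose[OF has_derivative_snd[OF has_derivative_ident] assms(2)[unfolded has_vector_derivative_def]] .
  ultimately have "((\<lambda>z. (\<sigma>p (fst z), \<sigma>m (snd z))) has_derivative (\<lambda>X. (fst X *\<^sub>R a, snd X *\<^sub>R b))) (at z)"
    by (rule has_derivative_Pair)
  from bounded_linear.has_derivative[OF bounded_linear_star this]
  show ?thesis by (simp add: iota2_def case_prod_beta')
qed

text \<open>The differential of \<^const>\<open>iota2\<close> in coordinates; all its components are determined by the four
  derivatives of \<open>p\<close>, \<open>p\<^sub>0\<close>, \<open>q\<close>, \<open>q\<^sub>0\<close>.\<close>

lemma iota2_tangent: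
  assumes "integral_curve UNIV theta_hat1 J \<sigma>p" "integral_curve UNIV theta_hat2 J \<sigma>m" "z \<in> J \<times> J"
    and i: "iota2 \<sigma>p \<sigma>m z = (p, p0, q, q0, v, y)"
  obtains dp dp0 dq dq0 where "dp \<noteq> 0 \<or> dp0 \<noteq> 0" "dq \<noteq> 0 \<or> dq0 \<noteq> 0"
    and "\<And>s t. frechet_derivative (iota2 \<sigma>p \<sigma>m) (at z) (s, t) =
      (s * dp, s * dp0, t * dq, t * dq0, - (1/2 * p0^2 * (s * dp)) + 1/2 * q0^2 * (t * dq),
       vector [- (1/8 * p0^4 * (p^2 + 1) * (s * dp)) + 1/8 * q0^4 * (q^2 + 1) * (t * dq),
         - (1/8 * p0^4 * (p^2 - 1) * (s * dp)) + 1/8 * q0^4 * (q^2 - 1) * (t * dq),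
         1/4 * p * p0^4 * (s * dp) - 1/4 * q * q0^4 * (t * dq)])"
proof -
  obtain t1 t2 where z: "z = (t1, t2)" and t: "t1 \<in> J" "t2 \<in> J" using assms(3) by auto
  obtain vp yp vm ym where s: "\<sigma>p t1 = (p, p0, vp, yp)" "\<sigma>m t2 = (q, q0, vm, ym)"
    using i unfolding iota2_def z
    by (cases "\<sigma>p t1"; cases "\<sigma>m t2") (auto simp: star_def)
  obtain dp dp0 where d: "dp \<noteq> 0 \<or> dp0 \<noteq> 0"
    "(\<sigma>p has_vector_derivative (dp, dp0, - (1/2 * p0^2 * dp),
      vector [- (1/8 * p0^4 * (p^2 + 1) * dp), - (1/8 * p0^4 * (p^2 - 1) * dp), 1/4 * p * p0^4 * dp])) (at t1)"
    by (rule theta_hat1_tangent[OF assms(1) t(1) s(1)])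
  obtain dq dq0 where e: "dq \<noteq> 0 \<or> dq0 \<noteq> 0"
    "(\<sigma>m has_vector_derivative (dq, dq0, 1/2 * q0^2 * dq,
      vector [1/8 * q0^4 * (q^2 + 1) * dq, 1/8 * q0^4 * (q^2 - 1) * dq, - (1/4 * q * q0^4 * dq)])) (at t2)"
    by (rule theta_hat2_tangent[OF assms(2) t(2) s(2)])
  note D = has_derivative_iota2[of \<sigma>p _ z \<sigma>m, unfolded z fst_conv snd_conv, OF d(2) e(2)]
  show ?thesis
    by (rule that[OF d(1) e(1)])
      (simp add: z frechet_derivative_at[OF D, symmetric] star_def vec_eq_iff forall_3 mult.left_commute)
qed

lemma frechet_iota2_V2:
  assumes "integral_curve UNIV theta_hat1 J \<sigma>p" "integral_curve UNIV theta_hat2 J \<sigma>m" "z \<in> J \<times> J"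
  shows "\<forall>\<theta>\<in>V2. \<theta> (iota2 \<sigma>p \<sigma>m z) (frechet_derivative (iota2 \<sigma>p \<sigma>m) (at z) X) = 0"
proof -
  obtain p p0 q q0 v y where i: "iota2 \<sigma>p \<sigma>m z = (p, p0, q, q0, v, y)"
    by (cases "iota2 \<sigma>p \<sigma>m z") auto
  obtain s t where X: "X = (s, t)" by (cases X)
  show ?thesis
    by (rule iota2_tangent[OF assms i]) (simp only: X i V2_iff vector_3 simp_thms)
qed

lemma integral_surface_iota2:
  assumes J: "open J" and p: "integral_curve UNIV theta_hat1 J \<sigma>p" and m: "integral_curve UNIV theta_hat2 J \<sigma>m"
    and N: "iota2 \<sigma>p \<sigma>m ` (J \<times> J) \<subseteq> N_region"
  shows "integral_surface N_region V2 V2_two_forms (J \<times> J) (iota2 \<sigma>p \<sigma>m)"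
  unfolding integral_surface_def
proof (intro conjI ballI allI N)
  show "smooth_on (J \<times> J) (iota2 \<sigma>p \<sigma>m)"
    using smooth_on_iota2[OF J] p m by (simp add: integral_curve_def)
next
  fix z assume z: "z \<in> J \<times> J"
  obtain p' p0 q q0 v y where i: "iota2 \<sigma>p \<sigma>m z = (p', p0, q, q0, v, y)"
    by (cases "iota2 \<sigma>p \<sigma>m z") auto
  show "inj (frechet_derivative (iota2 \<sigma>p \<sigma>m) (at z))"
    by (rule iota2_tangent[OF p m z i]) (auto simp: inj_on_def)
next
  fix z \<theta> and X assume "z \<in> J \<times> J" "\<theta> \<in> V2"
  then show "\<theta> (iota2 \<sigma>p \<sigma>m z) (frechet_derivative (iota2 \<sigma>p \<sigma>m) (at z) X) = 0"
    using frechet_iota2_V2[OF p m] by blast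
next
  fix z \<omega> and X Y :: "real \<times> real" assume z: "z \<in> J \<times> J" and w: "\<omega> \<in> V2_two_forms"
  obtain p' p0 q q0 v y where i: "iota2 \<sigma>p \<sigma>m z = (p', p0, q, q0, v, y)"
    by (cases "iota2 \<sigma>p \<sigma>m z") auto
  obtain s t s' t' where XY: "X = (s, t)" "Y = (s', t')" by (cases X; cases Y)
  show "\<omega> (iota2 \<sigma>p \<sigma>m z) (frechet_derivative (iota2 \<sigma>p \<sigma>m) (at z) X)
      (frechet_derivative (iota2 \<sigma>p \<sigma>m) (at z) Y) = 0"
    by (rule iota2_tangent[OF p m z i])
      (use w in \<open>auto simp: V2_two_forms_def wedge_def form_dp_def form_dp0_def form_dq_def form_dq0_def XY\<close>)
qed

section \<open>The induced metric\<close>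

text \<open>The differential of \<^const>\<open>u_fun\<close>, and the differential of the position vector in Minkowski space
  as a function on \<open>N\<^sub>2\<close>, that is, of \<open>\<pi> \<circ> \<psi>\<^sup>-\<^sup>1\<close>.\<close>

definition du_form :: "pt8 \<Rightarrow> pt8 \<Rightarrow> real" where
  "du_form = (\<lambda>(p, p0, q, q0, v, x) (dp, dp0, dq, dq0, dv, dx).
     1/2 * ((dp0 * q0 + p0 * dq0) * (q - p) + p0 * q0 * (dq - dp)))"

definition dx_form :: "pt8 \<Rightarrow> pt8 \<Rightarrow> real^3" where
  "dx_form m X = proj_x X - dshear m X"

lemma has_derivative_u_fun: "(u_fun has_derivative du_form m) (at m)"
proof -
  define P A Q B :: "pt8 \<Rightarrow> real"
    where "P = fst" and "A m = fst (snd m)" and "Q m = fst (snd (snd m))" and "B m = fst (snd (snd (snd m)))" for m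
  note defs = this
  have P: "(P has_derivative P) (at m)" and A: "(A has_derivative A) (at m)"
    and Q: "(Q has_derivative Q) (at m)" and B: "(B has_derivative B) (at m)"
    unfolding defs[abs_def] by (intro has_derivative_fst has_derivative_snd has_derivative_ident)+
  have eq: "u_fun = (\<lambda>m. 1/2 * ((A m * B m) * (Q m - P m)))"
    by (simp add: u_fun_def defs case_prod_beta' fun_eq_iff)
  show ?thesis
    unfolding eq
    by (rule has_derivative_eq_rhs[OF has_derivative_mult[OF has_derivative_const
            has_derivative_mult[OF has_derivative_mult[OF A B] has_derivative_diff[OF Q P]]]])
      (simp add: du_form_def defs case_prod_beta' fun_eq_iff algebra_simps)
qed

lemma v_fun_eq: "v_fun = (\<lambda>m. fst (snd (snd (snd (snd m)))))"
  by (simp add: v_fun_def case_prod_beta')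

lemma bounded_linear_v_fun: "bounded_linear v_fun"
  unfolding v_fun_eq
  by (intro bounded_linear_fst_comp bounded_linear_snd_comp bounded_linear_ident)

lemma proj_x_eq: "proj_x = (\<lambda>m. snd (snd (snd (snd (snd m)))))"
  by (simp add: proj_x_def case_prod_beta')

lemma proj_x_psi_inv: "proj_x (psi_inv m) = proj_x m - shear m"
  by (simp add: proj_x_eq psi_inv_def)

lemma has_derivative_proj_x_psi_inv: "((\<lambda>m. proj_x (psi_inv m)) has_derivative dx_form m) (at m)"
  unfolding proj_x_psi_inv dx_form_def[abs_def] unfolding proj_x_eq
  by (intro has_derivative_diff has_derivative_snd has_derivative_ident has_derivative_shear)

text \<open>On the vectors annihilated by the Pfaffian system, the components of \<^const>\<open>dx_form\<close> in a null basis,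
  and the two components of the coframe \<open>(u dv, u du)\<close>, are linear in three quantities \<open>f\<close>, \<open>g\<close>, \<open>n\<close>.\<close>

lemma tangent_components:
  fixes p a q b :: real
  assumes V2: "\<forall>\<theta>\<in>V2. \<theta> (p, a, q, b, v, x) (P, A, Q, B, V, Z) = 0"
  defines "f \<equiv> a^2 * P" and "g \<equiv> b^2 * Q" and "n \<equiv> a * b * (A * b + a * B) * (p - q)"
  defines "W \<equiv> dx_form (p, a, q, b, v, x) (P, A, Q, B, V, Z)"
  shows "W $ 1 - W $ 2 = 1/4 * (2 * n - (a^2 - b^2) * (f + g))"
    and "W $ 1 + W $ 2 = 1/4 * (2 * n * p * q + f * (b^2 * (2 * p * q - q^2) - a^2 * p^2)
       + g * (b^2 * q^2 + a^2 * (p^2 - 2 * p * q)))"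
    and "W $ 3 = 1/4 * ((a^2 - b^2) * (p * f + q * g) - n * (p + q))"
    and "u_fun (p, a, q, b, v, x) * V = 1/4 * (p - q) * (a * b * (f - g))"
    and "u_fun (p, a, q, b, v, x) * du_form (p, a, q, b, v, x) (P, A, Q, B, V, Z) =
      1/4 * (p - q) * (n + b^2 * f - a^2 * g)"
proof -
  note eqs = V2[unfolded V2_iff]
  have W: "W $ i = Z $ i - dshear (p, a, q, b, v, x) (P, A, Q, B, V, Z) $ i" for i
    by (simp add: W_def dx_form_def proj_x_def)
  note Z = eqs[THEN conjunct2, THEN conjunct1] eqs[THEN conjunct2, THEN conjunct2, THEN conjunct1]
    eqs[THEN conjunct2, THEN conjunct2, THEN conjunct2]
  show "W $ 1 - W $ 2 = 1/4 * (2 * n - (a^2 - b^2) * (f + g))"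
    unfolding W Z dshear_def Let_def f_def g_def n_def
    by (simp add: field_simps power2_eq_square power4_eq_xxxx)
  show "W $ 1 + W $ 2 = 1/4 * (2 * n * p * q + f * (b^2 * (2 * p * q - q^2) - a^2 * p^2)
       + g * (b^2 * q^2 + a^2 * (p^2 - 2 * p * q)))"
    unfolding W Z dshear_def Let_def f_def g_def n_def
    by (simp add: field_simps power2_eq_square power4_eq_xxxx)
  show "W $ 3 = 1/4 * ((a^2 - b^2) * (p * f + q * g) - n * (p + q))"
    unfolding W Z dshear_def Let_def f_def g_def n_def
    by (simp add: field_simps power2_eq_square power4_eq_xxxx)
  show "u_fun (p, a, q, b, v, x) * V = 1/4 * (p - q) * (a * b * (f - g))"
    unfolding eqs[THEN conjunct1] f_def g_def u_fun_def
    by (simp add: field_simps power2_eq_square)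
  show "u_fun (p, a, q, b, v, x) * du_form (p, a, q, b, v, x) (P, A, Q, B, V, Z) =
      1/4 * (p - q) * (n + b^2 * f - a^2 * g)"
    unfolding f_def g_def n_def u_fun_def du_form_def
    by (simp add: field_simps power2_eq_square)
qed

lemma minkowski_null_basis:
  "4 * minkowski X Y = 2 * ((X$1 - X$2) * (Y$1 + Y$2) + (X$1 + X$2) * (Y$1 - Y$2)) - 4 * (X$3 * Y$3)"
  by (simp add: minkowski_def algebra_simps)

text \<open>The key identity: on the vectors annihilated by the Pfaffian system, the ambient metric pulls back
  to the metric of the surface.\<close>

lemma minkowski_dx:
  assumes X: "\<forall>\<theta>\<in>V2. \<theta> m X = 0" and Y: "\<forall>\<theta>\<in>V2. \<theta> m Y = 0"
  shows "minkowski (dx_form m X) (dx_form m Y) = (u_fun m)^2 * (v_fun X * v_fun Y - du_form m X * du_form m Y)"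
proof -
  obtain p a q b v x where m: "m = (p, a, q, b, v, x)" by (cases m) auto
  obtain P A Q B V Z where X': "X = (P, A, Q, B, V, Z)" by (cases X) auto
  obtain P' A' Q' B' V' Z' where Y': "Y = (P', A', Q', B', V', Z')" by (cases Y) auto
  note tX = tangent_components[OF X[unfolded m X']] and tY = tangent_components[OF Y[unfolded m Y']]
  define f where "f = a^2 * P"
  define g where "g = b^2 * Q"
  define n where "n = a * b * (A * b + a * B) * (p - q)"
  define f' where "f' = a^2 * P'"
  define g' where "g' = b^2 * Q'"
  define n' where "n' = a * b * (A' * b + a * B') * (p - q)"
  note tX = tX[folded f_def g_def n_def, folded m X'] and tY = tY[folded f'_def g'_def n'_def, folded m Y']
  have "4 * ((u_fun m)^2 * (v_fun X * v_fun Y - du_form m X * du_form m Y)) =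
      4 * ((u_fun m * V) * (u_fun m * V') - (u_fun m * du_form m X) * (u_fun m * du_form m Y))"
    by (simp add: X' Y' v_fun_def power2_eq_square algebra_simps)
  also have "\<dots> = 4 * minkowski (dx_form m X) (dx_form m Y)"
    unfolding minkowski_null_basis tX tY
    by (simp add: power2_eq_square field_simps)
  finally show ?thesis by simp
qed

section \<open>Local isometric embeddings\<close>

text \<open>A smooth map whose pulled-back metric is that of \<open>M\<close>, read in the local coordinates \<open>h\<close>, is locally
  an isometric embedding: nondegeneracy of the metric makes it an immersion, and an immersion is
  locally injective with continuous inverse.\<close>

lemma local_isometric_embedding_via_intro:
  fixes f :: "real \<times> real \<Rightarrow> real^3"
  assumes D: "open D" and h: "smooth_on D h" and f: "smooth_on D f"
    and inj: "\<And>z. z \<in> D \<Longrightarrow> inj (frechet_derivative h (at z))"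
    and M: "h ` D \<subseteq> M_dom"
    and metric: "\<And>z X Y. z \<in> D \<Longrightarrow>
      minkowski (frechet_derivative f (at z) X) (frechet_derivative f (at z) Y) =
      g0 (h z) (frechet_derivative h (at z) X) (frechet_derivative h (at z) Y)"
  shows "local_isometric_embedding_via D h f"
  unfolding local_isometric_embedding_via_def
proof
  let ?dh = "\<lambda>z. frechet_derivative h (at z)" and ?df = "\<lambda>z. frechet_derivative f (at z)"
  have hd: "(h has_derivative ?dh z) (at z)" and fd: "(f has_derivative ?df z) (at z)" if "z \<in> D" for z
    using smooth_on_has_derivative h f that by blast+
  have lin: "linear (?dh z)" "linear (?df z)" if "z \<in> D" for z
    using hd fd has_derivative_linear that by blast+
  have injf: "inj (?df z)" if z: "z \<in> D" for z
  proof (rule linear_injective_0[OF lin(2)[OF z], THEN iffD2], intro allI impI)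
    fix X assume X: "?df z X = 0"
    have surj: "surj (?dh z)"
      using linear_injective_imp_surjective[OF lin(1)[OF z] inj[OF z]] by simp
    obtain u v where uv: "h z = (u, v)" by (cases "h z")
    obtain c d where cd: "?dh z X = (c, d)" by (cases "?dh z X")
    have "u \<noteq> 0" using M z uv by (auto simp: M_dom_def)
    have "g0 (h z) (?dh z X) Y = 0" for Y
    proof -
      obtain Y' where "Y = ?dh z Y'" using surj by (metis surjD)
      then show ?thesis using metric[OF z, of X Y'] X by (simp add: minkowski_def)
    qed
    \<comment> \<open>The metric at a point with \<open>u \<noteq> 0\<close> is nondegenerate.\<close>
    from this[of "(1, 0)"] this[of "(0, 1)"] have "c = 0" "d = 0"
      using \<open>u \<noteq> 0\<close> by (auto simp: uv cd g0_def)
    then have "?dh z X = ?dh z 0" using cd linear_0[OF lin(1)[OF z]] by (simp add: zero_prod_def)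
    then show "X = 0" using inj[OF z] by (rule injD[rotated])
  qed
  fix z assume z: "z \<in> D"
  obtain W1 V1 G where 1: "open W1" "W1 \<subseteq> D" "z \<in> W1" "open V1" "homeomorphism W1 V1 h G" "smooth_on V1 G"
    by (rule smooth_local_inverse_plane[OF D h z inj[OF z]])
  obtain L where L: "linear L" "L \<circ> ?df z = id"
    using linear_injective_left_inverse[OF lin(2)[OF z] injf[OF z]] by blast
  then have bL: "bounded_linear L" by (simp add: linear_conv_bounded_linear)
  \<comment> \<open>\<open>L \<circ> f\<close> is a map of the plane with invertible differential at \<open>z\<close>; its local inverse yields a
    continuous left inverse of \<open>f\<close>.\<close>
  let ?k = "\<lambda>w. L (f w)"
  have k: "smooth_on D ?k" by (rule smooth_on_bounded_linear[OF D bL f])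
  have "(?k has_derivative (\<lambda>X. L (?df z X))) (at z)"
    by (rule bounded_linear.has_derivative[OF bL fd[OF z]])
  then have "frechet_derivative ?k (at z) = id"
    using L(2) frechet_derivative_at by (metis comp_def ext)
  then have "inj (frechet_derivative ?k (at z))" by simp
  then obtain W2 V2 K where 2: "open W2" "W2 \<subseteq> D" "z \<in> W2" "open V2" "homeomorphism W2 V2 ?k K"
    by (rule smooth_local_inverse_plane[OF D k z])
  define W where "W = W1 \<inter> W2"
  have W: "open W" "z \<in> W" "W \<subseteq> D" "W \<subseteq> W1" "W \<subseteq> W2" using 1 2 by (auto simp: W_def)
  have Gh: "G (h w) = w" if "w \<in> W" for w
    using 1(5) W(4) that by (auto simp: homeomorphism_def)
  have Kk: "K (?k w) = w" if "w \<in> W" for w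
    using 2(5) W(5) that by (auto simp: homeomorphism_def)
  have hW: "h ` W \<subseteq> V1" using 1(5) W(4) by (auto simp: homeomorphism_def)
  have ophW: "open (h ` W)"
  proof -
    have "openin (top_of_set V1) (h ` W)"
      using homeomorphism_imp_open_map[OF 1(5)] W(1,4) by (simp add: open_openin_trans openin_open_eq[OF 1(1)])
    then show ?thesis using 1(4) openin_open_trans by blast
  qed
  have smG: "smooth_on (h ` W) G" using smooth_on_subset[OF 1(6) hW] .
  let ?F = "f \<circ> G"
  have GW: "G ` (h ` W) \<subseteq> D" using Gh W(3) by auto
  have smF: "smooth_on (h ` W) ?F"
    unfolding o_def by (rule smooth_on_compose[OF ophW D smG f GW])
  have iso: "isometric_embedding (h ` W) ?F"
    unfolding isometric_embedding_def
  proof (intro conjI ophW smF ballI allI)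
    show "h ` W \<subseteq> M_dom" using M W(3) by blast
    show "\<exists>H. homeomorphism (h ` W) (?F ` (h ` W)) ?F H"
    proof (intro exI homeomorphismI)
      let ?H = "\<lambda>x. h (K (L x))"
      show "continuous_on (h ` W) ?F" by (rule smooth_on_imp_continuous_on[OF smF])
      have im: "?F ` (h ` W) = f ` W" using Gh by (force simp: image_image)
      show "continuous_on (?F ` (h ` W)) ?H"
      proof (rule continuous_on_compose2[of D h])
        show "continuous_on D h" by (rule smooth_on_imp_continuous_on[OF h])
        show "continuous_on (?F ` (h ` W)) (\<lambda>x. K (L x))"
        proof (rule continuous_on_compose2[of V2 K])
          show "continuous_on V2 K" using 2(5) by (simp add: homeomorphism_def)
          show "continuous_on (?F ` (h ` W)) L" using bL by (rule linear_continuous_on)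
          show "L ` ?F ` h ` W \<subseteq> V2" unfolding im using 2(5) W(5) by (auto simp: homeomorphism_def)
        qed
        show "(\<lambda>x. K (L x)) ` ?F ` h ` W \<subseteq> D" unfolding im using Kk W(3) by auto
      qed
      show "?F ` h ` W \<subseteq> ?F ` h ` W" by simp
      show "?H ` ?F ` h ` W \<subseteq> h ` W" unfolding im using Kk by auto
      show "?H (?F m) = m" if "m \<in> h ` W" for m using that Gh Kk by auto
      show "?F (?H x) = x" if "x \<in> ?F ` h ` W" for x using that unfolding im using Gh Kk by auto
    qed
    fix m assume "m \<in> h ` W"
    then obtain w where w: "w \<in> W" "m = h w" by blast
    then have wD: "w \<in> D" and mV: "m \<in> h ` W" and Gm: "G m = w" using W Gh by auto
    define dG where "dG = frechet_derivative G (at m)"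
    have dG: "(G has_derivative dG) (at m)"
      unfolding dG_def by (rule smooth_on_has_derivative[OF smG mV])
    have dF: "(?F has_derivative (\<lambda>X. ?df w (dG X))) (at m)"
      unfolding o_def using has_derivative_compose[OF dG, of f "?df w"] fd[OF wD] Gm by simp
    have "((\<lambda>m. h (G m)) has_derivative (\<lambda>X. ?dh w (dG X))) (at m)"
      using has_derivative_compose[OF dG, of h "?dh w"] hd[OF wD] Gm by simp
    moreover have "((\<lambda>m. h (G m)) has_derivative (\<lambda>X. X)) (at m)"
      by (rule has_derivative_transform_within_open[OF has_derivative_ident ophW mV]) (use Gh in auto)
    ultimately have id: "?dh w (dG X) = X" for X
      using has_derivative_unique by metis
    have injG: "inj dG" by (rule inj_on_inverseI) (rule id)
    note FD = frechet_derivative_at[OF dF, symmetric]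
    show "inj (frechet_derivative ?F (at m))"
      unfolding FD using inj_compose[OF injf[OF wD] injG] by (simp add: o_def)
    show "minkowski (frechet_derivative ?F (at m) X) (frechet_derivative ?F (at m) Y) = g0 m X Y" for X Y
      unfolding FD by (simp add: metric[OF wD] id w(2))
  qed
  show "\<exists>W G. open W \<and> z \<in> W \<and> W \<subseteq> D \<and> smooth_on W h \<and> smooth_on (h ` W) G \<and>
      (\<forall>w\<in>W. G (h w) = w) \<and> isometric_embedding (h ` W) (f \<circ> G)"
    using W(1-3) smooth_on_subset[OF h W(3)] smG Gh iso by blast
qed

lemma surface_map_eq:
  assumes "\<iota> z \<in> N_region"
  shows "surface_map \<iota> z = proj_x (psi_inv (\<iota> z))"
  using assms by (simp add: surface_map_def inv_into_psi)

lemma local_isometric_embedding_iota2: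
  assumes J: "open J" and p: "integral_curve UNIV theta_hat1 J \<sigma>p" and m: "integral_curve UNIV theta_hat2 J \<sigma>m"
    and N: "iota2 \<sigma>p \<sigma>m ` (J \<times> J) \<subseteq> N_region"
    and ind: "independence (J \<times> J) (iota2 \<sigma>p \<sigma>m)"
  shows "local_isometric_embedding_via (J \<times> J)
    (\<lambda>z. (u_fun (iota2 \<sigma>p \<sigma>m z), v_fun (iota2 \<sigma>p \<sigma>m z))) (surface_map (iota2 \<sigma>p \<sigma>m))"
proof -
  let ?i = "iota2 \<sigma>p \<sigma>m" and ?D = "J \<times> J"
  let ?h = "\<lambda>z. (u_fun (?i z), v_fun (?i z))"
  have D: "open ?D" using J by (simp add: open_Times)
  have sm: "smooth_on ?D ?i" using smooth_on_iota2[OF J] p m by (simp add: integral_curve_def)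
  have smu: "smooth_on UNIV u_fun"
    unfolding u_fun_def case_prod_beta' by (intro smooth_intros open_UNIV)
  have smx: "smooth_on UNIV (\<lambda>m. proj_x (psi_inv m))"
    unfolding proj_x_psi_inv by (subst proj_x_eq, intro smooth_intros smooth_on_shear open_UNIV)
  have smv: "smooth_on ?D (\<lambda>z. v_fun (?i z))"
    by (rule smooth_on_bounded_linear[OF D bounded_linear_v_fun sm])
  have h: "smooth_on ?D ?h"
    by (intro smooth_on_Pair D smv smooth_on_compose[OF D open_UNIV sm smu]) auto
  let ?di = "\<lambda>z. frechet_derivative ?i (at z)"
  have di: "(?i has_derivative ?di z) (at z)" if "z \<in> ?D" for z
    using smooth_on_has_derivative[OF sm that] .
  have eqf: "proj_x (psi_inv (?i z)) = surface_map ?i z" if "z \<in> ?D" for z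
    using surface_map_eq[of ?i z] N that by (metis image_subset_iff)
  have smf': "smooth_on ?D (\<lambda>z. proj_x (psi_inv (?i z)))"
    by (rule smooth_on_compose[OF D open_UNIV sm smx]) auto
  have f: "smooth_on ?D (surface_map ?i)"
    by (rule smooth_on_cong[OF smf' D eqf])
  have dh: "frechet_derivative ?h (at z) = (\<lambda>X. (du_form (?i z) (?di z X), v_fun (?di z X)))" if z: "z \<in> ?D" for z
    by (intro frechet_derivative_at[symmetric] has_derivative_Pair
        has_derivative_compose[OF di[OF z] has_derivative_u_fun]
        bounded_linear.has_derivative[OF bounded_linear_v_fun di[OF z]])
  have df: "frechet_derivative (surface_map ?i) (at z) = (\<lambda>X. dx_form (?i z) (?di z X))" if z: "z \<in> ?D" for z
  proof (rule frechet_derivative_at[symmetric])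
    show "(surface_map ?i has_derivative (\<lambda>X. dx_form (?i z) (?di z X))) (at z)"
      by (rule has_derivative_transform_within_open[OF
            has_derivative_compose[OF di[OF z] has_derivative_proj_x_psi_inv] D z eqf])
  qed
  show ?thesis
  proof (rule local_isometric_embedding_via_intro[OF D h f])
    fix z assume z: "z \<in> ?D"
    have lin: "linear (frechet_derivative ?h (at z))"
      using smooth_on_has_derivative[OF h z] has_derivative_linear by blast
    let ?L = "frechet_derivative ?h (at z)"
    obtain X Y where "wedge (ext_d u_fun) (ext_d v_fun) (?i z) (?di z X) (?di z Y) \<noteq> 0"
      using ind z unfolding independence_def by blast
    moreover have "ext_d u_fun m = du_form m" for m
      by (simp add: ext_d_def frechet_derivative_at[OF has_derivative_u_fun, symmetric])
    moreover have "ext_d v_fun m = v_fun" for m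
      by (simp add: ext_d_def frechet_derivative_at[OF bounded_linear_imp_has_derivative[OF bounded_linear_v_fun], symmetric])
    ultimately have nz: "fst (?L X) * snd (?L Y) - fst (?L Y) * snd (?L X) \<noteq> 0"
      by (simp add: wedge_def dh[OF z])
    show "inj ?L"
    proof (rule ccontr)
      assume "\<not> inj ?L"
      then have det: "fst (?L (1,0)) * snd (?L (0,1)) - fst (?L (0,1)) * snd (?L (1,0)) = 0"
        using inj_linear_plane_iff_det(1)[OF lin] by blast
      interpret L: linear ?L by (rule lin)
      have L: "?L Z = fst Z *\<^sub>R ?L (1,0) + snd Z *\<^sub>R ?L (0,1)" for Z
      proof -
        have "?L Z = ?L (fst Z *\<^sub>R (1,0) + snd Z *\<^sub>R (0,1))" by simp
        then show ?thesis by (simp only: L.add L.scaleR)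
      qed
      have "fst (?L X) * snd (?L Y) - fst (?L Y) * snd (?L X) =
          (fst X * snd Y - fst Y * snd X) *
          (fst (?L (1,0)) * snd (?L (0,1)) - fst (?L (0,1)) * snd (?L (1,0)))"
        unfolding L[of X] L[of Y] by (simp add: algebra_simps)
      with det nz show False by simp
    qed
    show "minkowski (frechet_derivative (surface_map ?i) (at z) X) (frechet_derivative (surface_map ?i) (at z) Y) =
        g0 (?h z) (?L X) (?L Y)" for X Y
      unfolding df[OF z] dh[OF z] minkowski_dx[OF frechet_iota2_V2[OF p m z] frechet_iota2_V2[OF p m z]]
      by (simp add: g0_def)
  next
    have "u_fun m \<noteq> 0" if "m \<in> N_region" for m
      using that by (auto simp: N_region_def u_fun_def)
    then have "u_fun (?i z) \<noteq> 0" if "z \<in> ?D" for z using N that by (metis image_subset_iff)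
    then show "?h ` ?D \<subseteq> M_dom" by (force simp: M_dom_def)
  qed
qed

section \<open>Functions obtained by quadratures\<close>

lemma algebraic_in_minus: "f \<in> algebraic_in S B \<Longrightarrow> (\<lambda>x. - f x) \<in> algebraic_in S B"
  using algebraic_in.diff[OF algebraic_in.const[of 0]] by simp

lemma algebraic_in_power: "f \<in> algebraic_in S B \<Longrightarrow> (\<lambda>x. f x ^ n) \<in> algebraic_in S B"
  by (induction n) (auto intro: algebraic_in.const algebraic_in.mult)

lemmas algebraic_in_intros = algebraic_in.const algebraic_in.add algebraic_in.diff algebraic_in.mult
  algebraic_in_minus algebraic_in_power

lemma quadrature_in_const: "(\<lambda>x. c) \<in> quadrature_in J B"
  by (rule quadrature_in.algebraic, rule algebraic_in.const)

lemma quadrature_in_add: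
  "f \<in> quadrature_in J B \<Longrightarrow> g \<in> quadrature_in J B \<Longrightarrow> (\<lambda>x. f x + g x) \<in> quadrature_in J B"
  by (rule quadrature_in.algebraic, rule algebraic_in.add; rule algebraic_in.base)

lemma quadrature_in_diff:
  "f \<in> quadrature_in J B \<Longrightarrow> g \<in> quadrature_in J B \<Longrightarrow> (\<lambda>x. f x - g x) \<in> quadrature_in J B"
  by (rule quadrature_in.algebraic, rule algebraic_in.diff; rule algebraic_in.base)

lemma quadrature_in_mult:
  "f \<in> quadrature_in J B \<Longrightarrow> g \<in> quadrature_in J B \<Longrightarrow> (\<lambda>x. f x * g x) \<in> quadrature_in J B"
  by (rule quadrature_in.algebraic, rule algebraic_in.mult; rule algebraic_in.base)

lemma quadrature_in_minus: "f \<in> quadrature_in J B \<Longrightarrow> (\<lambda>x. - f x) \<in> quadrature_in J B"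
  by (rule quadrature_in.algebraic, rule algebraic_in_minus, rule algebraic_in.base)

lemma quadrature_in_power: "f \<in> quadrature_in J B \<Longrightarrow> (\<lambda>x. f x ^ n) \<in> quadrature_in J B"
  by (rule quadrature_in.algebraic, rule algebraic_in_power, rule algebraic_in.base)

lemma quadrature_in_divide:
  "f \<in> quadrature_in J B \<Longrightarrow> g \<in> quadrature_in J B \<Longrightarrow> (\<And>x. x \<in> J \<Longrightarrow> g x \<noteq> 0) \<Longrightarrow>
    (\<lambda>x. f x / g x) \<in> quadrature_in J B"
  by (rule quadrature_in.algebraic, rule algebraic_in.divide) (rule algebraic_in.base | assumption)+

lemma quadrature_in_cong:
  assumes "f \<in> quadrature_in J B" "\<And>x. x \<in> J \<Longrightarrow> g x = f x"
  shows "g \<in> quadrature_in J B"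
  using algebraic_in.cong[OF algebraic_in.base[OF assms(1)] assms(2)] by (rule quadrature_in.algebraic)

lemmas quadrature_intros = quadrature_in_const quadrature_in_add quadrature_in_diff
  quadrature_in_mult quadrature_in_minus quadrature_in_power

lemma deriv_in_quadrature_in:
  assumes "f \<in> quadrature_in J B" "smooth_on J f"
  shows "deriv f \<in> quadrature_in J B"
  using quadrature_in.derivative[OF assms(1)] smooth_on_has_real_derivative[OF assms(2)] .

lemma inner_Basis_vec3:
  fixes x :: "'a \<Rightarrow> real^3"
  assumes "e \<in> Basis" "\<And>i. (\<lambda>t. x t $ i) \<in> A"
  shows "(\<lambda>t. x t \<bullet> e) \<in> A"
  using assms by (auto simp: Basis_vec_def inner_axis)

lemma inner_Basis_pt6:
  fixes \<sigma> :: "'a \<Rightarrow> pt6"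
  assumes "e \<in> Basis" "(\<lambda>t. fst (\<sigma> t)) \<in> A" "(\<lambda>t. fst (snd (\<sigma> t))) \<in> A"
    "(\<lambda>t. fst (snd (snd (\<sigma> t)))) \<in> A" "\<And>i. (\<lambda>t. snd (snd (snd (\<sigma> t))) $ i) \<in> A"
  shows "(\<lambda>t. \<sigma> t \<bullet> e) \<in> A"
  using assms by (auto simp: Basis_prod_def Basis_vec_def inner_axis inner_prod_def)

lemma inner_Basis_pt8:
  fixes \<sigma> :: "'a \<Rightarrow> pt8"
  assumes "e \<in> Basis" "(\<lambda>t. fst (\<sigma> t)) \<in> A" "(\<lambda>t. fst (snd (\<sigma> t))) \<in> A"
    "(\<lambda>t. fst (snd (snd (\<sigma> t)))) \<in> A" "(\<lambda>t. fst (snd (snd (snd (\<sigma> t))))) \<in> A"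
    "(\<lambda>t. fst (snd (snd (snd (snd (\<sigma> t)))))) \<in> A"
    "\<And>i. (\<lambda>t. snd (snd (snd (snd (snd (\<sigma> t))))) $ i) \<in> A"
  shows "(\<lambda>t. \<sigma> t \<bullet> e) \<in> A"
  using assms by (auto simp: Basis_prod_def Basis_vec_def inner_axis inner_prod_def)

text \<open>The remaining components of an integral curve of a singular system are antiderivatives of
  polynomials in the first two components and the derivative of the first one.\<close>

lemma theta_hat1_quadrature:
  assumes \<sigma>: "integral_curve UNIV theta_hat1 J \<sigma>" and J: "open J"
    and p: "(\<lambda>t. fst (\<sigma> t)) \<in> quadrature_in J B" and p0: "(\<lambda>t. fst (snd (\<sigma> t))) \<in> quadrature_in J B"
  shows "(\<lambda>t. fst (snd (snd (\<sigma> t)))) \<in> quadrature_in J B"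
    and "(\<lambda>t. snd (snd (snd (\<sigma> t))) $ i) \<in> quadrature_in J B"
proof -
  have sm: "smooth_on J \<sigma>" using \<sigma> by (simp add: integral_curve_def)
  define P where "P t = fst (\<sigma> t)" for t
  define A where "A t = fst (snd (\<sigma> t))" for t
  have PA: "P \<in> quadrature_in J B" "A \<in> quadrature_in J B" using p p0 by (simp_all add: P_def[abs_def] A_def[abs_def])
  have "smooth_on J P" unfolding P_def by (intro smooth_on_fst J sm)
  then have dP: "deriv P \<in> quadrature_in J B" by (rule deriv_in_quadrature_in[OF PA(1)])
  define F where "F t = (vector [- (1/8 * A t^4 * (P t^2 + 1) * deriv P t),
      - (1/8 * A t^4 * (P t^2 - 1) * deriv P t), 1/4 * P t * A t^4 * deriv P t] :: real^3)" for t
  have der: "((\<lambda>t. fst (snd (snd (\<sigma> t)))) has_real_derivative - (1/2 * A t^2 * deriv P t)) (at t)"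
    "((\<lambda>t. snd (snd (snd (\<sigma> t))) $ i) has_real_derivative F t $ i) (at t)" if t: "t \<in> J" for t i
  proof -
    obtain v y where s: "\<sigma> t = (P t, A t, v, y)" by (cases "\<sigma> t") (auto simp: P_def A_def)
    obtain dp dp0 where d: "(\<sigma> has_vector_derivative (dp, dp0, - (1/2 * A t^2 * dp),
        vector [- (1/8 * A t^4 * (P t^2 + 1) * dp), - (1/8 * A t^4 * (P t^2 - 1) * dp), 1/4 * P t * A t^4 * dp])) (at t)"
      by (rule theta_hat1_tangent[OF \<sigma> t s])
    have "(P has_vector_derivative dp) (at t)"
      using bounded_linear.has_vector_derivative[OF bounded_linear_fst d] by (simp add: P_def[abs_def])
    then have dp: "deriv P t = dp"
      by (simp add: DERIV_imp_deriv has_real_derivative_iff_has_vector_derivative)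
    show "((\<lambda>t. fst (snd (snd (\<sigma> t)))) has_real_derivative - (1/2 * A t^2 * deriv P t)) (at t)"
      using bounded_linear.has_vector_derivative[OF bounded_linear_fst_comp[OF
            bounded_linear_snd_comp[OF bounded_linear_snd]] d]
      by (simp add: dp has_real_derivative_iff_has_vector_derivative)
    show "((\<lambda>t. snd (snd (snd (\<sigma> t))) $ i) has_real_derivative F t $ i) (at t)"
      using bounded_linear.has_vector_derivative[OF bounded_linear_compose[OF bounded_linear_vec_nth
            bounded_linear_snd_comp[OF bounded_linear_snd_comp[OF bounded_linear_snd]]] d]
      by (simp add: dp F_def has_real_derivative_iff_has_vector_derivative)
  qed
  show "(\<lambda>t. fst (snd (snd (\<sigma> t)))) \<in> quadrature_in J B"
    by (rule quadrature_in.antiderivative[OF _ der(1)]) (intro quadrature_intros PA dP)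
  have "\<forall>i. (\<lambda>t. F t $ i) \<in> quadrature_in J B"
    unfolding F_def forall_3 vector_3 by (intro conjI quadrature_intros PA dP)
  then show "(\<lambda>t. snd (snd (snd (\<sigma> t))) $ i) \<in> quadrature_in J B"
    using quadrature_in.antiderivative[OF _ der(2)] by blast
qed

lemma theta_hat2_quadrature:
  assumes \<sigma>: "integral_curve UNIV theta_hat2 J \<sigma>" and J: "open J"
    and q: "(\<lambda>t. fst (\<sigma> t)) \<in> quadrature_in J B" and q0: "(\<lambda>t. fst (snd (\<sigma> t))) \<in> quadrature_in J B"
  shows "(\<lambda>t. fst (snd (snd (\<sigma> t)))) \<in> quadrature_in J B"
    and "(\<lambda>t. snd (snd (snd (\<sigma> t))) $ i) \<in> quadrature_in J B"
proof -
  have sm: "smooth_on J \<sigma>" using \<sigma> by (simp add: integral_curve_def)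
  define P where "P t = fst (\<sigma> t)" for t
  define A where "A t = fst (snd (\<sigma> t))" for t
  have PA: "P \<in> quadrature_in J B" "A \<in> quadrature_in J B" using q q0 by (simp_all add: P_def[abs_def] A_def[abs_def])
  have "smooth_on J P" unfolding P_def by (intro smooth_on_fst J sm)
  then have dP: "deriv P \<in> quadrature_in J B" by (rule deriv_in_quadrature_in[OF PA(1)])
  define F where "F t = (vector [1/8 * A t^4 * (P t^2 + 1) * deriv P t,
      1/8 * A t^4 * (P t^2 - 1) * deriv P t, - (1/4 * P t * A t^4 * deriv P t)] :: real^3)" for t
  have der: "((\<lambda>t. fst (snd (snd (\<sigma> t)))) has_real_derivative 1/2 * A t^2 * deriv P t) (at t)"
    "((\<lambda>t. snd (snd (snd (\<sigma> t))) $ i) has_real_derivative F t $ i) (at t)" if t: "t \<in> J" for t i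
  proof -
    obtain v y where s: "\<sigma> t = (P t, A t, v, y)" by (cases "\<sigma> t") (auto simp: P_def A_def)
    obtain dq dq0 where d: "(\<sigma> has_vector_derivative (dq, dq0, 1/2 * A t^2 * dq,
        vector [1/8 * A t^4 * (P t^2 + 1) * dq, 1/8 * A t^4 * (P t^2 - 1) * dq, - (1/4 * P t * A t^4 * dq)])) (at t)"
      by (rule theta_hat2_tangent[OF \<sigma> t s])
    have "(P has_vector_derivative dq) (at t)"
      using bounded_linear.has_vector_derivative[OF bounded_linear_fst d] by (simp add: P_def[abs_def])
    then have dp: "deriv P t = dq"
      by (simp add: DERIV_imp_deriv has_real_derivative_iff_has_vector_derivative)
    show "((\<lambda>t. fst (snd (snd (\<sigma> t)))) has_real_derivative 1/2 * A t^2 * deriv P t) (at t)"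
      using bounded_linear.has_vector_derivative[OF bounded_linear_fst_comp[OF
            bounded_linear_snd_comp[OF bounded_linear_snd]] d]
      by (simp add: dp has_real_derivative_iff_has_vector_derivative)
    show "((\<lambda>t. snd (snd (snd (\<sigma> t))) $ i) has_real_derivative F t $ i) (at t)"
      using bounded_linear.has_vector_derivative[OF bounded_linear_compose[OF bounded_linear_vec_nth
            bounded_linear_snd_comp[OF bounded_linear_snd_comp[OF bounded_linear_snd]]] d]
      by (simp add: dp F_def has_real_derivative_iff_has_vector_derivative)
  qed
  show "(\<lambda>t. fst (snd (snd (\<sigma> t)))) \<in> quadrature_in J B"
    by (rule quadrature_in.antiderivative[OF _ der(1)]) (intro quadrature_intros PA dP)
  have "\<forall>i. (\<lambda>t. F t $ i) \<in> quadrature_in J B"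
    unfolding F_def forall_3 vector_3 by (intro conjI quadrature_intros PA dP)
  then show "(\<lambda>t. snd (snd (snd (\<sigma> t))) $ i) \<in> quadrature_in J B"
    using quadrature_in.antiderivative[OF _ der(2)] by blast
qed

section \<open>The Cauchy problem for the given curve\<close>

lemma decomposition_components:
  assumes "decomposition J (psi \<circ> sigma0 \<gamma> p p0 q q0 v) \<sigma>p \<sigma>m" "t \<in> J"
  shows "fst (\<sigma>p t) = p t" "fst (snd (\<sigma>p t)) = p0 t" "fst (\<sigma>m t) = q t" "fst (snd (\<sigma>m t)) = q0 t"
proof -
  have "star (\<sigma>p t) (\<sigma>m t) = psi (sigma0 \<gamma> p p0 q q0 v t)"
    using assms unfolding decomposition_def by simp
  then show "fst (\<sigma>p t) = p t" "fst (snd (\<sigma>p t)) = p0 t" "fst (\<sigma>m t) = q t" "fst (snd (\<sigma>m t)) = q0 t"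
    by (auto simp: psi_sigma0 star_def case_prod_beta')
qed

lemma iota2_components:
  "fst (iota2 \<sigma>p \<sigma>m z) = fst (\<sigma>p (fst z))" "fst (snd (iota2 \<sigma>p \<sigma>m z)) = fst (snd (\<sigma>p (fst z)))"
  "fst (snd (snd (iota2 \<sigma>p \<sigma>m z))) = fst (\<sigma>m (snd z))"
  "fst (snd (snd (snd (iota2 \<sigma>p \<sigma>m z)))) = fst (snd (\<sigma>m (snd z)))"
  "fst (snd (snd (snd (snd (iota2 \<sigma>p \<sigma>m z))))) = fst (snd (snd (\<sigma>p (fst z)))) + fst (snd (snd (\<sigma>m (snd z))))"
  "snd (snd (snd (snd (snd (iota2 \<sigma>p \<sigma>m z))))) = snd (snd (snd (\<sigma>p (fst z)))) + snd (snd (snd (\<sigma>m (snd z))))"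
  by (simp_all add: iota2_def star_def case_prod_beta')

lemma iota2_in_N_region:
  assumes J: "open J" and "initial_data \<gamma> J p p0 q q0 v"
    and sep: "\<forall>t1\<in>J. \<forall>t2\<in>J. p t1 \<noteq> q t2"
    and dec: "decomposition J (psi \<circ> sigma0 \<gamma> p p0 q q0 v) \<sigma>p \<sigma>m"
  shows "iota2 \<sigma>p \<sigma>m ` (J \<times> J) \<subseteq> N_region"
proof
  fix m assume "m \<in> iota2 \<sigma>p \<sigma>m ` (J \<times> J)"
  then obtain t1 t2 where t: "t1 \<in> J" "t2 \<in> J" and m: "m = iota2 \<sigma>p \<sigma>m (t1, t2)" by auto
  have nz: "p0 t \<noteq> 0 \<and> q0 t \<noteq> 0" if "t \<in> J" for t
    using assms(2) that unfolding initial_data_iff[OF J] by auto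
  have "fst m = p t1" "fst (snd m) = p0 t1" "fst (snd (snd m)) = q t2" "fst (snd (snd (snd m))) = q0 t2"
    using decomposition_components[OF dec] t by (simp_all add: m iota2_components)
  then show "m \<in> N_region"
    using t sep nz by (cases m) (auto simp: N_region_def)
qed

lemma surface_map_diagonal:
  assumes dec: "decomposition J (psi \<circ> sigma0 \<gamma> p p0 q q0 v) \<sigma>p \<sigma>m" and t: "t \<in> J"
    and N: "iota2 \<sigma>p \<sigma>m (t, t) \<in> N_region"
  shows "surface_map (iota2 \<sigma>p \<sigma>m) (t, t) = \<gamma> t"
proof -
  have "iota2 \<sigma>p \<sigma>m (t, t) = psi (sigma0 \<gamma> p p0 q q0 v t)"
    using dec t unfolding decomposition_def by (simp add: iota2_def)
  then show ?thesis
    using surface_map_eq[of "iota2 \<sigma>p \<sigma>m", OF N] by (simp add: psi_inv_psi sigma0_def proj_x_def)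
qed

lemma shear_components_algebraic:
  assumes "(\<lambda>z. fst (\<iota> z)) \<in> algebraic_in S B" "(\<lambda>z. fst (snd (\<iota> z))) \<in> algebraic_in S B"
    "(\<lambda>z. fst (snd (snd (\<iota> z)))) \<in> algebraic_in S B" "(\<lambda>z. fst (snd (snd (snd (\<iota> z))))) \<in> algebraic_in S B"
  shows "(\<lambda>z. shear (\<iota> z) $ i) \<in> algebraic_in S B"
proof -
  have "\<forall>i. (\<lambda>z. shear (\<iota> z) $ i) \<in> algebraic_in S B"
    unfolding shear_def case_prod_beta' forall_3 vector_3
    by (intro conjI algebraic_in_intros assms)
  then show ?thesis by blast
qed

lemma by_quadratures_of_decomposition:
  assumes J: "open J" and id: "initial_data \<gamma> J p p0 q q0 v"
    and sep: "\<forall>t1\<in>J. \<forall>t2\<in>J. p t1 \<noteq> q t2"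
    and Q: "{p, p0, q, q0} \<subseteq> by_quadratures \<gamma> J"
    and dec: "decomposition J (psi \<circ> sigma0 \<gamma> p p0 q q0 v) \<sigma>p \<sigma>m"
  shows "\<forall>e\<in>Basis. (\<lambda>t. \<sigma>p t \<bullet> e) \<in> by_quadratures \<gamma> J"
    and "\<forall>e\<in>Basis. (\<lambda>t. \<sigma>m t \<bullet> e) \<in> by_quadratures \<gamma> J"
    and "\<forall>e\<in>Basis. (\<lambda>z. iota2 \<sigma>p \<sigma>m z \<bullet> e) \<in> by_quadratures2 \<gamma> J"
    and "\<forall>e\<in>Basis. (\<lambda>z. surface_map (iota2 \<sigma>p \<sigma>m) z \<bullet> e) \<in> by_quadratures2 \<gamma> J"
proof -
  let ?Q = "by_quadratures \<gamma> J" and ?A = "by_quadratures2 \<gamma> J"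
  have ic: "integral_curve UNIV theta_hat1 J \<sigma>p" "integral_curve UNIV theta_hat2 J \<sigma>m"
    using dec unfolding decomposition_def by auto
  note comp = decomposition_components[OF dec]
  have q12: "(\<lambda>t. fst (\<sigma>p t)) \<in> ?Q" "(\<lambda>t. fst (snd (\<sigma>p t))) \<in> ?Q"
    "(\<lambda>t. fst (\<sigma>m t)) \<in> ?Q" "(\<lambda>t. fst (snd (\<sigma>m t))) \<in> ?Q"
    using Q comp unfolding by_quadratures_def by (auto intro: quadrature_in_cong)
  note qp = theta_hat1_quadrature[OF ic(1) J q12(1,2)[unfolded by_quadratures_def], folded by_quadratures_def]
  note qm = theta_hat2_quadrature[OF ic(2) J q12(3,4)[unfolded by_quadratures_def], folded by_quadratures_def]
  show "\<forall>e\<in>Basis. (\<lambda>t. \<sigma>p t \<bullet> e) \<in> ?Q" using inner_Basis_pt6 q12 qp by blast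
  show "\<forall>e\<in>Basis. (\<lambda>t. \<sigma>m t \<bullet> e) \<in> ?Q" using inner_Basis_pt6 q12 qm by blast
  have f: "(\<lambda>z. g (fst z)) \<in> ?A" and s: "(\<lambda>z. g (snd z)) \<in> ?A" if "g \<in> ?Q" for g
    unfolding by_quadratures2_def using that by (auto intro!: algebraic_in.base simp: o_def)
  note add = algebraic_in.add[where S = "J \<times> J", of _ "{g \<circ> fst |g. g \<in> ?Q} \<union> {g \<circ> snd |g. g \<in> ?Q}",
      folded by_quadratures2_def]
  have i: "(\<lambda>z. fst (iota2 \<sigma>p \<sigma>m z)) \<in> ?A" "(\<lambda>z. fst (snd (iota2 \<sigma>p \<sigma>m z))) \<in> ?A"
    "(\<lambda>z. fst (snd (snd (iota2 \<sigma>p \<sigma>m z)))) \<in> ?A" "(\<lambda>z. fst (snd (snd (snd (iota2 \<sigma>p \<sigma>m z))))) \<in> ?A"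
    "(\<lambda>z. fst (snd (snd (snd (snd (iota2 \<sigma>p \<sigma>m z)))))) \<in> ?A"
    "(\<lambda>z. snd (snd (snd (snd (snd (iota2 \<sigma>p \<sigma>m z))))) $ i) \<in> ?A" for i
    unfolding iota2_components vector_add_component
    by (intro f[OF q12(1)] f[OF q12(2)] s[OF q12(3)] s[OF q12(4)]
        add[OF f[OF qp(1)] s[OF qm(1)]] add[OF f[OF qp(2)] s[OF qm(2)]])+
  show "\<forall>e\<in>Basis. (\<lambda>z. iota2 \<sigma>p \<sigma>m z \<bullet> e) \<in> ?A" using inner_Basis_pt8 i by blast
  have "(\<lambda>z. surface_map (iota2 \<sigma>p \<sigma>m) z $ i) \<in> ?A" for i
    unfolding by_quadratures2_def
  proof (rule algebraic_in.cong)
    show "(\<lambda>z. snd (snd (snd (snd (snd (iota2 \<sigma>p \<sigma>m z))))) $ i - shear (iota2 \<sigma>p \<sigma>m z) $ i)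
        \<in> algebraic_in (J \<times> J) ({g \<circ> fst |g. g \<in> ?Q} \<union> {g \<circ> snd |g. g \<in> ?Q})"
      using i[unfolded by_quadratures2_def] by (intro algebraic_in.diff shear_components_algebraic)
    show "surface_map (iota2 \<sigma>p \<sigma>m) z $ i =
        snd (snd (snd (snd (snd (iota2 \<sigma>p \<sigma>m z))))) $ i - shear (iota2 \<sigma>p \<sigma>m z) $ i"
      if "z \<in> J \<times> J" for z
    proof -
      have "iota2 \<sigma>p \<sigma>m z \<in> N_region" using iota2_in_N_region[OF J id sep dec] that by blast
      from surface_map_eq[of "iota2 \<sigma>p \<sigma>m" z, OF this] show ?thesis by (simp add: proj_x_psi_inv) (simp add: proj_x_eq)
    qed
  qed
  then show "\<forall>e\<in>Basis. (\<lambda>z. surface_map (iota2 \<sigma>p \<sigma>m) z \<bullet> e) \<in> ?A"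
    using inner_Basis_vec3 by blast
qed

text \<open>Under the additional relation, \<open>r = t\<close> and \<open>w = D / t\<^sup>3\<close> solve the two scalar equations.  The relation
  itself keeps the interval away from \<open>t = 0\<close>, where it would force \<open>D = 0\<close>.\<close>

lemma initial_data_by_quadratures:
  fixes \<gamma> :: "real \<Rightarrow> real^3"
  assumes \<gamma>: "smooth_on {a<..<b} \<gamma>" and t0: "t0 \<in> {a<..<b}"
    and D: "\<And>t. t \<in> {a<..<b} \<Longrightarrow> deriv (coord \<gamma> 1) t - deriv (coord \<gamma> 2) t \<noteq> 0"
    and rel: "\<And>t. t \<in> {a<..<b} \<Longrightarrow>
      - 4 * ((deriv (coord \<gamma> 1) t)^2 - (deriv (coord \<gamma> 2) t)^2 - (deriv (coord \<gamma> 3) t)^2) * t^6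
      + 2 * (deriv (coord \<gamma> 1) t - deriv (coord \<gamma> 2) t)^4
      - (deriv (coord \<gamma> 1) t - deriv (coord \<gamma> 2) t)^3 *
        (deriv (deriv (coord \<gamma> 1)) t - deriv (deriv (coord \<gamma> 2)) t) * t = 0"
  obtains \<alpha> \<beta> p r q v where "t0 \<in> {\<alpha><..<\<beta>}" "{\<alpha><..<\<beta>} \<subseteq> {a<..<b}"
    and "initial_data \<gamma> {\<alpha><..<\<beta>} p r q r v"
    and "\<And>t1 t2. t1 \<in> {\<alpha><..<\<beta>} \<Longrightarrow> t2 \<in> {\<alpha><..<\<beta>} \<Longrightarrow> p t1 \<noteq> q t2"
    and "{p, r, q, v} \<subseteq> by_quadratures \<gamma> {\<alpha><..<\<beta>}"
proof -
  define D where "D t = deriv (coord \<gamma> 1) t - deriv (coord \<gamma> 2) t" for t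
  define S where "S t = deriv (coord \<gamma> 1) t + deriv (coord \<gamma> 2) t" for t
  define T where "T t = deriv (coord \<gamma> 3) t" for t
  let ?I = "{a<..<b}"
  have D0: "D t \<noteq> 0" if "t \<in> ?I" for t using D[OF that] by (simp add: D_def)
  have coord: "smooth_on ?I (coord \<gamma> i)" for i
    unfolding coord_def by (intro smooth_intros \<gamma> open_greaterThanLessThan)
  have coord': "smooth_on ?I (deriv (coord \<gamma> i))" for i
    by (intro smooth_on_deriv coord open_greaterThanLessThan)
  have smD: "smooth_on ?I D"
    unfolding D_def by (intro smooth_intros coord' open_greaterThanLessThan)
  have D': "(D has_real_derivative deriv D t) (at t)"
    "deriv D t = deriv (deriv (coord \<gamma> 1)) t - deriv (deriv (coord \<gamma> 2)) t" if "t \<in> ?I" for t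
  proof -
    show "(D has_real_derivative deriv D t) (at t)" by (rule smooth_on_has_real_derivative[OF smD that])
    show "deriv D t = deriv (deriv (coord \<gamma> 1)) t - deriv (deriv (coord \<gamma> 2)) t"
      unfolding D_def by (intro DERIV_imp_deriv DERIV_diff smooth_on_has_real_derivative[OF coord' that])
  qed
  have rel': "4 * ((T t)^2 - S t * D t) * t^6 = (D t)^3 * deriv D t * t - 2 * (D t)^4" if "t \<in> ?I" for t
    using rel[OF that] unfolding D'(2)[OF that] D_def[symmetric]
    by (simp add: D_def S_def T_def power2_eq_square algebra_simps)
  have t_nz: "t \<noteq> 0" if "t \<in> ?I" for t
    using rel'[OF that] D0[OF that] by auto
  define r :: "real \<Rightarrow> real" where "r t = t" for t
  define w where "w t = D t / t^3" for t
  define p where "p t = (- (2 * T t / D t) + w t) / 2" for t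
  define q where "q t = (- (2 * T t / D t) - w t) / 2" for t
  have smr: "smooth_on ?I r" unfolding r_def by (intro smooth_intros open_greaterThanLessThan)
  have smw: "smooth_on ?I w" unfolding w_def
    using t_nz by (intro smooth_on_divide smooth_intros smD open_greaterThanLessThan) auto
  have r': "deriv r t = 1" for t
    unfolding r_def by simp
  obtain \<alpha> \<beta> v where J: "t0 \<in> {\<alpha><..<\<beta>}" "{\<alpha><..<\<beta>} \<subseteq> ?I"
    and id: "initial_data \<gamma> {\<alpha><..<\<beta>} p r q r v"
    and sep: "\<And>t1 t2. t1 \<in> {\<alpha><..<\<beta>} \<Longrightarrow> t2 \<in> {\<alpha><..<\<beta>} \<Longrightarrow> p t1 \<noteq> q t2"
    and v: "\<And>t. t \<in> {\<alpha><..<\<beta>} \<Longrightarrow> (v has_real_derivative - (1/2 * (r t)^2 * deriv w t)) (at t)"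
  proof (rule initial_data_from_ode_solution[of t0 a b \<gamma> r w p q])
    fix t assume t: "t \<in> ?I"
    note nz = t_nz[OF t] D0[OF t]
    have "(w has_real_derivative deriv D t / t^3 - 3 * D t / t^4) (at t)"
      unfolding w_def[abs_def] using nz
      by (auto intro!: derivative_eq_intros D'(1) t simp: power2_eq_square power3_eq_cube power4_eq_xxxx field_simps)
    then have w': "deriv w t = deriv D t / t^3 - 3 * D t / t^4" by (rule DERIV_imp_deriv)
    show "(r t)^3 * deriv r t * w t = deriv (coord \<gamma> 1) t - deriv (coord \<gamma> 2) t"
      using nz by (simp add: r' r_def w_def D_def)
    have "((D t)^2 * (w t)^2 + D t * (r t)^4 * (w t)^2 * deriv w t) * t^6 =
        (D t)^3 * deriv D t * t - 2 * (D t)^4"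
      unfolding w' r_def w_def using nz by (simp add: field_simps) (simp add: eval_nat_numeral algebra_simps)
    then have "(D t)^2 * (w t)^2 + D t * (r t)^4 * (w t)^2 * deriv w t = 4 * ((T t)^2 - S t * D t)"
      using rel'[OF t] nz by (metis mult_right_cancel power_not_zero)
    then show "(deriv (coord \<gamma> 1) t - deriv (coord \<gamma> 2) t)^2 * (w t)^2 +
        (deriv (coord \<gamma> 1) t - deriv (coord \<gamma> 2) t) * (r t)^4 * (w t)^2 * deriv w t =
        4 * ((deriv (coord \<gamma> 3) t)^2 - (deriv (coord \<gamma> 1) t + deriv (coord \<gamma> 2) t) *
          (deriv (coord \<gamma> 1) t - deriv (coord \<gamma> 2) t))"
      by (simp add: D_def S_def T_def)
  qed (use t0 \<gamma> D smr smw in \<open>auto simp: p_def q_def T_def D_def\<close>)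
  let ?J = "{\<alpha><..<\<beta>}"
  let ?Q = "by_quadratures \<gamma> ?J"
  note Q = by_quadratures_def
  have base: "(\<lambda>t. t) \<in> ?Q" "coord \<gamma> 1 \<in> ?Q" "coord \<gamma> 2 \<in> ?Q" "coord \<gamma> 3 \<in> ?Q"
    unfolding Q by (intro quadrature_in.base; simp)+
  have smJ: "smooth_on ?J (coord \<gamma> i)" for i using coord smooth_on_subset J(2) by blast
  have dc: "deriv (coord \<gamma> 1) \<in> ?Q" "deriv (coord \<gamma> 2) \<in> ?Q" "deriv (coord \<gamma> 3) \<in> ?Q"
    using base(2-4) unfolding Q by (auto intro: deriv_in_quadrature_in smJ)
  have rQ: "r \<in> ?Q" using base(1) by (simp add: r_def[abs_def])
  have DQ: "D \<in> ?Q" using dc(1,2) unfolding Q D_def[abs_def] by (rule quadrature_in_diff)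
  have nzJ: "t \<noteq> 0 \<and> D t \<noteq> 0" if "t \<in> ?J" for t
    using subsetD[OF J(2) that] t_nz D0 by blast
  have wQ: "w \<in> ?Q"
    using DQ base(1) nzJ unfolding Q w_def[abs_def]
    by (intro quadrature_in_divide quadrature_in_power) auto
  have sQ: "(\<lambda>t. 2 * T t / D t) \<in> ?Q"
    using dc(3) DQ nzJ unfolding Q T_def
    by (intro quadrature_in_divide quadrature_in_mult quadrature_in_const) auto
  have pq: "p \<in> ?Q" "q \<in> ?Q"
    using quadrature_in_divide[OF quadrature_in_add[OF quadrature_in_minus[OF sQ[unfolded Q]] wQ[unfolded Q]]
        quadrature_in_const[of 2]]
      quadrature_in_divide[OF quadrature_in_diff[OF quadrature_in_minus[OF sQ[unfolded Q]] wQ[unfolded Q]]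
        quadrature_in_const[of 2]]
    unfolding Q p_def[abs_def] q_def[abs_def] by simp_all
  have "deriv w \<in> ?Q"
    using wQ smooth_on_subset[OF smw J(2)] unfolding Q by (rule deriv_in_quadrature_in)
  then have "(\<lambda>t. - (1/2 * (r t)^2 * deriv w t)) \<in> ?Q"
    using rQ unfolding Q by (intro quadrature_intros)
  then have "v \<in> ?Q"
    using quadrature_in.antiderivative[OF _ v] unfolding Q by blast
  then show ?thesis using that[OF J id sep] pq rQ by blast
qed

theorem theorem15:
  fixes \<gamma> :: "real \<Rightarrow> real^3" and a b t0 :: real
  assumes smooth: "smooth_on {a<..<b} \<gamma>"
    and immersed: "\<forall>t\<in>{a<..<b}. vector_derivative \<gamma> (at t) \<noteq> 0"
    and x12: "\<forall>t\<in>{a<..<b}. deriv (coord \<gamma> 1) t - deriv (coord \<gamma> 2) t \<noteq> 0"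
    and x3: "\<forall>t\<in>{a<..<b}. deriv (coord \<gamma> 3) t \<noteq> 0"
    and t0: "t0 \<in> {a<..<b}"
  shows
    "(\<exists>\<alpha> \<beta> p p0 q q0 v.
        t0 \<in> {\<alpha><..<\<beta>} \<and> {\<alpha><..<\<beta>} \<subseteq> {a<..<b} \<and>
        initial_data \<gamma> {\<alpha><..<\<beta>} p p0 q q0 v \<and>
        (\<forall>t1\<in>{\<alpha><..<\<beta>}. \<forall>t2\<in>{\<alpha><..<\<beta>}. p t1 \<noteq> q t2))
     \<and>
     (\<forall>\<alpha> \<beta> p p0 q q0 v. let J = {\<alpha><..<\<beta>}; \<sigma> = psi \<circ> sigma0 \<gamma> p p0 q q0 v in
        t0 \<in> J \<longrightarrow> J \<subseteq> {a<..<b} \<longrightarrow> initial_data \<gamma> J p p0 q q0 v \<longrightarrow>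
        (\<exists>\<sigma>p \<sigma>m. decomposition J \<sigma> \<sigma>p \<sigma>m) \<and>
        (\<forall>\<sigma>p \<sigma>m \<tau>p \<tau>m. decomposition J \<sigma> \<sigma>p \<sigma>m \<longrightarrow> decomposition J \<sigma> \<tau>p \<tau>m \<longrightarrow>
           (\<exists>cv cy. \<forall>t\<in>J. \<tau>p t = \<sigma>p t + (0, 0, cv, cy) \<and> \<tau>m t = \<sigma>m t - (0, 0, cv, cy)) \<and>
           (\<forall>z\<in>J \<times> J. iota2 \<tau>p \<tau>m z = iota2 \<sigma>p \<sigma>m z)) \<and>
        ((\<forall>t1\<in>J. \<forall>t2\<in>J. p t1 \<noteq> q t2) \<longrightarrow>
           (\<forall>\<sigma>p \<sigma>m. decomposition J \<sigma> \<sigma>p \<sigma>m \<longrightarrow>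
              integral_surface N_region V2 V2_two_forms (J \<times> J) (iota2 \<sigma>p \<sigma>m) \<and>
              (independence (J \<times> J) (iota2 \<sigma>p \<sigma>m) \<longrightarrow>
                 local_isometric_embedding_via (J \<times> J)
                   (\<lambda>z. (u_fun (iota2 \<sigma>p \<sigma>m z), v_fun (iota2 \<sigma>p \<sigma>m z)))
                   (surface_map (iota2 \<sigma>p \<sigma>m)) \<and>
                 \<gamma> ` J \<subseteq> surface_map (iota2 \<sigma>p \<sigma>m) ` (J \<times> J)))))
     \<and>
     ((\<forall>t\<in>{a<..<b}.
          - 4 * ((deriv (coord \<gamma> 1) t)^2 - (deriv (coord \<gamma> 2) t)^2 - (deriv (coord \<gamma> 3) t)^2) * t^6
          + 2 * (deriv (coord \<gamma> 1) t - deriv (coord \<gamma> 2) t)^4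
          - (deriv (coord \<gamma> 1) t - deriv (coord \<gamma> 2) t)^3 * (deriv (deriv (coord \<gamma> 1)) t - deriv (deriv (coord \<gamma> 2)) t) * t = 0)
      \<longrightarrow>
      (\<exists>\<alpha> \<beta> p p0 q q0 v. let J = {\<alpha><..<\<beta>}; \<sigma> = psi \<circ> sigma0 \<gamma> p p0 q q0 v in
         t0 \<in> J \<and> J \<subseteq> {a<..<b} \<and> initial_data \<gamma> J p p0 q q0 v \<and>
         (\<forall>t1\<in>J. \<forall>t2\<in>J. p t1 \<noteq> q t2) \<and>
         {p, p0, q, q0, v} \<subseteq> by_quadratures \<gamma> J \<and>
         (\<forall>\<sigma>p \<sigma>m. decomposition J \<sigma> \<sigma>p \<sigma>m \<longrightarrow>
            (\<forall>e\<in>Basis. (\<lambda>t. \<sigma>p t \<bullet> e) \<in> by_quadratures \<gamma> J) \<and>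
            (\<forall>e\<in>Basis. (\<lambda>t. \<sigma>m t \<bullet> e) \<in> by_quadratures \<gamma> J) \<and>
            (\<forall>e\<in>Basis. (\<lambda>z. iota2 \<sigma>p \<sigma>m z \<bullet> e) \<in> by_quadratures2 \<gamma> J) \<and>
            (\<forall>e\<in>Basis. (\<lambda>z. surface_map (iota2 \<sigma>p \<sigma>m) z \<bullet> e) \<in> by_quadratures2 \<gamma> J))))"
proof (intro conjI)
  obtain \<alpha> \<beta> p r q v where id: "t0 \<in> {\<alpha><..<\<beta>}" "{\<alpha><..<\<beta>} \<subseteq> {a<..<b}"
    "initial_data \<gamma> {\<alpha><..<\<beta>} p r q r v"
    "\<And>t1 t2. t1 \<in> {\<alpha><..<\<beta>} \<Longrightarrow> t2 \<in> {\<alpha><..<\<beta>} \<Longrightarrow> p t1 \<noteq> q t2"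
    by (rule initial_data_exists[OF smooth t0]) (use x12 in blast)+
  show "\<exists>\<alpha> \<beta> p p0 q q0 v.
        t0 \<in> {\<alpha><..<\<beta>} \<and> {\<alpha><..<\<beta>} \<subseteq> {a<..<b} \<and>
        initial_data \<gamma> {\<alpha><..<\<beta>} p p0 q q0 v \<and>
        (\<forall>t1\<in>{\<alpha><..<\<beta>}. \<forall>t2\<in>{\<alpha><..<\<beta>}. p t1 \<noteq> q t2)"
    by (rule exI[of _ \<alpha>], rule exI[of _ \<beta>], rule exI[of _ p], rule exI[of _ r], rule exI[of _ q],
        rule exI[of _ r], rule exI[of _ v]) (intro conjI ballI id)
next
  show "\<forall>\<alpha> \<beta> p p0 q q0 v. let J = {\<alpha><..<\<beta>}; \<sigma> = psi \<circ> sigma0 \<gamma> p p0 q q0 v in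
        t0 \<in> J \<longrightarrow> J \<subseteq> {a<..<b} \<longrightarrow> initial_data \<gamma> J p p0 q q0 v \<longrightarrow>
        (\<exists>\<sigma>p \<sigma>m. decomposition J \<sigma> \<sigma>p \<sigma>m) \<and>
        (\<forall>\<sigma>p \<sigma>m \<tau>p \<tau>m. decomposition J \<sigma> \<sigma>p \<sigma>m \<longrightarrow> decomposition J \<sigma> \<tau>p \<tau>m \<longrightarrow>
           (\<exists>cv cy. \<forall>t\<in>J. \<tau>p t = \<sigma>p t + (0, 0, cv, cy) \<and> \<tau>m t = \<sigma>m t - (0, 0, cv, cy)) \<and>
           (\<forall>z\<in>J \<times> J. iota2 \<tau>p \<tau>m z = iota2 \<sigma>p \<sigma>m z)) \<and>
        ((\<forall>t1\<in>J. \<forall>t2\<in>J. p t1 \<noteq> q t2) \<longrightarrow>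
           (\<forall>\<sigma>p \<sigma>m. decomposition J \<sigma> \<sigma>p \<sigma>m \<longrightarrow>
              integral_surface N_region V2 V2_two_forms (J \<times> J) (iota2 \<sigma>p \<sigma>m) \<and>
              (independence (J \<times> J) (iota2 \<sigma>p \<sigma>m) \<longrightarrow>
                 local_isometric_embedding_via (J \<times> J)
                   (\<lambda>z. (u_fun (iota2 \<sigma>p \<sigma>m z), v_fun (iota2 \<sigma>p \<sigma>m z)))
                   (surface_map (iota2 \<sigma>p \<sigma>m)) \<and>
                 \<gamma> ` J \<subseteq> surface_map (iota2 \<sigma>p \<sigma>m) ` (J \<times> J))))"
    unfolding Let_def
  proof (intro allI impI)
    fix \<alpha> \<beta> :: real and p p0 q q0 v
    let ?J = "{\<alpha><..<\<beta>}" and ?\<sigma> = "psi \<circ> sigma0 \<gamma> p p0 q q0 v"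
    assume id: "initial_data \<gamma> ?J p p0 q q0 v"
    have J: "open ?J" by simp
    show "(\<exists>\<sigma>p \<sigma>m. decomposition ?J ?\<sigma> \<sigma>p \<sigma>m) \<and>
        (\<forall>\<sigma>p \<sigma>m \<tau>p \<tau>m. decomposition ?J ?\<sigma> \<sigma>p \<sigma>m \<longrightarrow> decomposition ?J ?\<sigma> \<tau>p \<tau>m \<longrightarrow>
           (\<exists>cv cy. \<forall>t\<in>?J. \<tau>p t = \<sigma>p t + (0, 0, cv, cy) \<and> \<tau>m t = \<sigma>m t - (0, 0, cv, cy)) \<and>
           (\<forall>z\<in>?J \<times> ?J. iota2 \<tau>p \<tau>m z = iota2 \<sigma>p \<sigma>m z)) \<and>
        ((\<forall>t1\<in>?J. \<forall>t2\<in>?J. p t1 \<noteq> q t2) \<longrightarrow>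
           (\<forall>\<sigma>p \<sigma>m. decomposition ?J ?\<sigma> \<sigma>p \<sigma>m \<longrightarrow>
              integral_surface N_region V2 V2_two_forms (?J \<times> ?J) (iota2 \<sigma>p \<sigma>m) \<and>
              (independence (?J \<times> ?J) (iota2 \<sigma>p \<sigma>m) \<longrightarrow>
                 local_isometric_embedding_via (?J \<times> ?J)
                   (\<lambda>z. (u_fun (iota2 \<sigma>p \<sigma>m z), v_fun (iota2 \<sigma>p \<sigma>m z)))
                   (surface_map (iota2 \<sigma>p \<sigma>m)) \<and>
                 \<gamma> ` ?J \<subseteq> surface_map (iota2 \<sigma>p \<sigma>m) ` (?J \<times> ?J))))"
    proof (intro conjI allI impI)
      show "\<exists>\<sigma>p \<sigma>m. decomposition ?J ?\<sigma> \<sigma>p \<sigma>m" by (rule decomposition_exists[OF refl id])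
    next
      fix \<sigma>p \<sigma>m \<tau>p \<tau>m
      assume "decomposition ?J ?\<sigma> \<sigma>p \<sigma>m" "decomposition ?J ?\<sigma> \<tau>p \<tau>m"
      then obtain cv cy where c: "\<And>t. t \<in> ?J \<Longrightarrow>
          \<tau>p t = \<sigma>p t + (0, 0, cv, cy) \<and> \<tau>m t = \<sigma>m t - (0, 0, cv, cy)"
        by (rule decomposition_unique[OF refl]) blast
      then show "\<exists>cv cy. \<forall>t\<in>?J. \<tau>p t = \<sigma>p t + (0, 0, cv, cy) \<and> \<tau>m t = \<sigma>m t - (0, 0, cv, cy)"
        by blast
      show "\<forall>z\<in>?J \<times> ?J. iota2 \<tau>p \<tau>m z = iota2 \<sigma>p \<sigma>m z"
        using c by (auto simp: iota2_def star_shift)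
    next
      fix \<sigma>p \<sigma>m
      assume sep: "\<forall>t1\<in>?J. \<forall>t2\<in>?J. p t1 \<noteq> q t2" and dec: "decomposition ?J ?\<sigma> \<sigma>p \<sigma>m"
      have N: "iota2 \<sigma>p \<sigma>m ` (?J \<times> ?J) \<subseteq> N_region" by (rule iota2_in_N_region[OF J id sep dec])
      have ic: "integral_curve UNIV theta_hat1 ?J \<sigma>p" "integral_curve UNIV theta_hat2 ?J \<sigma>m"
        using dec unfolding decomposition_def by auto
      show "integral_surface N_region V2 V2_two_forms (?J \<times> ?J) (iota2 \<sigma>p \<sigma>m)"
        by (rule integral_surface_iota2[OF J ic N])
      show "local_isometric_embedding_via (?J \<times> ?J)
          (\<lambda>z. (u_fun (iota2 \<sigma>p \<sigma>m z), v_fun (iota2 \<sigma>p \<sigma>m z))) (surface_map (iota2 \<sigma>p \<sigma>m))"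
        if "independence (?J \<times> ?J) (iota2 \<sigma>p \<sigma>m)"
        by (rule local_isometric_embedding_iota2[OF J ic N that])
      show "\<gamma> ` ?J \<subseteq> surface_map (iota2 \<sigma>p \<sigma>m) ` (?J \<times> ?J)"
      proof
        fix x assume "x \<in> \<gamma> ` ?J"
        then obtain t where t: "t \<in> ?J" "x = \<gamma> t" by blast
        then have "iota2 \<sigma>p \<sigma>m (t, t) \<in> N_region" using N by blast
        from surface_map_diagonal[OF dec t(1) this] show "x \<in> surface_map (iota2 \<sigma>p \<sigma>m) ` (?J \<times> ?J)"
          using t by (metis SigmaI image_eqI)
      qed
    qed
  qed
next
  show "(\<forall>t\<in>{a<..<b}.
          - 4 * ((deriv (coord \<gamma> 1) t)^2 - (deriv (coord \<gamma> 2) t)^2 - (deriv (coord \<gamma> 3) t)^2) * t^6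
          + 2 * (deriv (coord \<gamma> 1) t - deriv (coord \<gamma> 2) t)^4
          - (deriv (coord \<gamma> 1) t - deriv (coord \<gamma> 2) t)^3 * (deriv (deriv (coord \<gamma> 1)) t - deriv (deriv (coord \<gamma> 2)) t) * t = 0) \<longrightarrow> (\<exists>\<alpha> \<beta> p p0 q q0 v. let J = {\<alpha><..<\<beta>}; \<sigma> = psi \<circ> sigma0 \<gamma> p p0 q q0 v in
         t0 \<in> J \<and> J \<subseteq> {a<..<b} \<and> initial_data \<gamma> J p p0 q q0 v \<and>
         (\<forall>t1\<in>J. \<forall>t2\<in>J. p t1 \<noteq> q t2) \<and>
         {p, p0, q, q0, v} \<subseteq> by_quadratures \<gamma> J \<and>
         (\<forall>\<sigma>p \<sigma>m. decomposition J \<sigma> \<sigma>p \<sigma>m \<longrightarrow>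
            (\<forall>e\<in>Basis. (\<lambda>t. \<sigma>p t \<bullet> e) \<in> by_quadratures \<gamma> J) \<and>
            (\<forall>e\<in>Basis. (\<lambda>t. \<sigma>m t \<bullet> e) \<in> by_quadratures \<gamma> J) \<and>
            (\<forall>e\<in>Basis. (\<lambda>z. iota2 \<sigma>p \<sigma>m z \<bullet> e) \<in> by_quadratures2 \<gamma> J) \<and>
            (\<forall>e\<in>Basis. (\<lambda>z. surface_map (iota2 \<sigma>p \<sigma>m) z \<bullet> e) \<in> by_quadratures2 \<gamma> J)))"
  proof
    assume rel: "(\<forall>t\<in>{a<..<b}.
          - 4 * ((deriv (coord \<gamma> 1) t)^2 - (deriv (coord \<gamma> 2) t)^2 - (deriv (coord \<gamma> 3) t)^2) * t^6
          + 2 * (deriv (coord \<gamma> 1) t - deriv (coord \<gamma> 2) t)^4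
          - (deriv (coord \<gamma> 1) t - deriv (coord \<gamma> 2) t)^3 * (deriv (deriv (coord \<gamma> 1)) t - deriv (deriv (coord \<gamma> 2)) t) * t = 0)"
    obtain \<alpha> \<beta> p r q v where id: "t0 \<in> {\<alpha><..<\<beta>}" "{\<alpha><..<\<beta>} \<subseteq> {a<..<b}"
      "initial_data \<gamma> {\<alpha><..<\<beta>} p r q r v"
      and sep: "\<And>t1 t2. t1 \<in> {\<alpha><..<\<beta>} \<Longrightarrow> t2 \<in> {\<alpha><..<\<beta>} \<Longrightarrow> p t1 \<noteq> q t2"
      and Q: "{p, r, q, v} \<subseteq> by_quadratures \<gamma> {\<alpha><..<\<beta>}"
      by (rule initial_data_by_quadratures[OF smooth t0]) (use x12 rel in blast)+
    have sep': "\<forall>t1\<in>{\<alpha><..<\<beta>}. \<forall>t2\<in>{\<alpha><..<\<beta>}. p t1 \<noteq> q t2" using sep by blast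
    have Q': "{p, r, q, r} \<subseteq> by_quadratures \<gamma> {\<alpha><..<\<beta>}"
      "{p, r, q, r, v} \<subseteq> by_quadratures \<gamma> {\<alpha><..<\<beta>}" using Q by auto
    note quad = by_quadratures_of_decomposition[OF open_greaterThanLessThan id(3) sep' Q'(1)]
    show "(\<exists>\<alpha> \<beta> p p0 q q0 v. let J = {\<alpha><..<\<beta>}; \<sigma> = psi \<circ> sigma0 \<gamma> p p0 q q0 v in
         t0 \<in> J \<and> J \<subseteq> {a<..<b} \<and> initial_data \<gamma> J p p0 q q0 v \<and>
         (\<forall>t1\<in>J. \<forall>t2\<in>J. p t1 \<noteq> q t2) \<and>
         {p, p0, q, q0, v} \<subseteq> by_quadratures \<gamma> J \<and>
         (\<forall>\<sigma>p \<sigma>m. decomposition J \<sigma> \<sigma>p \<sigma>m \<longrightarrow>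
            (\<forall>e\<in>Basis. (\<lambda>t. \<sigma>p t \<bullet> e) \<in> by_quadratures \<gamma> J) \<and>
            (\<forall>e\<in>Basis. (\<lambda>t. \<sigma>m t \<bullet> e) \<in> by_quadratures \<gamma> J) \<and>
            (\<forall>e\<in>Basis. (\<lambda>z. iota2 \<sigma>p \<sigma>m z \<bullet> e) \<in> by_quadratures2 \<gamma> J) \<and>
            (\<forall>e\<in>Basis. (\<lambda>z. surface_map (iota2 \<sigma>p \<sigma>m) z \<bullet> e) \<in> by_quadratures2 \<gamma> J)))"
      unfolding Let_def
      by (rule exI[of _ \<alpha>], rule exI[of _ \<beta>], rule exI[of _ p], rule exI[of _ r], rule exI[of _ q],
          rule exI[of _ r], rule exI[of _ v], intro conjI allI impI id sep' Q'(2) quad)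
  qed
qed

end
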